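(* Let $v_0$ be an object of an indecomposable admissible component of the root groupoid. For $v,v'\in\mathrm{Sk}(v_0)$ the distance $d(v,v')$, i.e. the minimal number of reflexions in a decomposition of the arrow $v\to v'$ of $\mathrm{Sk}(v_0)$ into a composition of reflexions, equals the cardinality of $\Delta^+_{re}(v)\setminus\Delta^+_{re}(v')$.
   Context: Root groupoid. Fix a finite set $X$. A root datum is a quadruple $v=(\mathfrak h,a,b,p)$ with $\mathfrak h$ a finite-dimensional complex vector space, $a:X\to\mathfrak h$, $b:X\to\mathfrak h^*$ such that the families $(a(x))_{x\in X}$ and $(b(x))_{x\in X}$ are linearly independent, and $p:X\to\mathbb Z_2$; we write $\mathfrak h(v),a_v,b_v,p_v$. Its Cartan matrix is $a_{xy}=\langle a(x),b(y)\rangle$. An element $x\in X$ is reflectable at $v$ if: $a_{xx}=0$ implies $p(x)=1$; if $a_{xx}\ne 0$ and $p(x)=0$ then $2a_{xy}/a_{xx}\in\mathbb Z_{\le 0}$ for all $y\ne x$; if $a_{xx}\neq 0$ and $p(x)=1$ then $a_{xy}/a_{xx}\in\mathbb Z_{\le 0}$ for all $y\ne x$. For $x$ reflectable at $v$ the reflexion $r_x:v\to v'=(\mathfrak h,a',b',p')$ is defined as follows. Anisotropic case $a_{xx}\ne0$: $p'=p$, $a'(y)=a(y)-2\frac{a_{yx}}{a_{xx}}a(x)$, $b'(y)=b(y)-2\frac{a_{xy}}{a_{xx}}b(x)$. Isotropic case $a_{xx}=0$: $(a'(x),b'(x),p'(x))=(-a(x),-b(x),p(x))$; for $y\neq x$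 with $a_{xy}=0$, $(a'(y),b'(y),p'(y))=(a(y),b(y),p(y))$; for $y$ with $a_{xy}\ne0$, $(a'(y),b'(y),p'(y))=(a(y)+\frac{a_{yx}}{a_{xy}}a(x),\,b(y)+b(x),\,1+p(y))$. The root groupoid $\mathcal R$ has the root data as objects; its arrows are generated by reflexions, tautological arrows $t_\theta:(\mathfrak h,a,b,p)\to(\mathfrak h',\theta\circ a,(\theta^* )^{-1}\circ b,p)$ for linear isomorphisms $\theta:\mathfrak h\to\mathfrak h'$, and homotheties $h_\lambda:(\mathfrak h,a,b,p)\to(\mathfrak h,\lambda a,b,p)$ for $\lambda:X\to\mathbb C^*$. Each generator induces a linear isomorphism of the spaces $\mathfrak h$ (the identity for reflexions and homotheties, $\theta$ for $t_\theta$), and two compositions of generators $v\to v'$ are identified iff they induce the same isomorphism $\mathfrak h(v)\to\mathfrak h(v')$. A component is a connected component of $\mathcal R$; it is indecomposable if for $v$ in it there is no partition $X=X_1\sqcup X_2$ into nonempty subsets with $a_{xy}=a_{yx}=0$ for $x\in X_1,y\in X_2$. Admissibility. The half-baked Lie superalgebra $\tilde{\mathfrak g}(v)$ is generated by $\mathfrak h(v)$ (even) and $\tilde e_x,\tilde f_x$ ($x\in X$, of parity $p(x)$) with relations $[\mathfrak h,\mathfrak h]=0$, $[h,\tilde e_x]=\langle b(x),h\rangle\tilde e_x$, $[h,\tilde f_x]=-\langle b(x),h\rangle\tilde f_x$, $[\tilde e_x,\tilde f_y]=0$ for $x\ne y$, $[\tilde e_x,\tilde f_x]=a(x)$. A component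 $\mathcal R_0$ is admissible if there is a collection of quotients $\mathfrak g(v)=\tilde{\mathfrak g}(v)/I(v)$, $v\in\mathcal R_0$, with $I(v)\cap\mathfrak h(v)=0$, such that for each arrow $v\to v'$ in $\mathcal R_0$ the induced isomorphism $\mathfrak h(v)\to\mathfrak h(v')$ extends to an isomorphism $\mathfrak g(v)\to\mathfrak g(v')$. Equivalently: at every $v\in\mathcal R_0$, if $x$ is reflectable at $v$ and $a_{xy}=0$ then $a_{yx}=0$. Skeleton. $\mathrm{Sk}(v_0)$ is the groupoid whose objects are obtained from $v_0$ by chains of reflexions and whose arrows are the compositions of reflexions; between any two objects there is exactly one arrow (it induces the identity of $\mathfrak h=\mathfrak h(v_0)$). Real roots: $\Delta^{re}=\{b_u(x):u\in\mathrm{Sk}(v_0),x\in X\}\subset\mathfrak h^*$. For $u\in\mathrm{Sk}(v_0)$, $\Delta^+_{re}(u)=\Delta^{re}\cap\sum_x\mathbb Z_{\ge0}b_u(x)$. *)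

theory Defs
  imports Complex_Main "HOL-Library.Poly_Mapping" "HOL-Library.Z2" "HOL-Library.Nonpos_Ints"
begin

class complex_vector = ab_group_add +
  fixes scaleC :: "complex \<Rightarrow> 'a \<Rightarrow> 'a" (infixr "*\<^sub>C" 75)
  assumes scaleC_add_right: "c *\<^sub>C (u + w) = c *\<^sub>C u + c *\<^sub>C w"
    and scaleC_add_left: "(c + d) *\<^sub>C u = c *\<^sub>C u + d *\<^sub>C u"
    and scaleC_scaleC: "c *\<^sub>C d *\<^sub>C u = (c * d) *\<^sub>C u"
    and scaleC_one: "1 *\<^sub>C u = u"

lemma vector_space_scaleC: "vector_space (scaleC :: complex \<Rightarrow> 'a \<Rightarrow> 'a::complex_vector)"
  by unfold_locales (simp_all add: scaleC_add_right scaleC_add_left scaleC_scaleC scaleC_one)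

class fd_complex_vector = complex_vector +
  assumes finite_dimensional: "\<exists>B. finite B \<and> (\<forall>u. \<exists>c. u = (\<Sum>b\<in>B. c b *\<^sub>C b))"

text \<open>
  The vector space of a root datum is the type \<open>'h\<close> and its index set is the type \<open>'x\<close>; both are
  arbitrary.  Every root datum in a connected component of the root groupoid is isomorphic, by a
  tautological arrow, to one whose vector space is that of any chosen object, so the components
  below are full subgroupoids meeting every isomorphism class of the original component.
\<close>

record ('h, 'x) root_datum =
  rda :: "'x \<Rightarrow> 'h"
  rdb :: "'x \<Rightarrow> 'h \<Rightarrow> complex"
  rdp :: "'x \<Rightarrow> bit"

definition is_root_datum :: "('h::fd_complex_vector, 'x::finite) root_datum \<Rightarrow> bool" where
  "is_root_datum v \<longleftrightarrow>
     (\<forall>x. Vector_Spaces.linear scaleC (*) (rdb v x)) \<and>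
     (\<forall>c. (\<Sum>x\<in>UNIV. c x *\<^sub>C rda v x) = 0 \<longrightarrow> (\<forall>x. c x = 0)) \<and>
     (\<forall>c. (\<forall>h. (\<Sum>x\<in>UNIV. c x * rdb v x h) = 0) \<longrightarrow> (\<forall>x. c x = 0))"

definition cartan :: "('h, 'x) root_datum \<Rightarrow> 'x \<Rightarrow> 'x \<Rightarrow> complex" where
  "cartan v x y = rdb v y (rda v x)"

definition reflectable :: "('h, 'x) root_datum \<Rightarrow> 'x \<Rightarrow> bool" where
  "reflectable v x \<longleftrightarrow>
     (cartan v x x = 0 \<longrightarrow> rdp v x = 1) \<and>
     (cartan v x x \<noteq> 0 \<and> rdp v x = 0 \<longrightarrow>
        (\<forall>y. y \<noteq> x \<longrightarrow> 2 * cartan v x y / cartan v x x \<in> nonpos_Ints)) \<and>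
     (cartan v x x \<noteq> 0 \<and> rdp v x = 1 \<longrightarrow>
        (\<forall>y. y \<noteq> x \<longrightarrow> cartan v x y / cartan v x x \<in> nonpos_Ints))"

definition reflexion ::
  "'x \<Rightarrow> ('h::fd_complex_vector, 'x) root_datum \<Rightarrow> ('h, 'x) root_datum" where
  "reflexion x v =
     (if cartan v x x \<noteq> 0 then
        \<lparr> rda = (\<lambda>y. rda v y - (2 * cartan v y x / cartan v x x) *\<^sub>C rda v x),
          rdb = (\<lambda>y h. rdb v y h - (2 * cartan v x y / cartan v x x) * rdb v x h),
          rdp = rdp v \<rparr>
      else
        \<lparr> rda = (\<lambda>y. if y = x then - rda v x
                     else if cartan v x y = 0 then rda v y
                     else rda v y + (cartan v y x / cartan v x y) *\<^sub>C rda v x),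
          rdb = (\<lambda>y. if y = x then (\<lambda>h. - rdb v x h)
                     else if cartan v x y = 0 then rdb v y
                     else (\<lambda>h. rdb v y h + rdb v x h)),
          rdp = (\<lambda>y. if y = x then rdp v x
                     else if cartan v x y = 0 then rdp v y
                     else 1 + rdp v y) \<rparr>)"

definition taut :: "('h \<Rightarrow> 'h) \<Rightarrow> ('h, 'x) root_datum \<Rightarrow> ('h, 'x) root_datum" where
  "taut \<theta> v = \<lparr> rda = (\<lambda>x. \<theta> (rda v x)), rdb = (\<lambda>x h. rdb v x (inv \<theta> h)), rdp = rdp v \<rparr>"

definition homothety ::
  "('x \<Rightarrow> complex) \<Rightarrow> ('h::fd_complex_vector, 'x) root_datum \<Rightarrow> ('h, 'x) root_datum" where
  "homothety c v = \<lparr> rda = (\<lambda>x. c x *\<^sub>C rda v x), rdb = rdb v, rdp = rdp v \<rparr>"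

text \<open>An arrow from \<open>v\<close> to \<open>v'\<close> is determined by the isomorphism \<open>\<phi>\<close> of vector spaces it induces.\<close>

inductive arrow ::
  "('h::fd_complex_vector, 'x::finite) root_datum \<Rightarrow> ('h \<Rightarrow> 'h) \<Rightarrow> ('h, 'x) root_datum \<Rightarrow> bool"
where
  arrow_id: "is_root_datum v \<Longrightarrow> arrow v id v"
| arrow_reflexion: "is_root_datum v \<Longrightarrow> reflectable v x \<Longrightarrow> arrow v id (reflexion x v)"
| arrow_taut: "is_root_datum v \<Longrightarrow> Vector_Spaces.linear scaleC scaleC \<theta> \<Longrightarrow> bij \<theta> \<Longrightarrow>
    arrow v \<theta> (taut \<theta> v)"
| arrow_homothety: "is_root_datum v \<Longrightarrow> (\<And>x. c x \<noteq> 0) \<Longrightarrow> arrow v id (homothety c v)"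
| arrow_comp: "arrow u \<phi> v \<Longrightarrow> arrow v \<psi> w \<Longrightarrow> arrow u (\<psi> \<circ> \<phi>) w"
| arrow_inv: "arrow v \<phi> w \<Longrightarrow> arrow w (inv \<phi>) v"

definition component ::
  "('h::fd_complex_vector, 'x::finite) root_datum \<Rightarrow> ('h, 'x) root_datum set" where
  "component v = {w. \<exists>\<phi>. arrow v \<phi> w}"

definition indecomposable :: "('h, 'x) root_datum set \<Rightarrow> bool" where
  "indecomposable R \<longleftrightarrow>
     (\<forall>v\<in>R. \<not> (\<exists>X1 X2. X1 \<union> X2 = UNIV \<and> X1 \<inter> X2 = {} \<and> X1 \<noteq> {} \<and> X2 \<noteq> {} \<and>
        (\<forall>x\<in>X1. \<forall>y\<in>X2. cartan v x y = 0 \<and> cartan v y x = 0)))"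

record 'g superalg =
  sa_carrier :: "'g set"
  sa_zero :: 'g
  sa_add :: "'g \<Rightarrow> 'g \<Rightarrow> 'g"
  sa_scale :: "complex \<Rightarrow> 'g \<Rightarrow> 'g"
  sa_bracket :: "'g \<Rightarrow> 'g \<Rightarrow> 'g"
  sa_part :: "bit \<Rightarrow> 'g set"

definition graded_ideal :: "'g superalg \<Rightarrow> 'g set \<Rightarrow> bool" where
  "graded_ideal L I \<longleftrightarrow>
     I \<subseteq> sa_carrier L \<and> sa_zero L \<in> I \<and>
     (\<forall>s\<in>I. \<forall>t\<in>I. sa_add L s t \<in> I) \<and>
     (\<forall>c. \<forall>s\<in>I. sa_scale L c s \<in> I) \<and>
     (\<forall>s\<in>I. \<forall>t\<in>sa_carrier L. sa_bracket L s t \<in> I \<and> sa_bracket L t s \<in> I) \<and>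
     (\<forall>s\<in>I. \<exists>s0 \<in> I \<inter> sa_part L 0. \<exists>s1 \<in> I \<inter> sa_part L 1. s = sa_add L s0 s1)"

definition coset :: "'g superalg \<Rightarrow> 'g set \<Rightarrow> 'g \<Rightarrow> 'g set" where
  "coset L I s = sa_add L s ` I"

text \<open>For a graded ideal \<open>I\<close>, the operations below are the induced ones on cosets of \<open>I\<close>.\<close>

definition quotient_alg :: "'g superalg \<Rightarrow> 'g set \<Rightarrow> 'g set superalg" where
  "quotient_alg L I =
     \<lparr> sa_carrier = coset L I ` sa_carrier L,
       sa_zero = I,
       sa_add = (\<lambda>S T. \<Union>s\<in>S. \<Union>t\<in>T. coset L I (sa_add L s t)),
       sa_scale = (\<lambda>c S. \<Union>s\<in>S. coset L I (sa_scale L c s)),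
       sa_bracket = (\<lambda>S T. \<Union>s\<in>S. \<Union>t\<in>T. coset L I (sa_bracket L s t)),
       sa_part = (\<lambda>i. coset L I ` sa_part L i) \<rparr>"

definition superalg_iso :: "'g superalg \<Rightarrow> 'k superalg \<Rightarrow> ('g \<Rightarrow> 'k) \<Rightarrow> bool" where
  "superalg_iso L M \<psi> \<longleftrightarrow>
     bij_betw \<psi> (sa_carrier L) (sa_carrier M) \<and>
     (\<forall>s\<in>sa_carrier L. \<forall>t\<in>sa_carrier L. \<psi> (sa_add L s t) = sa_add M (\<psi> s) (\<psi> t)) \<and>
     (\<forall>c. \<forall>s\<in>sa_carrier L. \<psi> (sa_scale L c s) = sa_scale M c (\<psi> s)) \<and>
     (\<forall>s\<in>sa_carrier L. \<forall>t\<in>sa_carrier L. \<psi> (sa_bracket L s t) = sa_bracket M (\<psi> s) (\<psi> t)) \<and>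
     (\<forall>i. \<psi> ` sa_part L i = sa_part M i)"

datatype ('h, 'x) gen = GenH 'h | GenE 'x | GenF 'x

datatype 'g monomial = Leaf 'g | Node "'g monomial" "'g monomial"

primrec gen_parity :: "('h, 'x) root_datum \<Rightarrow> ('h, 'x) gen \<Rightarrow> bit" where
  "gen_parity v (GenH h) = 0"
| "gen_parity v (GenE x) = rdp v x"
| "gen_parity v (GenF x) = rdp v x"

primrec parity :: "('h, 'x) root_datum \<Rightarrow> ('h, 'x) gen monomial \<Rightarrow> bit" where
  "parity v (Leaf g) = gen_parity v g"
| "parity v (Node s t) = parity v s + parity v t"

type_synonym ('h, 'x) free = "('h, 'x) gen monomial \<Rightarrow>\<^sub>0 complex"

definition free_scale :: "complex \<Rightarrow> ('h, 'x) free \<Rightarrow> ('h, 'x) free" where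
  "free_scale c u = Poly_Mapping.map ((*) c) u"

definition free_bracket :: "('h, 'x) free \<Rightarrow> ('h, 'x) free \<Rightarrow> ('h, 'x) free" where
  "free_bracket u w =
     (\<Sum>s\<in>Poly_Mapping.keys u. \<Sum>t\<in>Poly_Mapping.keys w.
        Poly_Mapping.single (Node s t) (Poly_Mapping.lookup u s * Poly_Mapping.lookup w t))"

definition free_part :: "('h, 'x) root_datum \<Rightarrow> bit \<Rightarrow> ('h, 'x) free set" where
  "free_part v i = {u. \<forall>t\<in>Poly_Mapping.keys u. parity v t = i}"

text \<open>
  The free nonassociative superalgebra on the elements of the vector space (as even generators,
  not yet subject to linearity), the \<open>e\<^sub>x\<close> and the \<open>f\<^sub>x\<close>.
\<close>

definition free_alg :: "('h, 'x) root_datum \<Rightarrow> ('h, 'x) free superalg" where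
  "free_alg v =
     \<lparr> sa_carrier = UNIV, sa_zero = 0, sa_add = (+), sa_scale = free_scale,
       sa_bracket = free_bracket, sa_part = free_part v \<rparr>"

abbreviation genH :: "'h \<Rightarrow> ('h, 'x) free" where
  "genH h \<equiv> Poly_Mapping.single (Leaf (GenH h)) 1"
abbreviation genE :: "'x \<Rightarrow> ('h, 'x) free" where
  "genE x \<equiv> Poly_Mapping.single (Leaf (GenE x)) 1"
abbreviation genF :: "'x \<Rightarrow> ('h, 'x) free" where
  "genF x \<equiv> Poly_Mapping.single (Leaf (GenF x)) 1"

definition super_sign :: "bit \<Rightarrow> bit \<Rightarrow> complex" where
  "super_sign i j = (if i = 1 \<and> j = 1 then - 1 else 1)"

inductive_set relators :: "('h::fd_complex_vector, 'x) root_datum \<Rightarrow> ('h, 'x) free set"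
  for v :: "('h, 'x) root_datum"
where
  super_antisymmetry: "r \<in> free_part v i \<Longrightarrow> s \<in> free_part v j \<Longrightarrow>
    free_bracket r s + free_scale (super_sign i j) (free_bracket s r) \<in> relators v"
| super_Jacobi: "r \<in> free_part v i \<Longrightarrow> s \<in> free_part v j \<Longrightarrow> t \<in> free_part v k \<Longrightarrow>
    free_bracket r (free_bracket s t) - free_bracket (free_bracket r s) t
      - free_scale (super_sign i j) (free_bracket s (free_bracket r t)) \<in> relators v"
| H_add: "genH (h + h') - genH h - genH h' \<in> relators v"
| H_scale: "genH (c *\<^sub>C h) - free_scale c (genH h) \<in> relators v"
| HH: "free_bracket (genH h) (genH h') \<in> relators v"
| HE: "free_bracket (genH h) (genE x) - free_scale (rdb v x h) (genE x) \<in> relators v"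
| HF: "free_bracket (genH h) (genF x) + free_scale (rdb v x h) (genF x) \<in> relators v"
| EF_distinct: "x \<noteq> y \<Longrightarrow> free_bracket (genE x) (genF y) \<in> relators v"
| EF_same: "free_bracket (genE x) (genF x) - genH (rda v x) \<in> relators v"

definition relation_ideal :: "('h::fd_complex_vector, 'x) root_datum \<Rightarrow> ('h, 'x) free set" where
  "relation_ideal v = \<Inter> {K. graded_ideal (free_alg v) K \<and> relators v \<subseteq> K}"

definition half_baked :: "('h::fd_complex_vector, 'x) root_datum \<Rightarrow> ('h, 'x) free set superalg" where
  "half_baked v = quotient_alg (free_alg v) (relation_ideal v)"

definition half_baked_h :: "('h::fd_complex_vector, 'x) root_datum \<Rightarrow> 'h \<Rightarrow> ('h, 'x) free set" where
  "half_baked_h v h = coset (free_alg v) (relation_ideal v) (genH h)"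

text \<open>
  The condition that \<open>I v\<close> meets the vector space trivially is stated for the vectors themselves,
  mapped to the half-baked algebra by \<open>half_baked_h\<close>.
\<close>

definition admissible :: "('h::fd_complex_vector, 'x::finite) root_datum set \<Rightarrow> bool" where
  "admissible R \<longleftrightarrow>
     (\<exists>I. (\<forall>v\<in>R. graded_ideal (half_baked v) (I v) \<and>
             (\<forall>h. half_baked_h v h \<in> I v \<longrightarrow> h = 0)) \<and>
          (\<forall>v\<in>R. \<forall>v'\<in>R. \<forall>\<phi>. arrow v \<phi> v' \<longrightarrow>
             (\<exists>\<psi>. superalg_iso (quotient_alg (half_baked v) (I v))
                               (quotient_alg (half_baked v') (I v')) \<psi> \<and>
                  (\<forall>h. \<psi> (coset (half_baked v) (I v) (half_baked_h v h)) =
                       coset (half_baked v') (I v') (half_baked_h v' (\<phi> h))))))"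

definition reflexion_step ::
  "(('h::fd_complex_vector, 'x) root_datum \<times> ('h, 'x) root_datum) set" where
  "reflexion_step = {(v, reflexion x v) | v x. reflectable v x}"

definition Sk :: "('h::fd_complex_vector, 'x) root_datum \<Rightarrow> ('h, 'x) root_datum set" where
  "Sk v0 = reflexion_step\<^sup>* `` {v0}"

text \<open>
  Any two objects of \<open>Sk v0\<close> are joined by a unique arrow of \<open>Sk v0\<close>, so every chain of reflexions
  from \<open>v\<close> to \<open>v'\<close> is a decomposition of that arrow.
\<close>

definition sk_dist ::
  "('h::fd_complex_vector, 'x) root_datum \<Rightarrow> ('h, 'x) root_datum \<Rightarrow> nat" where
  "sk_dist v v' = (LEAST n. (v, v') \<in> reflexion_step ^^ n)"

definition real_roots :: "('h::fd_complex_vector, 'x) root_datum \<Rightarrow> ('h \<Rightarrow> complex) set" where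
  "real_roots v0 = {rdb u x | u x. u \<in> Sk v0}"

definition pos_real_roots ::
  "('h::fd_complex_vector, 'x::finite) root_datum \<Rightarrow> ('h, 'x) root_datum \<Rightarrow> ('h \<Rightarrow> complex) set"
where
  "pos_real_roots v0 u =
     real_roots v0 \<inter> {\<alpha>. \<exists>n :: 'x \<Rightarrow> nat. \<alpha> = (\<lambda>h. \<Sum>x\<in>UNIV. of_nat (n x) * rdb u x h)}"

end

theory Submission
  imports Defs
begin

text \<open>
  Admissibility forces three facts: every real root is a nonnegative or a nonpositive integral
  combination of the simple roots of each object, a simple root determines its coroot up to a scalar,
  and reflectability of \<open>x\<close> makes \<open>a\<^sub>x\<^sub>y = 0\<close> imply \<open>a\<^sub>y\<^sub>x = 0\<close>.  They follow from the
  weight spaces of \<open>\<gg>(v)\<close> (triangular decomposition), transported along the isomorphisms that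
  extend the identity of the vector space.  Consequently a reflexion at \<open>x\<close> only exchanges \<open>b(x)\<close> for
  \<open>- b(x)\<close> among the positive real roots, which bounds the distance below.

  For the upper bound fix the target \<open>t\<close> and walk from \<open>v\<close> only across walls separating \<open>v\<close> from \<open>t\<close>;
  such walls are always reflectable, and every step removes one separating root.  This rewriting is locally
  confluent: starting with \<open>x\<close> or with \<open>y\<close> and alternating, one flips all positive roots in the span of
  \<open>b(x)\<close> and \<open>b(y)\<close>, and the two resulting objects coincide exactly, the labels being determined by the
  number of these roots and the coroots by a symmetrizer of the rank two Cartan matrix.  By Newman's lemma
  and symmetry of reflexions, every walk ends in \<open>t\<close>.
\<close>

section \<open>Quotients of the free superalgebra\<close>

text \<open>A walk across separating walls clearly stops, but a priori only at some object with the
  positive roots of \<open>t\<close>. That object might differ from \<open>t\<close> by a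
  permutation of the labels or by rescaled coroots. Isotropic reflexions need not come from
  symmetries of the set of roots, so no simply transitive group action is at hand to exclude this.
  Confluence excludes it: every reflexion, read in one of its two directions, is a step toward
  \<open>t\<close>, so neighbouring objects have the same end of walk, and a chain starting at
  \<open>t\<close> shows that this end is \<open>t\<close>. No classification of rank two data is
  used. The alternation ends because each root it flips is negative at \<open>t\<close> and only
  finitely many roots separate two objects. The recurring device is that a root has coefficients of
  one sign over the simple roots of every object: comparing two expansions then forces coefficients
  to vanish or a matrix to be a permutation matrix.\<close>

lemma lookup_free_scale [simp]:
  "Poly_Mapping.lookup (free_scale c u) k = c * Poly_Mapping.lookup u k"
  unfolding free_scale_def by (simp add: Poly_Mapping.map.rep_eq when_def)

text \<open>A tree is a \<open>Node\<close> in at most one way, so at each monomial at most one term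
  of the double sum survives. Bilinearity can then be checked coefficient by coefficient, without
  tracking supports.\<close>

lemma lookup_free_bracket:
  "Poly_Mapping.lookup (free_bracket u w) k =
     (case k of Leaf _ \<Rightarrow> 0 | Node s t \<Rightarrow> Poly_Mapping.lookup u s * Poly_Mapping.lookup w t)"
proof -
  have "Poly_Mapping.lookup (free_bracket u w) k =
     (\<Sum>s\<in>Poly_Mapping.keys u. \<Sum>t\<in>Poly_Mapping.keys w.
        (Poly_Mapping.lookup u s * Poly_Mapping.lookup w t) when Node s t = k)"
    by (simp add: free_bracket_def lookup_sum lookup_single)
  also have "\<dots> = (case k of Leaf _ \<Rightarrow> 0
     | Node s t \<Rightarrow> Poly_Mapping.lookup u s * Poly_Mapping.lookup w t)"
  proof (cases k)
    case (Node a b)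
    have "(\<Sum>s\<in>Poly_Mapping.keys u. \<Sum>t\<in>Poly_Mapping.keys w.
        (Poly_Mapping.lookup u s * Poly_Mapping.lookup w t) when Node s t = k)
      = (\<Sum>s\<in>Poly_Mapping.keys u. if s = a then
          (\<Sum>t\<in>Poly_Mapping.keys w. if t = b then
             Poly_Mapping.lookup u s * Poly_Mapping.lookup w t else 0) else 0)"
      by (intro sum.cong refl) (auto simp: Node when_def intro!: sum.cong)
    also have "\<dots> = Poly_Mapping.lookup u a * Poly_Mapping.lookup w b"
      by (simp add: sum.delta in_keys_iff)
    finally show ?thesis by (simp add: Node)
  qed simp
  finally show ?thesis .
qed

lemma free_bracket_add_left: "free_bracket (s + s') t = free_bracket s t + free_bracket s' t"
  by (rule poly_mapping_eqI)
     (simp add: lookup_free_bracket lookup_add algebra_simps split: monomial.split)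

lemma free_bracket_add_right: "free_bracket s (t + t') = free_bracket s t + free_bracket s t'"
  by (rule poly_mapping_eqI)
     (simp add: lookup_free_bracket lookup_add algebra_simps split: monomial.split)

lemma free_bracket_diff_left: "free_bracket (s - s') t = free_bracket s t - free_bracket s' t"
  by (rule poly_mapping_eqI)
     (simp add: lookup_free_bracket lookup_minus algebra_simps split: monomial.split)

lemma free_bracket_diff_right: "free_bracket s (t - t') = free_bracket s t - free_bracket s t'"
  by (rule poly_mapping_eqI)
     (simp add: lookup_free_bracket lookup_minus algebra_simps split: monomial.split)

lemma free_bracket_scale_left:
  "free_bracket (free_scale c s) t = free_scale c (free_bracket s t)"
  by (rule poly_mapping_eqI) (simp add: lookup_free_bracket split: monomial.split)

lemma free_bracket_scale_right:
  "free_bracket s (free_scale c t) = free_scale c (free_bracket s t)"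
  by (rule poly_mapping_eqI) (simp add: lookup_free_bracket split: monomial.split)

lemma free_bracket_zero [simp]: "free_bracket 0 t = 0" "free_bracket s 0 = 0"
  by (rule poly_mapping_eqI, simp add: lookup_free_bracket split: monomial.split)+

lemma free_bracket_sum_right: "free_bracket s (\<Sum>i\<in>A. g i) = (\<Sum>i\<in>A. free_bracket s (g i))"
  by (induction A rule: infinite_finite_induct) (simp_all add: free_bracket_add_right)

lemma free_bracket_single:
  "free_bracket (Poly_Mapping.single s 1) (Poly_Mapping.single t 1) = Poly_Mapping.single (Node s t) 1"
  by (rule poly_mapping_eqI)
     (auto simp: lookup_free_bracket lookup_single when_def split: monomial.split)

lemma free_scale_add_right: "free_scale c (s + t) = free_scale c s + free_scale c t"
  by (rule poly_mapping_eqI) (simp add: lookup_add algebra_simps)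

lemma free_scale_diff_right: "free_scale c (s - t) = free_scale c s - free_scale c t"
  by (rule poly_mapping_eqI) (simp add: lookup_minus algebra_simps)

lemma free_scale_add_left: "free_scale (c + d) s = free_scale c s + free_scale d s"
  by (rule poly_mapping_eqI) (simp add: lookup_add algebra_simps)

lemma free_scale_diff_left: "free_scale (c - d) s = free_scale c s - free_scale d s"
  by (rule poly_mapping_eqI) (simp add: lookup_minus algebra_simps)

lemma free_scale_scale [simp]: "free_scale c (free_scale d s) = free_scale (c * d) s"
  by (rule poly_mapping_eqI) simp

lemma free_scale_simps [simp]:
  "free_scale 1 s = s" "free_scale 0 s = 0" "free_scale c 0 = 0"
  "free_scale (- c) s = - free_scale c s"
  by (rule poly_mapping_eqI, simp)+

lemma free_scale_sum: "free_scale c (\<Sum>i\<in>A. g i) = (\<Sum>i\<in>A. free_scale c (g i))"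
  by (induction A rule: infinite_finite_induct) (simp_all add: free_scale_add_right)

lemma free_induct [case_names zero add]:
  assumes "P 0" and "\<And>s t c. P s \<Longrightarrow> P (s + free_scale c (Poly_Mapping.single t 1))"
  shows "P (u :: ('h, 'x) free)"
proof -
  have "P (\<Sum>t\<in>A. free_scale (c t) (Poly_Mapping.single t 1))"
    for A and c :: "('h, 'x) gen monomial \<Rightarrow> complex"
    by (induction A rule: infinite_finite_induct) (auto simp: assms add.commute[of "free_scale _ _"])
  moreover have "u = (\<Sum>t\<in>Poly_Mapping.keys u.
      free_scale (Poly_Mapping.lookup u t) (Poly_Mapping.single t 1))"
    by (rule poly_mapping_eqI)
       (simp add: lookup_sum lookup_single when_def in_keys_iff if_distrib sum.delta cong: if_cong)
  ultimately show ?thesis by metis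
qed

text \<open>
  The ideals that occur as kernels of the projection of the free superalgebra onto \<open>\<gg>(v)\<close>; working with them
  keeps all computations in the type of the free superalgebra.
\<close>

definition lie_ideal :: "('h::fd_complex_vector, 'x) root_datum \<Rightarrow> ('h, 'x) free set \<Rightarrow> bool" where
  "lie_ideal v J \<longleftrightarrow> 0 \<in> J \<and> (\<forall>s\<in>J. \<forall>t\<in>J. s + t \<in> J) \<and> (\<forall>c. \<forall>s\<in>J. free_scale c s \<in> J) \<and>
     (\<forall>s\<in>J. \<forall>t. free_bracket s t \<in> J \<and> free_bracket t s \<in> J) \<and> relators v \<subseteq> J \<and>
     (\<forall>h. genH h \<in> J \<longrightarrow> h = 0)"

text \<open>A choice of representatives for an injective homomorphism of quotients that is the identity on vectors.\<close>

definition ideal_hom ::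
  "('h, 'x) free set \<Rightarrow> ('h, 'x) free set \<Rightarrow> (('h, 'x) free \<Rightarrow> ('h, 'x) free) \<Rightarrow> bool" where
  "ideal_hom J J' f \<longleftrightarrow>
     (\<forall>s t. f (s + t) - (f s + f t) \<in> J') \<and>
     (\<forall>c s. f (free_scale c s) - free_scale c (f s) \<in> J') \<and>
     (\<forall>s t. f (free_bracket s t) - free_bracket (f s) (f t) \<in> J') \<and>
     (\<forall>h. f (genH h) - genH h \<in> J') \<and> (\<forall>s. f s \<in> J' \<longleftrightarrow> s \<in> J)"

lemma relation_ideal_props:
  "0 \<in> relation_ideal v" "s \<in> relation_ideal v \<Longrightarrow> t \<in> relation_ideal v \<Longrightarrow> s + t \<in> relation_ideal v"
  "s \<in> relation_ideal v \<Longrightarrow> free_scale c s \<in> relation_ideal v"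
  "s \<in> relation_ideal v \<Longrightarrow> free_bracket s u \<in> relation_ideal v"
  "s \<in> relation_ideal v \<Longrightarrow> free_bracket u s \<in> relation_ideal v"
  "relators v \<subseteq> relation_ideal v"
  by (auto simp: relation_ideal_def graded_ideal_def free_alg_def)

section \<open>From two successive quotients to one ideal of the free superalgebra\<close>

locale ideal_chain =
  fixes v :: "('h::fd_complex_vector, 'x) root_datum" and I
  assumes I: "graded_ideal (half_baked v) I"
    and I_h: "\<And>h. half_baked_h v h \<in> I \<Longrightarrow> h = 0"
begin

text \<open>\<open>q\<close> projects onto the half-baked algebra and \<open>cl\<close> onto its
  quotient by \<open>I\<close>, whose elements are sets of sets; \<open>J\<close> is the kernel of
  \<open>cl\<close> in the free superalgebra.\<close>

definition q where "q u = coset (free_alg v) (relation_ideal v) u"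
definition J where "J = {u. q u \<in> I}"
definition cl where "cl u = coset (half_baked v) I (q u)"

lemma q_eq_iff: "q u = q w \<longleftrightarrow> u - w \<in> relation_ideal v"
proof
  assume "q u = q w"
  moreover have "u \<in> q u"
    using relation_ideal_props(1)[of v] by (force simp: q_def coset_def free_alg_def)
  ultimately obtain r where "r \<in> relation_ideal v" "u = w + r"
    by (auto simp: q_def coset_def free_alg_def)
  then show "u - w \<in> relation_ideal v" by simp
next
  have sub: "q u \<subseteq> q w" if "u - w \<in> relation_ideal v" for u w
  proof
    fix s assume "s \<in> q u"
    then obtain r where r: "r \<in> relation_ideal v" "s = u + r"
      by (auto simp: q_def coset_def free_alg_def)
    have "s = w + ((u - w) + r)" using r by simp
    moreover have "w + ((u - w) + r) \<in> (+) w ` relation_ideal v"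
      using relation_ideal_props(2)[OF that r(1)] by (rule imageI)
    ultimately show "s \<in> q w" by (simp add: q_def coset_def free_alg_def)
  qed
  assume "u - w \<in> relation_ideal v"
  moreover from relation_ideal_props(3)[OF this, of "-1"] have "w - u \<in> relation_ideal v" by simp
  ultimately show "q u = q w" using sub by blast
qed

lemma q_ne: "u \<in> q u"
  using relation_ideal_props(1)[of v] by (force simp: q_def coset_def free_alg_def)

lemma q_self: "s \<in> q u \<Longrightarrow> q s = q u"
  unfolding q_eq_iff by (auto simp: q_def coset_def free_alg_def)

lemma half_baked_simps:
  "sa_carrier (half_baked v) = range q" "sa_zero (half_baked v) = q 0"
  "sa_add (half_baked v) (q s) (q t) = q (s + t)"
  "sa_scale (half_baked v) c (q s) = q (free_scale c s)"
  "sa_bracket (half_baked v) (q s) (q t) = q (free_bracket s t)"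
proof -
  show "sa_carrier (half_baked v) = range q"
    by (simp add: half_baked_def quotient_alg_def free_alg_def q_def[abs_def])
  show "sa_zero (half_baked v) = q 0"
    by (simp add: half_baked_def quotient_alg_def free_alg_def q_def coset_def)
  have q: "coset (free_alg v) (relation_ideal v) s = q s" for s by (simp add: q_def)
  \<comment> \<open>Operations on cosets are unions over all representatives. The terms do not
    depend on the representatives, so each union is over a constant nonempty family.\<close>
  have eq: "q (s' + t') = q (s + t)" "q (free_scale c s') = q (free_scale c s)"
    "q (free_bracket s' t') = q (free_bracket s t)"
    if "s' \<in> q s" "t' \<in> q t" for s' t'
  proof -
    have d: "s' - s \<in> relation_ideal v" "t' - t \<in> relation_ideal v"
      using that q_self q_eq_iff by blast+
    have 1: "s' + t' - (s + t) = (s' - s) + (t' - t)" by simp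
    have 2: "free_bracket s' t' - free_bracket s t
      = free_bracket (s' - s) t' + free_bracket s (t' - t)"
      by (simp add: free_bracket_diff_left free_bracket_diff_right)
    show "q (s' + t') = q (s + t)" unfolding q_eq_iff 1
      by (intro relation_ideal_props d)
    show "q (free_scale c s') = q (free_scale c s)" unfolding q_eq_iff
      using relation_ideal_props(3)[OF d(1), of c] by (simp add: free_scale_diff_right)
    show "q (free_bracket s' t') = q (free_bracket s t)" unfolding q_eq_iff 2
      by (intro relation_ideal_props d)
  qed
  have "sa_add (half_baked v) (q s) (q t) = (\<Union>s'\<in>q s. \<Union>t'\<in>q t. q (s' + t'))"
    by (simp add: half_baked_def quotient_alg_def q) (simp add: free_alg_def)
  also have "\<dots> = (\<Union>s'\<in>q s. \<Union>t'\<in>q t. q (s + t))" using eq by (intro SUP_cong refl) blast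
  also have "\<dots> = q (s + t)" using q_ne by blast
  finally show "sa_add (half_baked v) (q s) (q t) = q (s + t)" .
  have "sa_bracket (half_baked v) (q s) (q t) = (\<Union>s'\<in>q s. \<Union>t'\<in>q t. q (free_bracket s' t'))"
    by (simp add: half_baked_def quotient_alg_def q) (simp add: free_alg_def)
  also have "\<dots> = (\<Union>s'\<in>q s. \<Union>t'\<in>q t. q (free_bracket s t))"
    using eq by (intro SUP_cong refl) blast
  also have "\<dots> = q (free_bracket s t)" using q_ne by blast
  finally show "sa_bracket (half_baked v) (q s) (q t) = q (free_bracket s t)" .
  have "sa_scale (half_baked v) c (q s) = (\<Union>s'\<in>q s. q (free_scale c s'))"
    by (simp add: half_baked_def quotient_alg_def q) (simp add: free_alg_def)
  also have "\<dots> = (\<Union>s'\<in>q s. q (free_scale c s))" using eq q_ne by (intro SUP_cong refl) blast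
  also have "\<dots> = q (free_scale c s)" using q_ne by blast
  finally show "sa_scale (half_baked v) c (q s) = q (free_scale c s)" .
qed

lemma I_eq: "I = q ` J"
proof -
  have "I \<subseteq> range q" using I unfolding graded_ideal_def half_baked_simps by (rule conjunct1)
  then show ?thesis by (auto simp: J_def)
qed

lemma J_ideal:
  "0 \<in> J" "s \<in> J \<Longrightarrow> t \<in> J \<Longrightarrow> s + t \<in> J" "s \<in> J \<Longrightarrow> free_scale c s \<in> J"
  "s \<in> J \<Longrightarrow> free_bracket s u \<in> J" "s \<in> J \<Longrightarrow> free_bracket u s \<in> J"
proof -
  have *: "q 0 \<in> I" "\<forall>s\<in>I. \<forall>t\<in>I. sa_add (half_baked v) s t \<in> I"
    "\<forall>c. \<forall>s\<in>I. sa_scale (half_baked v) c s \<in> I"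
    "\<forall>s\<in>I. \<forall>t\<in>range q. sa_bracket (half_baked v) s t \<in> I \<and> sa_bracket (half_baked v) t s \<in> I"
    using I unfolding graded_ideal_def half_baked_simps by blast+
  show "0 \<in> J" using * by (simp add: J_def)
  show "s \<in> J \<Longrightarrow> t \<in> J \<Longrightarrow> s + t \<in> J" using *(2) half_baked_simps(3) by (force simp: J_def)
  show "s \<in> J \<Longrightarrow> free_scale c s \<in> J" using *(3) half_baked_simps(4) by (force simp: J_def)
  show "s \<in> J \<Longrightarrow> free_bracket s u \<in> J" using *(4) half_baked_simps(5) by (force simp: J_def)
  show "s \<in> J \<Longrightarrow> free_bracket u s \<in> J" using *(4) half_baked_simps(5) by (force simp: J_def)
qed

lemma relation_ideal_J: "relation_ideal v \<subseteq> J"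
proof
  fix s assume "s \<in> relation_ideal v"
  then have "q s = q 0" by (simp add: q_eq_iff)
  then show "s \<in> J" using J_ideal(1) by (simp add: J_def)
qed

lemma lie_ideal_J: "lie_ideal v J"
proof -
  have "h = 0" if "genH h \<in> J" for h
    using that I_h[of h] by (simp add: J_def half_baked_h_def q_def)
  then show ?thesis
    unfolding lie_ideal_def
    using J_ideal order_trans[OF relation_ideal_props(6)[of v] relation_ideal_J] by simp
qed

lemma cl_alt: "cl u = (\<lambda>j. q (u + j)) ` J"
proof -
  have "cl u = sa_add (half_baked v) (q u) ` I" by (simp only: cl_def coset_def)
  also have "sa_add (half_baked v) (q u) ` I = sa_add (half_baked v) (q u) ` (q ` J)"
    using I_eq by (rule arg_cong)
  also have "\<dots> = (\<lambda>j. q (u + j)) ` J" by (simp only: image_image half_baked_simps)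
  finally show ?thesis .
qed

lemma q_in_cl: "q u \<in> cl u"
  unfolding cl_alt by (rule image_eqI[where x = 0]) (simp_all add: J_ideal(1))

lemma cl_eq_iff: "cl u = cl w \<longleftrightarrow> u - w \<in> J"
proof
  assume "cl u = cl w"
  moreover have "q u \<in> cl u" by (rule q_in_cl)
  ultimately obtain j where j: "j \<in> J" "q u = q (w + j)" by (auto simp: cl_alt)
  then have "u - (w + j) \<in> J" using relation_ideal_J q_eq_iff by blast
  from J_ideal(2)[OF this j(1)] show "u - w \<in> J" by simp
next
  have sub: "cl u \<subseteq> cl w" if "u - w \<in> J" for u w
  proof
    fix s assume "s \<in> cl u"
    then obtain j where j: "j \<in> J" "s = q (u + j)" by (auto simp: cl_alt)
    have "q (w + ((u - w) + j)) \<in> (\<lambda>j. q (w + j)) ` J"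
      using J_ideal(2)[OF that j(1)] by (rule imageI)
    then show "s \<in> cl w" using j(2) by (simp add: cl_alt)
  qed
  assume "u - w \<in> J"
  moreover from J_ideal(3)[OF this, of "-1"] have "w - u \<in> J" by simp
  ultimately show "cl u = cl w" using sub by blast
qed

lemma cl_ne: "cl u \<noteq> {}" using J_ideal(1) by (auto simp: cl_alt)

lemma cl_self: "S \<in> cl u \<Longrightarrow> \<exists>s. S = q s \<and> s - u \<in> J" by (auto simp: cl_alt)

lemma quotient_simps:
  "sa_carrier (quotient_alg (half_baked v) I) = range cl"
  "sa_add (quotient_alg (half_baked v) I) (cl s) (cl t) = cl (s + t)"
  "sa_scale (quotient_alg (half_baked v) I) c (cl s) = cl (free_scale c s)"
  "sa_bracket (quotient_alg (half_baked v) I) (cl s) (cl t) = cl (free_bracket s t)"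
proof -
  let ?H = "half_baked v"
  show "sa_carrier (quotient_alg ?H I) = range cl"
    by (simp add: quotient_alg_def half_baked_simps cl_def[abs_def] image_image)
  have eq: "coset ?H I (sa_add ?H S T) = cl (s + t)" "coset ?H I (sa_scale ?H c S) = cl (free_scale c s)"
    "coset ?H I (sa_bracket ?H S T) = cl (free_bracket s t)"
    if ST: "S \<in> cl s" "T \<in> cl t" for S T
  proof -
    obtain s' t' where st: "S = q s'" "T = q t'" and d: "s' - s \<in> J" "t' - t \<in> J"
      using ST[THEN cl_self] by blast
    have 1: "s' + t' - (s + t) = (s' - s) + (t' - t)" by simp
    have 2: "free_bracket s' t' - free_bracket s t
      = free_bracket (s' - s) t' + free_bracket s (t' - t)"
      by (simp add: free_bracket_diff_left free_bracket_diff_right)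
    have "cl (s' + t') = cl (s + t)" unfolding cl_eq_iff 1 by (intro J_ideal d)
    then show "coset ?H I (sa_add ?H S T) = cl (s + t)" by (simp add: st half_baked_simps cl_def)
    have "cl (free_scale c s') = cl (free_scale c s)" unfolding cl_eq_iff
      using J_ideal(3)[OF d(1), of c] by (simp add: free_scale_diff_right)
    then show "coset ?H I (sa_scale ?H c S) = cl (free_scale c s)"
      by (simp add: st half_baked_simps cl_def)
    have "cl (free_bracket s' t') = cl (free_bracket s t)" unfolding cl_eq_iff 2
      by (intro J_ideal d)
    then show "coset ?H I (sa_bracket ?H S T) = cl (free_bracket s t)"
      by (simp add: st half_baked_simps cl_def)
  qed
  have "sa_add (quotient_alg ?H I) (cl s) (cl t) =
      (\<Union>S\<in>cl s. \<Union>T\<in>cl t. coset ?H I (sa_add ?H S T))" by (simp add: quotient_alg_def)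
  also have "\<dots> = (\<Union>S\<in>cl s. \<Union>T\<in>cl t. cl (s + t))" by (intro SUP_cong refl eq)
  also have "\<dots> = cl (s + t)" by (simp add: cl_ne)
  finally show "sa_add (quotient_alg ?H I) (cl s) (cl t) = cl (s + t)" .
  have "sa_bracket (quotient_alg ?H I) (cl s) (cl t) =
      (\<Union>S\<in>cl s. \<Union>T\<in>cl t. coset ?H I (sa_bracket ?H S T))" by (simp add: quotient_alg_def)
  also have "\<dots> = (\<Union>S\<in>cl s. \<Union>T\<in>cl t. cl (free_bracket s t))"
    by (intro SUP_cong refl eq)
  also have "\<dots> = cl (free_bracket s t)" by (simp add: cl_ne)
  finally show "sa_bracket (quotient_alg ?H I) (cl s) (cl t) = cl (free_bracket s t)" .
  have "sa_scale (quotient_alg ?H I) c (cl s) = (\<Union>S\<in>cl s. coset ?H I (sa_scale ?H c S))"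
    by (simp add: quotient_alg_def)
  also have "\<dots> = (\<Union>S\<in>cl s. cl (free_scale c s))" by (intro SUP_cong refl eq(2)[OF _ q_in_cl[of t]])
  also have "\<dots> = cl (free_scale c s)" by (simp add: cl_ne)
  finally show "sa_scale (quotient_alg ?H I) c (cl s) = cl (free_scale c s)" .
qed

end

text \<open>Only arrows inducing the identity are kept, because all arrows of a skeleton do. An
  isomorphism of quotients is replaced by a choice \<open>f\<close> of representatives of its
  values; its injectivity becomes the equivalence between \<open>f s\<close> and \<open>s\<close>
  lying in the respective ideals.\<close>

lemma admissible_ideals:
  fixes R :: "('h::fd_complex_vector, 'x::finite) root_datum set"
  assumes "admissible R"
  obtains J where "\<And>v. v \<in> R \<Longrightarrow> lie_ideal v (J v)"
    and "\<And>v v'. v \<in> R \<Longrightarrow> v' \<in> R \<Longrightarrow> arrow v id v' \<Longrightarrow> \<exists>f. ideal_hom (J v) (J v') f"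
proof -
  obtain I where I: "\<And>v. v \<in> R \<Longrightarrow> ideal_chain v (I v)"
    and iso: "\<And>v v'. v \<in> R \<Longrightarrow> v' \<in> R \<Longrightarrow> arrow v id v' \<Longrightarrow>
       \<exists>\<psi>. superalg_iso (quotient_alg (half_baked v) (I v)) (quotient_alg (half_baked v') (I v')) \<psi> \<and>
          (\<forall>h. \<psi> (coset (half_baked v) (I v) (half_baked_h v h)) =
                coset (half_baked v') (I v') (half_baked_h v' h))"
    using assms unfolding admissible_def ideal_chain_def by (metis id_apply)
  let ?J = "\<lambda>v. ideal_chain.J v (I v)"
  show thesis
  proof
    show "lie_ideal v (?J v)" if "v \<in> R" for v
      using ideal_chain.lie_ideal_J[OF I[OF that]] .
    show "\<exists>f. ideal_hom (?J v) (?J v') f" if v: "v \<in> R" "v' \<in> R" "arrow v id v'" for v v'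
    proof -
      interpret A: ideal_chain v "I v" by (rule I) fact
      interpret B: ideal_chain v' "I v'" by (rule I) fact
      obtain \<psi> where \<psi>: "superalg_iso (quotient_alg (half_baked v) (I v))
            (quotient_alg (half_baked v') (I v')) \<psi>"
        and \<psi>h: "\<And>h. \<psi> (A.cl (genH h)) = B.cl (genH h)"
        using iso[OF v] by (auto simp: A.cl_def A.q_def B.cl_def B.q_def half_baked_h_def)
      have bij: "bij_betw \<psi> (range A.cl) (range B.cl)"
        and add: "\<And>s t. \<psi> (A.cl (s + t)) =
            sa_add (quotient_alg (half_baked v') (I v')) (\<psi> (A.cl s)) (\<psi> (A.cl t))"
        and scale: "\<And>c s. \<psi> (A.cl (free_scale c s)) =
            sa_scale (quotient_alg (half_baked v') (I v')) c (\<psi> (A.cl s))"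
        and bracket: "\<And>s t. \<psi> (A.cl (free_bracket s t)) =
            sa_bracket (quotient_alg (half_baked v') (I v')) (\<psi> (A.cl s)) (\<psi> (A.cl t))"
        using \<psi> unfolding superalg_iso_def A.quotient_simps B.quotient_simps
        by (simp_all add: A.quotient_simps)
      have "\<forall>s. \<exists>t. \<psi> (A.cl s) = B.cl t" using bij_betwE[OF bij] by blast
      then obtain f where f: "\<And>s. \<psi> (A.cl s) = B.cl (f s)" by metis
      \<comment> \<open>A choice of representatives need not send 0 to 0, but additivity makes
        \<open>f 0\<close> congruent to \<open>f 0 + f 0\<close>.\<close>
      have zero: "f 0 \<in> B.J"
      proof -
        have "B.cl (f 0) = B.cl (f 0 + f 0)"
          using add[of 0 0] by (simp add: f B.quotient_simps)
        then have "f 0 - (f 0 + f 0) \<in> B.J" by (simp only: B.cl_eq_iff)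
        from B.J_ideal(3)[OF this, of "-1"] show ?thesis by simp
      qed
      have iff: "f s \<in> B.J \<longleftrightarrow> s \<in> A.J" for s
      proof -
        have "s \<in> A.J \<longleftrightarrow> A.cl s = A.cl 0" by (simp add: A.cl_eq_iff)
        also have "\<dots> \<longleftrightarrow> B.cl (f s) = B.cl (f 0)"
          by (simp add: f[symmetric] inj_on_eq_iff[OF bij_betw_imp_inj_on[OF bij]])
        also have "B.cl (f 0) = B.cl 0" using zero by (simp add: B.cl_eq_iff)
        finally show ?thesis by (simp add: B.cl_eq_iff)
      qed
      have "ideal_hom A.J B.J f"
        unfolding ideal_hom_def
        using add scale bracket \<psi>h iff by (simp add: f B.quotient_simps B.cl_eq_iff)
      then show ?thesis by blast
    qed
  qed
qed

section \<open>Triangular decomposition and weights\<close>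

interpretation scaleC: vector_space "scaleC :: complex \<Rightarrow> 'a \<Rightarrow> 'a::complex_vector"
  by (rule vector_space_scaleC)

section \<open>Integral combinations of simple roots, and words in the generators\<close>

definition comb :: "('h, 'x::finite) root_datum \<Rightarrow> ('x \<Rightarrow> complex) \<Rightarrow> 'h \<Rightarrow> complex" where
  "comb v c = (\<lambda>h. \<Sum>x\<in>UNIV. c x * rdb v x h)"

lemma comb_eq_iff:
  assumes "is_root_datum v"
  shows "comb v c = comb v d \<longleftrightarrow> c = d"
proof
  assume eq: "comb v c = comb v d"
  have "\<forall>h. (\<Sum>x\<in>UNIV. (c x - d x) * rdb v x h) = 0"
    using fun_cong[OF eq] by (simp add: comb_def left_diff_distrib sum_subtractf)
  then have "\<forall>x. c x - d x = 0" using assms unfolding is_root_datum_def by meson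
  then show "c = d" by auto
qed simp

lemma comb_unit: "comb v (\<lambda>z. if z = x then c else 0) = (\<lambda>h. c * rdb v x h)"
  by (simp add: comb_def if_distrib[of "\<lambda>a. a * _"] cong: if_cong)

lemma comb_delta: "comb v (\<lambda>z. of_bool (z = x)) = rdb v x"
  using comb_unit[of v x 1] by (simp add: of_bool_def)

definition Qpos :: "('h, 'x::finite) root_datum \<Rightarrow> ('h \<Rightarrow> complex) set" where
  "Qpos v = {\<alpha>. \<exists>n :: 'x \<Rightarrow> nat. \<alpha> = comb v (\<lambda>x. of_nat (n x))}"

definition Qneg :: "('h, 'x::finite) root_datum \<Rightarrow> ('h \<Rightarrow> complex) set" where
  "Qneg v = {\<alpha>. \<exists>n :: 'x \<Rightarrow> nat. \<alpha> = comb v (\<lambda>x. - of_nat (n x))}"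

text \<open>The flag selects one half of the algebra, so that a single proof serves both the e and
  the f, with \<open>\<not> i\<close> for the opposite half.\<close>

primrec gen_of :: "bool \<Rightarrow> 'x \<Rightarrow> ('h, 'x) gen" where
  "gen_of True x = GenE x"
| "gen_of False x = GenF x"

text \<open>Right-normed iterated brackets of generators from one half. The first letter is a
  separate argument because there is no empty bracket.\<close>

primrec word :: "bool \<Rightarrow> 'x \<Rightarrow> 'x list \<Rightarrow> ('h, 'x) gen monomial" where
  "word i x [] = Leaf (gen_of i x)"
| "word i x (y # ys) = Node (Leaf (gen_of i x)) (word i y ys)"

abbreviation mono1 :: "('h, 'x) gen monomial \<Rightarrow> ('h, 'x) free" where
  "mono1 t \<equiv> Poly_Mapping.single t 1"

abbreviation sgn_of :: "bool \<Rightarrow> complex" where "sgn_of i \<equiv> if i then 1 else - 1"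

definition word_wt ::
  "('h, 'x) root_datum \<Rightarrow> bool \<Rightarrow> 'x \<Rightarrow> 'x list \<Rightarrow> 'h \<Rightarrow> complex" where
  "word_wt v i x xs = (\<lambda>h. sgn_of i * (\<Sum>y\<leftarrow>x # xs. rdb v y h))"

lemma word_wt_comb:
  "word_wt v i x xs = comb v (\<lambda>z. sgn_of i * of_nat (count_list (x # xs) z))"
proof -
  have "(\<Sum>y\<leftarrow>ys. rdb v y h) = (\<Sum>z\<in>UNIV. of_nat (count_list ys z) * rdb v z h)" for ys h
  proof (induction ys)
    case (Cons a ys)
    have "(\<Sum>z\<in>UNIV. of_nat (count_list (a # ys) z) * rdb v z h) =
        (\<Sum>z\<in>UNIV. (if z = a then rdb v z h else 0) + of_nat (count_list ys z) * rdb v z h)"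
      by (intro sum.cong refl) (auto simp: algebra_simps)
    then show ?case using Cons by (simp add: sum.distrib)
  qed simp
  from this[of _ "x # xs"] show ?thesis
    unfolding word_wt_def comb_def by (simp only: sum_distrib_left mult.assoc)
qed

locale lie_quotient =
  fixes v :: "('h::fd_complex_vector, 'x::finite) root_datum" and J
  assumes rd: "is_root_datum v" and lie_ideal: "lie_ideal v J"
begin

lemma J0 [simp]: "0 \<in> J" and J_add: "s \<in> J \<Longrightarrow> t \<in> J \<Longrightarrow> s + t \<in> J"
  and J_scale: "s \<in> J \<Longrightarrow> free_scale c s \<in> J" and J_left: "s \<in> J \<Longrightarrow> free_bracket s u \<in> J"
  and J_right: "s \<in> J \<Longrightarrow> free_bracket u s \<in> J" and relators_J: "r \<in> relators v \<Longrightarrow> r \<in> J"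
  and genH_J: "genH h \<in> J \<Longrightarrow> h = 0"
  using lie_ideal unfolding lie_ideal_def by auto

lemma J_minus: "s \<in> J \<Longrightarrow> - s \<in> J"
  using J_scale[of s "-1"] by simp

lemma J_diff: "s \<in> J \<Longrightarrow> t \<in> J \<Longrightarrow> s - t \<in> J"
  using J_add[OF _ J_minus] by fastforce

lemma J_sum: "(\<And>i. i \<in> A \<Longrightarrow> g i \<in> J) \<Longrightarrow> (\<Sum>i\<in>A. g i) \<in> J"
  by (induction A rule: infinite_finite_induct) (auto intro: J_add)

lemma J_scale_iff: "c \<noteq> 0 \<Longrightarrow> free_scale c s \<in> J \<longleftrightarrow> s \<in> J"
  using J_scale[of "free_scale c s" "1 / c"] J_scale[of s c] by auto

definition cong (infix "\<approx>" 50) where "s \<approx> t \<longleftrightarrow> s - t \<in> J"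

lemma cong_refl [simp, intro]: "s \<approx> s" by (simp add: cong_def)

lemma cong_sym: "s \<approx> t \<Longrightarrow> t \<approx> s"
  unfolding cong_def using J_minus by fastforce

lemma cong_trans [trans]: "s \<approx> t \<Longrightarrow> t \<approx> u \<Longrightarrow> s \<approx> u"
  unfolding cong_def using J_add by fastforce

lemma cong_0: "s \<approx> 0 \<longleftrightarrow> s \<in> J" by (simp add: cong_def)

lemma cong_J: "s \<approx> t \<Longrightarrow> s \<in> J \<longleftrightarrow> t \<in> J"
  using cong_0 cong_sym cong_trans by blast

lemma cong_add: "s \<approx> t \<Longrightarrow> s' \<approx> t' \<Longrightarrow> s + s' \<approx> t + t'"
  unfolding cong_def using J_add by (fastforce simp: algebra_simps)

lemma cong_diff: "s \<approx> t \<Longrightarrow> s' \<approx> t' \<Longrightarrow> s - s' \<approx> t - t'"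
  unfolding cong_def using J_diff by (fastforce simp: algebra_simps)

lemma cong_scale: "s \<approx> t \<Longrightarrow> free_scale c s \<approx> free_scale c t"
  unfolding cong_def using J_scale by (simp add: free_scale_diff_right[symmetric])

lemma cong_bracket: "s \<approx> t \<Longrightarrow> s' \<approx> t' \<Longrightarrow> free_bracket s s' \<approx> free_bracket t t'"
proof -
  assume *: "s \<approx> t" "s' \<approx> t'"
  have "free_bracket s s' - free_bracket t t' = free_bracket (s - t) s' + free_bracket t (s' - t')"
    by (simp add: free_bracket_diff_left free_bracket_diff_right)
  then show ?thesis using * J_add J_left J_right by (simp add: cong_def)
qed

lemma mono1_part: "mono1 t \<in> free_part v (parity v t)"
  by (simp add: free_part_def)

text \<open>The sign involves the first two arguments only, so the identity for monomials extends
  linearly to an arbitrary, possibly inhomogeneous, third argument.\<close>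

lemma jacobi:
  "free_bracket (mono1 r) (free_bracket (mono1 s) t) \<approx>
   free_bracket (free_bracket (mono1 r) (mono1 s)) t +
   free_scale (super_sign (parity v r) (parity v s)) (free_bracket (mono1 s) (free_bracket (mono1 r) t))"
proof (induction t rule: free_induct)
  case (add t u c)
  have "free_bracket (mono1 r) (free_bracket (mono1 s) (mono1 u)) \<approx>
   free_bracket (free_bracket (mono1 r) (mono1 s)) (mono1 u) +
   free_scale (super_sign (parity v r) (parity v s))
     (free_bracket (mono1 s) (free_bracket (mono1 r) (mono1 u)))"
    using relators_J[OF relators.super_Jacobi[OF mono1_part[of r] mono1_part[of s] mono1_part[of u]]]
    by (simp add: cong_def algebra_simps)
  from cong_add[OF add cong_scale[OF this, of c]] show ?case
    by (simp add: free_bracket_add_right free_bracket_scale_right free_scale_add_right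
        mult.commute add_ac)
qed simp

lemma antisym:
  "free_bracket (mono1 r) (mono1 s) \<approx>
   free_scale (- super_sign (parity v r) (parity v s)) (free_bracket (mono1 s) (mono1 r))"
  using relators_J[OF relators.super_antisymmetry[OF mono1_part[of r] mono1_part[of s]]]
  by (simp add: cong_def)

lemma super_sign_simps [simp]: "super_sign 0 j = 1" "super_sign i 0 = 1"
  by (simp_all add: super_sign_def)

lemma H_gen: "free_bracket (genH h) (mono1 (Leaf (gen_of i x))) \<approx>
    free_scale (sgn_of i * rdb v x h) (mono1 (Leaf (gen_of i x)))"
  using relators_J[OF relators.HE[of h x v]] relators_J[OF relators.HF[of h x v]]
  by (cases i) (simp_all add: cong_def)

text \<open>Vectors are even, so they act as derivations without signs and the weights of the
  letters add up.\<close>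

lemma H_word: "free_bracket (genH h) (mono1 (word i x xs)) \<approx>
    free_scale (word_wt v i x xs h) (mono1 (word i x xs))"
proof (induction xs arbitrary: x)
  case Nil
  show ?case using H_gen[of h i x] by (simp add: word_wt_def)
next
  case (Cons y ys)
  let ?g = "mono1 (Leaf (gen_of i x))" and ?w = "mono1 (word i y ys)"
  have "free_bracket (genH h) (free_bracket ?g ?w) \<approx>
      free_bracket (free_bracket (genH h) ?g) ?w + free_bracket ?g (free_bracket (genH h) ?w)"
    using jacobi[of "Leaf (GenH h)" "Leaf (gen_of i x)" ?w] by simp
  also have "\<dots> \<approx> free_bracket (free_scale (sgn_of i * rdb v x h) ?g) ?w +
      free_bracket ?g (free_scale (word_wt v i y ys h) ?w)"
    by (intro cong_add cong_bracket H_gen cong_refl Cons)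
  also have "\<dots> = free_scale (word_wt v i x (y # ys) h) (free_bracket ?g ?w)"
    by (simp add: free_bracket_scale_left free_bracket_scale_right free_scale_add_left[symmetric]
        word_wt_def algebra_simps)
  finally show ?case by (simp add: free_bracket_single)
qed

text \<open>Spans are taken modulo the ideal: including all of \<open>J\<close> makes them closed
  under congruence.\<close>

inductive_set span for B where
  span_J: "s \<in> J \<Longrightarrow> s \<in> span B"
| span_base: "s \<in> B \<Longrightarrow> s \<in> span B"
| span_add: "s \<in> span B \<Longrightarrow> t \<in> span B \<Longrightarrow> s + t \<in> span B"
| span_scale: "s \<in> span B \<Longrightarrow> free_scale c s \<in> span B"

lemma span_cong: "s \<approx> t \<Longrightarrow> t \<in> span B \<Longrightarrow> s \<in> span B"
  unfolding cong_def using span_add[OF span_J] by fastforce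

lemma span_minimal: "B \<subseteq> span C \<Longrightarrow> span B \<subseteq> span C"
proof
  fix s assume B: "B \<subseteq> span C" and s: "s \<in> span B"
  from s show "s \<in> span C" by induction (use B in \<open>auto intro: span.intros(1,3,4)\<close>)
qed

lemma span_bracket_right:
  assumes "s \<in> span B" "\<And>b. b \<in> B \<Longrightarrow> free_bracket u b \<in> span C"
  shows "free_bracket u s \<in> span C"
  using assms(1)
  by induction (auto simp: free_bracket_add_right free_bracket_scale_right J_right assms(2)
      intro: span.intros(1,3,4))

lemma span_bracket_left:
  assumes "s \<in> span B" "\<And>b. b \<in> B \<Longrightarrow> free_bracket b u \<in> span C"
  shows "free_bracket s u \<in> span C"
  using assms(1)
  by induction (auto simp: free_bracket_add_left free_bracket_scale_left J_left assms(2)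
      intro: span.intros(1,3,4))

section \<open>Spanning by words in the e, words in the f, and the vector space\<close>

definition words :: "bool \<Rightarrow> ('h, 'x) free set" where
  "words i = {mono1 (word i x xs) | x xs. True}"

lemma wordsI: "mono1 (word i x xs) \<in> words i"
  by (auto simp: words_def)

lemma wordsE: "b \<in> words i \<Longrightarrow> (\<And>x xs. b = mono1 (word i x xs) \<Longrightarrow> P) \<Longrightarrow> P"
  by (auto simp: words_def)

lemma words_base: "mono1 (word i x xs) \<in> span (words i \<union> C)"
  by (rule span_base) (simp add: wordsI)

lemma gen_words: "mono1 (Leaf (gen_of i x)) \<in> span (words i \<union> C)"
  using words_base[of i x "[]"] by simp

lemma H_words: "s \<in> span (words i) \<Longrightarrow> free_bracket (genH h) s \<in> span (words i)"
proof (rule span_bracket_right)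
  show "free_bracket (genH h) b \<in> span (words i)" if "b \<in> words i" for b
    using that span_cong[OF H_word span_scale[OF words_base[where C = "{}"]]]
    by (auto elim!: wordsE)
qed

lemma gen_NH:
  assumes "s \<in> span (words i \<union> range genH)"
  shows "free_bracket (mono1 (Leaf (gen_of i x))) s \<in> span (words i)"
  using assms
proof (rule span_bracket_right)
  show "free_bracket (mono1 (Leaf (gen_of i x))) b \<in> span (words i)"
    if b: "b \<in> words i \<union> range genH" for b
    using b
  proof
    assume "b \<in> words i"
    then obtain y ys where "b = mono1 (word i y ys)" by (rule wordsE)
    then show ?thesis
      using words_base[of i x "y # ys" "{}"] by (simp add: free_bracket_single)
  next
    assume "b \<in> range genH"
    then obtain h where b: "b = genH h" by auto
    show ?thesis unfolding b
      by (rule span_cong[OF antisym span_scale[OF span_cong[OF H_gen span_scale]]])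
         (use gen_words[where C = "{}"] in simp)
  qed
qed

lemma gen_gen:
  "free_bracket (mono1 (Leaf (gen_of i x))) (mono1 (Leaf (gen_of (\<not> i) y))) \<in> span (range genH)"
proof -
  have EF: "free_bracket (genE x) (genF y) \<in> span (range genH)" for x y
  proof (cases "x = y")
    case True
    have "free_bracket (genE x) (genF x) \<approx> genH (rda v x)"
      unfolding cong_def by (rule relators_J[OF relators.EF_same])
    then have "free_bracket (genE x) (genF x) \<in> span (range genH)"
      by (rule span_cong[OF _ span_base]) simp
    then show ?thesis using True by simp
  next
    case False
    then show ?thesis by (intro span_J relators_J relators.EF_distinct)
  qed
  show ?thesis
  proof (cases i)
    case False
    then show ?thesis
      using span_cong[OF antisym span_scale[OF EF]] by simp
  qed (use EF in simp)
qed

lemma gen_word_opposite: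
  "free_bracket (mono1 (Leaf (gen_of i x))) (mono1 (word (\<not> i) y ys))
   \<in> span (words (\<not> i) \<union> range genH)"
proof (induction ys arbitrary: y)
  case Nil
  show ?case using gen_gen[of i x y] span_minimal[of "range genH" "words (\<not> i) \<union> range genH"]
    by (auto intro: span_base)
next
  case (Cons z zs)
  let ?g = "mono1 (Leaf (gen_of i x))" and ?g' = "mono1 (Leaf (gen_of (\<not> i) y))"
  let ?w = "mono1 (word (\<not> i) z zs)"
  have sub: "span (words (\<not> i)) \<subseteq> span (words (\<not> i) \<union> range genH)"
    by (intro span_minimal) (auto intro: span_base)
  have "free_bracket (free_bracket ?g ?g') ?w \<in> span (words (\<not> i))"
    by (rule span_bracket_left[OF gen_gen])
       (auto intro: H_words[OF span_base[OF wordsI]])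
  moreover have "free_bracket ?g' (free_bracket ?g ?w) \<in> span (words (\<not> i))"
    by (rule gen_NH[OF Cons])
  ultimately have "free_bracket ?g (free_bracket ?g' ?w) \<in> span (words (\<not> i))"
    by (rule span_cong[OF jacobi span_add[OF _ span_scale]])
  from subsetD[OF sub this] show ?case by (simp add: free_bracket_single)
qed

abbreviation spanners :: "('h, 'x) free set" where
  "spanners \<equiv> words True \<union> words False \<union> range genH"

lemma words_spanners: "words i \<union> range genH \<subseteq> spanners"
  by (cases i) auto

lemma spanners_mono: "C \<subseteq> spanners \<Longrightarrow> span C \<subseteq> span spanners"
  by (intro span_minimal) (auto intro: span_base)

lemma leaf_spanners: "s \<in> span spanners \<Longrightarrow> free_bracket (mono1 (Leaf g)) s \<in> span spanners"
proof (erule span_bracket_right)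
  fix b assume b: "b \<in> spanners"
  have gen: "free_bracket (mono1 (Leaf (gen_of i x))) b \<in> span spanners" for i x
  proof -
    consider "b \<in> words i \<union> range genH" | y ys where "b = mono1 (word (\<not> i) y ys)"
      using b by (cases i) (auto elim: wordsE)
    then show ?thesis
    proof cases
      case 1
      have "words i \<subseteq> spanners" using words_spanners[of i] by blast
      from subsetD[OF spanners_mono[OF this] gen_NH[OF span_base[OF 1]]] show ?thesis .
    next
      case 2
      show ?thesis unfolding 2
        by (rule subsetD[OF spanners_mono[OF words_spanners[of "\<not> i"]] gen_word_opposite])
    qed
  qed
  show "free_bracket (mono1 (Leaf g)) b \<in> span spanners"
  proof (cases g)
    case (GenE x)
    then show ?thesis using gen[of True x] by simp
  next
    case (GenF x)
    then show ?thesis using gen[of False x] by simp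
  next
    case (GenH h)
    from b consider h' where "b = genH h'" | i where "b \<in> words i" by blast
    then show ?thesis
    proof cases
      case 1
      then show ?thesis using GenH by (simp add: span_J relators_J relators.HH)
    next
      case 2
      have "words i \<subseteq> spanners" using words_spanners[of i] by blast
      from subsetD[OF spanners_mono[OF this] H_words[OF span_base[OF 2]]] GenH
      show ?thesis by simp
    qed
  qed
qed

text \<open>By Jacobi a bracket acts as the supercommutator of the actions of its two factors, so
  closure under the generators propagates to all trees; \<open>s\<close> is arbitrary because the
  two actions are composed.\<close>

lemma mono_spanners: "s \<in> span spanners \<Longrightarrow> free_bracket (mono1 t) s \<in> span spanners"
proof (induction t arbitrary: s)
  case (Node r t)
  let ?\<epsilon> = "super_sign (parity v r) (parity v t)"
  have "free_bracket (mono1 (Node r t)) s \<approx> free_bracket (mono1 r) (free_bracket (mono1 t) s) +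
     free_scale (- ?\<epsilon>) (free_bracket (mono1 t) (free_bracket (mono1 r) s))"
    using cong_sym[OF jacobi[of r t s]] by (simp add: cong_def free_bracket_single algebra_simps)
  moreover have "free_bracket (mono1 r) (free_bracket (mono1 t) s) \<in> span spanners"
    "free_bracket (mono1 t) (free_bracket (mono1 r) s) \<in> span spanners"
    by (rule Node.IH, rule Node.IH, rule Node.prems)+
  ultimately show ?case by (rule span_cong[OF _ span_add[OF _ span_scale]])
qed (rule leaf_spanners)

lemma mono1_in_spanners: "mono1 t \<in> span spanners"
proof (induction t)
  case (Leaf g)
  show ?case
  proof (cases g)
    case (GenE x)
    then show ?thesis using span_base[of "mono1 (word True x [])" spanners] wordsI[of True x "[]"]
      by (simp del: Un_iff add: UnI1)
  next
    case (GenF x)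
    then show ?thesis using span_base[of "mono1 (word False x [])" spanners] wordsI[of False x "[]"]
      by (simp del: Un_iff add: UnI1 UnI2)
  next
    case (GenH h)
    then show ?thesis using span_base[of "genH h" spanners] by simp
  qed
next
  case (Node r t)
  then show ?case using mono_spanners[of "mono1 t" r] by (simp add: free_bracket_single)
qed

lemma span_spanners: "s \<in> span spanners"
  by (induction s rule: free_induct) (auto intro: span_J span_add span_scale mono1_in_spanners)

section \<open>Weight spaces\<close>

definition has_weight where
  "has_weight s \<alpha> \<longleftrightarrow> (\<forall>h. free_bracket (genH h) s \<approx> free_scale (\<alpha> h) s)"

definition weight_spanners :: "('h \<Rightarrow> complex) \<Rightarrow> ('h, 'x) free set" where
  "weight_spanners \<alpha> = {mono1 (word i x xs) | i x xs. word_wt v i x xs = \<alpha>} \<union>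
     {genH h | h. \<alpha> = (\<lambda>h. 0)}"

lemma has_weight_add: "has_weight s \<alpha> \<Longrightarrow> has_weight t \<alpha> \<Longrightarrow> has_weight (s + t) \<alpha>"
  unfolding has_weight_def by (simp add: free_bracket_add_right free_scale_add_right cong_add)

lemma has_weight_scale: "has_weight s \<alpha> \<Longrightarrow> has_weight (free_scale c s) \<alpha>"
  unfolding has_weight_def
  using cong_scale by (fastforce simp: free_bracket_scale_right mult.commute)

lemma has_weight_diff: "has_weight s \<alpha> \<Longrightarrow> has_weight t \<alpha> \<Longrightarrow> has_weight (s - t) \<alpha>"
  unfolding has_weight_def by (simp add: free_bracket_diff_right free_scale_diff_right cong_diff)

lemma has_weight_J: "s \<in> J \<Longrightarrow> has_weight s \<alpha>"
  unfolding has_weight_def cong_def by (intro allI J_diff J_right J_scale)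

lemma has_weight_span: "s \<in> span (weight_spanners \<alpha>) \<Longrightarrow> has_weight s \<alpha>"
proof (induction rule: span.induct)
  case (span_base s)
  then show ?case
    using H_word relators_J[OF relators.HH]
    by (auto simp: weight_spanners_def has_weight_def cong_0)
qed (simp_all add: has_weight_add has_weight_scale has_weight_J)

text \<open>Eigenvectors with distinct eigenvalues are independent. For \<beta> other than \<alpha>
  choose \<open>h\<close> where the two weights differ: the action of \<open>h\<close> minus the
  scalar \<open>\<alpha> h\<close> kills the component of weight \<alpha> modulo the ideal and
  multiplies that of weight \<beta> by a nonzero scalar, leaving a sum over fewer weights.\<close>

lemma weight_separation:
  assumes "finite A" "\<And>\<beta>. \<beta> \<in> A \<Longrightarrow> has_weight (d \<beta>) \<beta>" "(\<Sum>\<beta>\<in>A. d \<beta>) \<in> J"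
  shows "\<forall>\<beta>\<in>A. d \<beta> \<in> J"
  using assms
proof (induction A arbitrary: d rule: finite_induct)
  case (insert \<alpha> A)
  have "\<beta> \<in> A \<Longrightarrow> d \<beta> \<in> J" for \<beta>
  proof -
    assume \<beta>: "\<beta> \<in> A"
    then obtain h where h: "\<beta> h \<noteq> \<alpha> h" using insert.hyps by (metis ext)
    have "free_bracket (genH h) (\<Sum>\<gamma>\<in>insert \<alpha> A. d \<gamma>) - free_scale (\<alpha> h) (\<Sum>\<gamma>\<in>insert \<alpha> A. d \<gamma>)
      \<in> J"
      using insert.prems(2) by (intro J_diff J_right J_scale)
    also have "free_bracket (genH h) (\<Sum>\<gamma>\<in>insert \<alpha> A. d \<gamma>) -
        free_scale (\<alpha> h) (\<Sum>\<gamma>\<in>insert \<alpha> A. d \<gamma>) =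
      (\<Sum>\<gamma>\<in>insert \<alpha> A. free_bracket (genH h) (d \<gamma>) - free_scale (\<alpha> h) (d \<gamma>))"
      by (simp only: free_bracket_sum_right free_scale_sum sum_subtractf)
    finally have 1: "(\<Sum>\<gamma>\<in>insert \<alpha> A. free_bracket (genH h) (d \<gamma>) - free_scale (\<alpha> h) (d \<gamma>)) \<in> J" .
    have "(\<Sum>\<gamma>\<in>insert \<alpha> A. free_scale (\<gamma> h) (d \<gamma>) - free_bracket (genH h) (d \<gamma>)) \<in> J"
      using insert.prems(1) by (intro J_sum) (metis has_weight_def cong_def cong_sym)
    from J_add[OF this 1] have "(\<Sum>\<gamma>\<in>insert \<alpha> A. free_scale (\<gamma> h - \<alpha> h) (d \<gamma>)) \<in> J"
      by (simp only: sum.distrib[symmetric]) (simp add: free_scale_diff_left)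
    then have 2: "(\<Sum>\<gamma>\<in>A. free_scale (\<gamma> h - \<alpha> h) (d \<gamma>)) \<in> J"
      using insert.hyps by simp
    have "free_scale (\<beta> h - \<alpha> h) (d \<beta>) \<in> J"
      using insert.IH[OF _ 2] insert.prems(1) has_weight_scale \<beta> by blast
    then show "d \<beta> \<in> J" using h by (simp add: J_scale_iff)
  qed
  moreover from this have "(\<Sum>\<beta>\<in>A. d \<beta>) \<in> J" by (intro J_sum)
  with J_diff[OF insert.prems(2) this] have "d \<alpha> \<in> J" using insert.hyps by simp
  ultimately show ?case by blast
qed simp

text \<open>The components are indexed by all weights and vanish off \<open>A\<close>, so that two
  decompositions can be added over the union of their supports.\<close>

lemma weight_decomposition:
  "\<exists>A c. finite A \<and> (\<forall>\<beta>. c \<beta> \<in> span (weight_spanners \<beta>)) \<and> (\<forall>\<beta>. \<beta> \<notin> A \<longrightarrow> c \<beta> = 0) \<and>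
     s \<approx> (\<Sum>\<beta>\<in>A. c \<beta>)"
  using span_spanners[of s]
proof (induction rule: span.induct)
  case (span_J s)
  then show ?case by (intro exI[of _ "{}"] exI[of _ "\<lambda>_. 0"]) (auto simp: cong_0 span.span_J)
next
  case (span_base s)
  then consider h where "s = genH h" | i x xs where "s = mono1 (word i x xs)"
    by (auto elim!: wordsE)
  then obtain \<alpha> where "s \<in> weight_spanners \<alpha>"
    unfolding weight_spanners_def by cases blast+
  then show ?case
    by (intro exI[of _ "{\<alpha>}"] exI[of _ "\<lambda>\<beta>. if \<beta> = \<alpha> then s else 0"])
       (auto simp: span.span_J span.span_base)
next
  case (span_scale s k)
  then obtain A c where "finite A" "\<forall>\<beta>. c \<beta> \<in> span (weight_spanners \<beta>)"
    "\<forall>\<beta>. \<beta> \<notin> A \<longrightarrow> c \<beta> = 0" "s \<approx> (\<Sum>\<beta>\<in>A. c \<beta>)" by (elim exE conjE)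
  then show ?case
    by (intro exI[of _ A] exI[of _ "\<lambda>\<beta>. free_scale k (c \<beta>)"])
       (simp add: free_scale_sum[symmetric] span.span_scale cong_scale)
next
  case (span_add s t)
  from span_add.IH(1) obtain A c where 1: "finite A" "\<forall>\<beta>. c \<beta> \<in> span (weight_spanners \<beta>)"
    "\<forall>\<beta>. \<beta> \<notin> A \<longrightarrow> c \<beta> = 0" "s \<approx> (\<Sum>\<beta>\<in>A. c \<beta>)" by (elim exE conjE)
  from span_add.IH(2) obtain B d where 2: "finite B" "\<forall>\<beta>. d \<beta> \<in> span (weight_spanners \<beta>)"
    "\<forall>\<beta>. \<beta> \<notin> B \<longrightarrow> d \<beta> = 0" "t \<approx> (\<Sum>\<beta>\<in>B. d \<beta>)" by (elim exE conjE)
  have "(\<Sum>\<beta>\<in>A. c \<beta>) = (\<Sum>\<beta>\<in>A \<union> B. c \<beta>)" "(\<Sum>\<beta>\<in>B. d \<beta>) = (\<Sum>\<beta>\<in>A \<union> B. d \<beta>)"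
    using 1 2 by (auto intro!: sum.mono_neutral_left)
  then have "s + t \<approx> (\<Sum>\<beta>\<in>A \<union> B. c \<beta> + d \<beta>)"
    using cong_add[OF 1(4) 2(4)] by (simp add: sum.distrib)
  then show ?case using 1 2
    by (intro exI[of _ "A \<union> B"] exI[of _ "\<lambda>\<beta>. c \<beta> + d \<beta>"]) (auto simp: span.span_add)
qed

text \<open>Subtracting from \<open>s\<close> all its components gives a sum in the ideal of vectors
  \<open>d \<beta>\<close> of distinct weights, so each of them is in the ideal; at \<alpha> this
  says that \<open>s\<close> agrees with its own component.\<close>

lemma weight_space:
  assumes s: "has_weight s \<alpha>"
  shows "s \<in> span (weight_spanners \<alpha>)"
proof -
  obtain A c where A: "finite A" "\<And>\<beta>. c \<beta> \<in> span (weight_spanners \<beta>)"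
    "\<And>\<beta>. \<beta> \<notin> A \<Longrightarrow> c \<beta> = 0" "s \<approx> (\<Sum>\<beta>\<in>A. c \<beta>)"
    using weight_decomposition[of s] by metis
  define d where "d \<beta> = (if \<beta> = \<alpha> then s - c \<alpha> else - c \<beta>)" for \<beta>
  have w: "has_weight (c \<beta>) \<beta>" for \<beta> by (rule has_weight_span[OF A(2)])
  have "(\<Sum>\<beta>\<in>insert \<alpha> A. d \<beta>) = (\<Sum>\<beta>\<in>insert \<alpha> A. (if \<beta> = \<alpha> then s else 0) - c \<beta>)"
    by (rule sum.cong) (auto simp: d_def)
  also have "\<dots> = s - (\<Sum>\<beta>\<in>insert \<alpha> A. c \<beta>)"
    using A(1) by (simp add: sum_subtractf sum.delta)
  also have "(\<Sum>\<beta>\<in>insert \<alpha> A. c \<beta>) = (\<Sum>\<beta>\<in>A. c \<beta>)"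
    using A(1,3) by (intro sum.mono_neutral_right) auto
  finally have "(\<Sum>\<beta>\<in>insert \<alpha> A. d \<beta>) \<in> J" using A(4) by (simp add: cong_def)
  then have "\<forall>\<beta>\<in>insert \<alpha> A. d \<beta> \<in> J"
  proof (rule weight_separation[rotated 2])
    show "has_weight (d \<beta>) \<beta>" for \<beta>
      using has_weight_diff[OF s w] has_weight_scale[OF w[of \<beta>], of "-1"] by (simp add: d_def)
  qed (use A(1) in simp)
  then have "s \<approx> c \<alpha>" by (simp add: d_def cong_def)
  then show ?thesis using A(2) by (rule span_cong)
qed

lemma span_no_base: "s \<in> span {} \<Longrightarrow> s \<in> J"
  by (induction rule: span.induct) (auto intro: J_add J_scale)

lemma weight_pos_or_neg:
  assumes "has_weight s \<alpha>" "s \<notin> J"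
  shows "\<alpha> \<in> Qpos v \<union> Qneg v"
proof -
  have "weight_spanners \<alpha> \<noteq> {}"
  proof
    assume "weight_spanners \<alpha> = {}"
    then have "s \<in> span {}" using weight_space[OF assms(1)] by simp
    then show False using span_no_base assms(2) by blast
  qed
  then consider i x xs where "word_wt v i x xs = \<alpha>" | "\<alpha> = (\<lambda>h. 0)"
    by (auto simp: weight_spanners_def)
  then show ?thesis
  proof cases
    case 1
    then show ?thesis unfolding word_wt_comb Qpos_def Qneg_def
      by (cases i) (auto simp del: count_list.simps)
  next
    case 2
    then have "\<alpha> = comb v (\<lambda>x. of_nat 0)" by (simp add: comb_def)
    then show ?thesis unfolding Qpos_def by (intro UnI1 CollectI exI[of _ "\<lambda>_. 0"])
  qed
qed

text \<open>By independence of the simple roots the weight determines the sign and the number of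
  occurrences of each letter: \<open>x\<close> once and no other letter. A word of the opposite half
  would need a natural number equal to -1.\<close>

lemma word_wt_simple:
  assumes "word_wt v j y ys = (\<lambda>h. sgn_of i * rdb v x h)"
  shows "j = i \<and> y = x \<and> ys = []"
proof -
  have "(\<lambda>z. sgn_of j * of_nat (count_list (y # ys) z)) = (\<lambda>z. if z = x then sgn_of i else 0)"
    using assms unfolding word_wt_comb comb_unit[symmetric] comb_eq_iff[OF rd] .
  from fun_cong[OF this] have c: "sgn_of j * of_nat (count_list (y # ys) z) =
      (if z = x then sgn_of i else 0)" for z .
  have y: "y = x" using c[of y] by (auto split: if_splits simp del: of_nat_Suc)
  have "(of_nat (count_list (y # ys) x) :: complex) = (if j = i then 1 else - 1)"
    using c[of x] by (auto split: if_splits simp: minus_equation_iff)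
  then have ji: "j = i" and cx: "count_list (y # ys) x = 1"
  proof -
    assume a: "(of_nat (count_list (y # ys) x) :: complex) = (if j = i then 1 else - 1)"
    show "j = i"
    proof (rule ccontr)
      assume "j \<noteq> i"
      then have "(of_nat (count_list (y # ys) x + 1) :: complex) = 0" using a by simp
      then show False by (simp only: of_nat_eq_0_iff)
    qed
    then show "count_list (y # ys) x = 1" using a by (metis of_nat_eq_1_iff)
  qed
  have "ys = []"
  proof (cases ys)
    case (Cons z zs)
    then have "z = x" using c[of z] by (auto split: if_splits simp del: of_nat_Suc)
    then show ?thesis using cx y Cons by simp
  qed
  then show ?thesis using ji y by blast
qed

text \<open>No word but a single generator has this weight, and vectors have weight 0, so the
  generator alone spans the weight space.\<close>

lemma simple_weight_space:
  assumes "has_weight s (\<lambda>h. sgn_of i * rdb v x h)"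
  shows "\<exists>c. s \<approx> free_scale c (mono1 (Leaf (gen_of i x)))"
proof -
  have "weight_spanners (\<lambda>h. sgn_of i * rdb v x h) \<subseteq> {mono1 (Leaf (gen_of i x))}"
  proof -
    have "(\<lambda>h. sgn_of i * rdb v x h) \<noteq> (\<lambda>h. 0)"
    proof
      assume "(\<lambda>h. sgn_of i * rdb v x h) = (\<lambda>h. 0)"
      then have "comb v (\<lambda>z. if z = x then sgn_of i else 0) = comb v (\<lambda>_. 0)"
        by (simp only: comb_unit) (simp add: comb_def)
      then show False unfolding comb_eq_iff[OF rd] by (auto dest: fun_cong[of _ _ x] split: if_splits)
    qed
    then show ?thesis unfolding weight_spanners_def using word_wt_simple by fastforce
  qed
  moreover have "s \<in> span {g} \<Longrightarrow> \<exists>c. s \<approx> free_scale c g" for s g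
  proof (induction rule: span.induct)
    case (span_J s)
    then show ?case by (intro exI[of _ 0]) (simp add: cong_0)
  next
    case (span_base s)
    then show ?case by (intro exI[of _ 1]) simp
  next
    case (span_add s t)
    then show ?case using cong_add by (metis free_scale_add_left)
  next
    case (span_scale s c)
    then show ?case using cong_scale by (metis free_scale_scale)
  qed
  moreover have "B \<subseteq> {g} \<Longrightarrow> span B \<subseteq> span {g}" for B g
    by (rule span_minimal) (auto intro: span_base)
  ultimately show ?thesis using weight_space[OF assms] by blast
qed

lemma rda_nonzero: "rda v x \<noteq> 0"
proof
  assume 0: "rda v x = 0"
  have "(\<Sum>y\<in>UNIV. (if y = x then 1 else 0) *\<^sub>C rda v y) = 0"
    by (rule sum.neutral) (use 0 in auto)
  moreover have indep: "(\<Sum>y\<in>UNIV. c y *\<^sub>C rda v y) = 0 \<Longrightarrow> c x = 0" for c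
    using rd unfolding is_root_datum_def by simp
  ultimately show False using indep[of "\<lambda>y. if y = x then 1 else 0"] by simp
qed

lemma EF: "free_bracket (genE x) (genF x) \<approx> genH (rda v x)"
  unfolding cong_def by (rule relators_J[OF relators.EF_same])

text \<open>Otherwise the bracket of \<open>e_x\<close> and \<open>f_x\<close>, which is the nonzero
  vector \<open>a(x)\<close>, would lie in an ideal that meets the vector space trivially.\<close>

lemma gen_notin_J: "mono1 (Leaf (gen_of i x)) \<notin> J"
proof
  assume "mono1 (Leaf (gen_of i x)) \<in> J"
  then have "free_bracket (genE x) (genF x) \<in> J"
    using J_left J_right by (cases i) auto
  then have "genH (rda v x) \<in> J" using cong_J[OF EF] by simp
  then show False using genH_J rda_nonzero by blast
qed

text \<open>Since the ideal meets the vector space trivially, congruent vectors are equal;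
  identities between coroots are recovered from the algebra in this way.\<close>

lemma genH_diff_scale: "genH h - free_scale c (genH k) \<in> J \<longleftrightarrow> h = c *\<^sub>C k"
proof -
  have "genH (h + (- c) *\<^sub>C k) \<approx> genH h + genH ((- c) *\<^sub>C k)"
    using relators_J[OF relators.H_add[of h "(- c) *\<^sub>C k"]] by (simp add: cong_def diff_diff_eq)
  also have "\<dots> \<approx> genH h + free_scale (- c) (genH k)"
    using relators_J[OF relators.H_scale[of "- c" k]]
    by (intro cong_add cong_refl) (simp only: cong_def)
  finally have "genH (h - c *\<^sub>C k) \<approx> genH h - free_scale c (genH k)" by simp
  note * = cong_J[OF this]
  have "genH (0::'h) \<in> J"
    using relators_J[OF relators.H_add[of "0::'h" 0]] J_minus by fastforce
  then show ?thesis using * genH_J[of "h - c *\<^sub>C k"] by auto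
qed

end

section \<open>Comparison of the superalgebras at two objects\<close>

locale lie_hom = A: lie_quotient v J + B: lie_quotient v' J'
  for v :: "('h::fd_complex_vector, 'x::finite) root_datum" and J
    and v' :: "('h, 'x) root_datum" and J' +
  fixes f
  assumes hom: "ideal_hom J J' f"
begin

lemma hom_add: "B.cong (f (s + t)) (f s + f t)"
  and hom_scale: "B.cong (f (free_scale c s)) (free_scale c (f s))"
  and hom_bracket: "B.cong (f (free_bracket s t)) (free_bracket (f s) (f t))"
  and hom_H: "B.cong (f (genH h)) (genH h)"
  and hom_J: "f s \<in> J' \<longleftrightarrow> s \<in> J"
  using hom unfolding ideal_hom_def B.cong_def by simp_all

lemma hom_cong:
  assumes "A.cong s t"
  shows "B.cong (f s) (f t)"
proof -
  have "B.cong (f s) (f (s - t) + f t)" using hom_add[of "s - t" t] by simp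
  also have "B.cong (f (s - t) + f t) (0 + f t)"
    using assms by (intro B.cong_add) (simp_all add: B.cong_0 hom_J A.cong_def)
  finally show ?thesis by simp
qed

lemma hom_weight:
  assumes "A.has_weight s \<alpha>"
  shows "B.has_weight (f s) \<alpha>"
  unfolding B.has_weight_def
proof
  fix h
  have "B.cong (free_bracket (genH h) (f s)) (free_bracket (f (genH h)) (f s))"
    by (intro B.cong_bracket B.cong_sym[OF hom_H] B.cong_refl)
  also have "B.cong \<dots> (f (free_bracket (genH h) s))" by (rule B.cong_sym[OF hom_bracket])
  also have "B.cong \<dots> (f (free_scale (\<alpha> h) s))"
    using assms by (intro hom_cong) (simp add: A.has_weight_def)
  also have "B.cong \<dots> (free_scale (\<alpha> h) (f s))" by (rule hom_scale)
  finally show "B.cong (free_bracket (genH h) (f s)) (free_scale (\<alpha> h) (f s))" .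
qed

lemma hom_gen_weight:
  "B.has_weight (f (mono1 (Leaf (gen_of i x)))) (\<lambda>h. sgn_of i * rdb v x h)"
  by (rule hom_weight) (simp add: A.has_weight_def A.H_gen del: mult_minus_left)

text \<open>The generator \<open>e_x\<close> is nonzero of weight \<open>b(x)\<close>, and so is its
  image, because the homomorphism is injective and fixes the vector space. All weights of the target
  algebra have a sign.\<close>

lemma simple_root_sign: "rdb v x \<in> Qpos v' \<union> Qneg v'"
  using B.weight_pos_or_neg[OF hom_gen_weight[of True x]] A.gen_notin_J[of True x]
  by (simp add: hom_J)

lemma hom_gen:
  assumes "(\<lambda>h. sgn_of i * rdb v x h) = (\<lambda>h. sgn_of j * rdb v' y h)"
  obtains c where "B.cong (f (mono1 (Leaf (gen_of i x)))) (free_scale c (mono1 (Leaf (gen_of j y))))"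
  using B.simple_weight_space[of _ j y] hom_gen_weight[of i x] unfolding assms by blast

text \<open>The images of \<open>e_x\<close> and \<open>f_x\<close> have the weights of
  \<open>e_y\<close> and \<open>f_y\<close>, so they are multiples of these. The bracket of
  \<open>e_x\<close> and \<open>f_x\<close> is a vector, hence fixed, and the product of the two
  factors is the scalar sought.\<close>

lemma coroot_proportional:
  assumes "rdb v x = rdb v' y"
  shows "\<exists>c. c \<noteq> 0 \<and> rda v x = c *\<^sub>C rda v' y"
proof -
  obtain c where c: "B.cong (f (genE x)) (free_scale c (genE y))"
    using hom_gen[of True x True y] assms by auto
  obtain d where d: "B.cong (f (genF x)) (free_scale d (genF y))"
    using hom_gen[of False x False y] assms by auto
  have "B.cong (genH (rda v x)) (f (genH (rda v x)))" by (rule B.cong_sym[OF hom_H])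
  also have "B.cong \<dots> (f (free_bracket (genE x) (genF x)))"
    by (intro hom_cong A.cong_sym[OF A.EF])
  also have "B.cong \<dots> (free_bracket (f (genE x)) (f (genF x)))" by (rule hom_bracket)
  also have "B.cong \<dots> (free_bracket (free_scale c (genE y)) (free_scale d (genF y)))"
    by (intro B.cong_bracket c d)
  also have "\<dots> = free_scale (c * d) (free_bracket (genE y) (genF y))"
    by (simp add: free_bracket_scale_left free_bracket_scale_right mult.commute)
  also have "B.cong \<dots> (free_scale (c * d) (genH (rda v' y)))"
    by (intro B.cong_scale B.EF)
  finally have eq: "rda v x = (c * d) *\<^sub>C rda v' y"
    by (simp add: B.cong_def B.genH_diff_scale)
  moreover have "c * d \<noteq> 0" using eq A.rda_nonzero[of x] by auto
  ultimately show ?thesis by blast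
qed

text \<open>
  If \<open>e\<^sub>x\<close> becomes a multiple of \<open>f\<^sub>x\<close> after a reflexion that fixes the root of \<open>e\<^sub>y\<close>, then
  \<open>[e\<^sub>y, e\<^sub>x] = 0\<close>, and bracketing with \<open>f\<^sub>y\<close> leaves a multiple of \<open>e\<^sub>x\<close>.
\<close>

lemma cartan_zero_of_opposite:
  assumes "x \<noteq> y" "rdb v' x = (\<lambda>h. - rdb v x h)" "rdb v' y = rdb v y"
  shows "cartan v y x = 0"
proof -
  obtain c where c: "B.cong (f (genE y)) (free_scale c (genE y))"
    using hom_gen[of True y True y] assms by auto
  obtain d where d: "B.cong (f (genE x)) (free_scale d (genF x))"
    using hom_gen[of True x False x] assms by auto
  have "B.cong (f (free_bracket (genE y) (genE x))) (free_bracket (f (genE y)) (f (genE x)))"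
    by (rule hom_bracket)
  also have "B.cong \<dots> (free_bracket (free_scale c (genE y)) (free_scale d (genF x)))"
    by (intro B.cong_bracket c d)
  also have "\<dots> = free_scale (c * d) (free_bracket (genE y) (genF x))"
    by (simp add: free_bracket_scale_left free_bracket_scale_right mult.commute)
  also have "B.cong \<dots> 0"
    unfolding B.cong_0 using assms(1) by (intro B.J_scale B.relators_J relators.EF_distinct) simp
  finally have yx: "free_bracket (genE y) (genE x) \<in> J" by (simp add: B.cong_0 hom_J)
  let ?e = "super_sign (parity v (Leaf (GenF y))) (parity v (Leaf (GenE y)))"
  have fyex: "free_bracket (genF y) (genE x) \<in> J"
    using A.antisym[of "Leaf (GenF y)" "Leaf (GenE x)"]
      A.J_scale[OF A.relators_J[OF relators.EF_distinct[OF assms(1)]]] A.cong_J by blast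
  have "A.cong 0 (free_bracket (genF y) (free_bracket (genE y) (genE x)))"
    using A.J_right[OF yx] by (simp add: A.cong_sym A.cong_0)
  also have "A.cong \<dots> (free_bracket (free_bracket (genF y) (genE y)) (genE x) +
      free_scale ?e (free_bracket (genE y) (free_bracket (genF y) (genE x))))"
    by (rule A.jacobi)
  also have "A.cong \<dots> (free_bracket (free_scale (- ?e) (free_bracket (genE y) (genF y))) (genE x) +
      0)"
    by (intro A.cong_add A.cong_bracket A.cong_refl A.antisym)
       (simp add: A.cong_0 A.J_scale A.J_right fyex)
  also have "A.cong \<dots> (free_bracket (free_scale (- ?e) (genH (rda v y))) (genE x) + 0)"
    by (intro A.cong_add A.cong_bracket A.cong_refl A.cong_scale A.EF)
  also have "A.cong \<dots> (free_scale (- ?e) (free_scale (cartan v y x) (genE x)))"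
    using A.H_gen[of "rda v y" True x]
    by (simp add: free_bracket_scale_left cartan_def A.cong_scale del: free_scale_simps free_scale_scale)
  finally have "free_scale (- ?e * cartan v y x) (genE x) \<in> J"
    using A.cong_sym A.cong_0 by (metis free_scale_scale)
  moreover have "?e \<noteq> 0" by (simp add: super_sign_def)
  ultimately show ?thesis
    using A.gen_notin_J[of True x] A.J_scale_iff[of "- ?e * cartan v y x" "genE x"] by auto
qed

end

section \<open>Reflexions of root data\<close>

lemma rdb_linear:
  assumes "is_root_datum v"
  shows "rdb v x (h + k) = rdb v x h + rdb v x k"
    and "rdb v x (c *\<^sub>C h) = c * rdb v x h"
    and "rdb v x (- h) = - rdb v x h"
    and "rdb v x (h - k) = rdb v x h - rdb v x k"
proof -
  have "Vector_Spaces.linear scaleC (*) (rdb v x)" using assms by (simp add: is_root_datum_def)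
  then interpret L: module_hom scaleC "(*)" "rdb v x" by (simp only: linear_iff_module_hom)
  show "rdb v x (h + k) = rdb v x h + rdb v x k" "rdb v x (c *\<^sub>C h) = c * rdb v x h"
    "rdb v x (- h) = - rdb v x h" "rdb v x (h - k) = rdb v x h - rdb v x k"
    by (fact L.add L.scale L.neg L.diff)+
qed

section \<open>Coordinates over the simple roots and the simple coroots\<close>

definition acomb :: "('h::fd_complex_vector, 'x::finite) root_datum \<Rightarrow> ('x \<Rightarrow> complex) \<Rightarrow> 'h" where
  "acomb v c = (\<Sum>x\<in>UNIV. c x *\<^sub>C rda v x)"

lemma acomb_eq_iff:
  assumes "is_root_datum v"
  shows "acomb v c = acomb v d \<longleftrightarrow> c = d"
proof
  assume "acomb v c = acomb v d"
  then have "(\<Sum>x\<in>UNIV. (c x - d x) *\<^sub>C rda v x) = 0"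
    by (simp add: acomb_def scaleC.scale_left_diff_distrib sum_subtractf)
  moreover have indep: "(\<Sum>x\<in>UNIV. k x *\<^sub>C rda v x) = 0 \<Longrightarrow> k x = 0" for k x
    using assms unfolding is_root_datum_def by simp
  ultimately have "c x - d x = 0" for x using indep[of "\<lambda>x. c x - d x"] by simp
  then show "c = d" by auto
qed simp

lemma acomb_add: "acomb v c + acomb v d = acomb v (\<lambda>x. c x + d x)"
  by (simp add: acomb_def scaleC_add_left sum.distrib)

lemma acomb_scale: "k *\<^sub>C acomb v c = acomb v (\<lambda>x. k * c x)"
  by (simp add: acomb_def scaleC.scale_sum_right)

lemma acomb_unit: "acomb v (\<lambda>z. if z = x then c else 0) = c *\<^sub>C rda v x"
proof -
  have "acomb v (\<lambda>z. if z = x then c else 0) = (\<Sum>z\<in>UNIV. if z = x then c *\<^sub>C rda v z else 0)"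
    unfolding acomb_def by (rule sum.cong) auto
  then show ?thesis by simp
qed

lemma acomb_delta: "acomb v (\<lambda>z. of_bool (z = x)) = rda v x"
  using acomb_unit[of v x 1] by (simp add: of_bool_def)

lemma comb_add: "comb v c h + comb v d h = comb v (\<lambda>x. c x + d x) h"
  by (simp add: comb_def distrib_right sum.distrib)

lemma comb_scale: "k * comb v c h = comb v (\<lambda>x. k * c x) h"
  by (simp add: comb_def sum_distrib_left mult.assoc)

lemma comb_uminus: "- comb v c h = comb v (\<lambda>x. - c x) h"
  by (simp add: comb_def sum_negf)

lemma comb_comb:
  assumes "\<And>y. rdb w y = comb v (M y)"
  shows "comb w c = comb v (\<lambda>z. \<Sum>y\<in>UNIV. c y * M y z)"
proof
  fix h
  have "comb w c h = (\<Sum>y\<in>UNIV. \<Sum>z\<in>UNIV. c y * M y z * rdb v z h)"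
    by (simp add: comb_def[of w] assms) (simp add: comb_def sum_distrib_left mult.assoc)
  also have "\<dots> = (\<Sum>z\<in>UNIV. \<Sum>y\<in>UNIV. c y * M y z * rdb v z h)" by (rule sum.swap)
  finally show "comb w c h = comb v (\<lambda>z. \<Sum>y\<in>UNIV. c y * M y z) h"
    by (simp add: comb_def sum_distrib_right)
qed

lemma acomb_acomb:
  assumes "\<And>y. rda w y = acomb v (M y)"
  shows "acomb w c = acomb v (\<lambda>z. \<Sum>y\<in>UNIV. c y * M y z)"
proof -
  have "acomb w c = (\<Sum>y\<in>UNIV. \<Sum>z\<in>UNIV. (c y * M y z) *\<^sub>C rda v z)"
    by (simp add: acomb_def[of w] assms) (simp add: acomb_def scaleC.scale_sum_right)
  also have "\<dots> = (\<Sum>z\<in>UNIV. \<Sum>y\<in>UNIV. (c y * M y z) *\<^sub>C rda v z)" by (rule sum.swap)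
  finally show ?thesis by (simp add: acomb_def scaleC.scale_sum_left)
qed

text \<open>One coefficient for all cases: a reflexion adds to the vector labelled \<open>y\<close>
  a multiple of the one labelled \<open>x\<close>. The value -2 at \<open>y = x\<close> expresses
  the change of sign, also in the isotropic case.\<close>

definition refl_a :: "('h, 'x) root_datum \<Rightarrow> 'x \<Rightarrow> 'x \<Rightarrow> complex" where
  "refl_a v x y = (if cartan v x x \<noteq> 0 then - 2 * cartan v y x / cartan v x x
     else if y = x then - 2 else if cartan v x y = 0 then 0 else cartan v y x / cartan v x y)"

definition refl_b :: "('h, 'x) root_datum \<Rightarrow> 'x \<Rightarrow> 'x \<Rightarrow> complex" where
  "refl_b v x y = (if cartan v x x \<noteq> 0 then - 2 * cartan v x y / cartan v x x
     else if y = x then - 2 else if cartan v x y = 0 then 0 else 1)"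

lemma refl_self [simp]: "refl_a v x x = - 2" "refl_b v x x = - 2"
  by (simp_all add: refl_a_def refl_b_def)

lemma scaleC_minus_two: "u + (- 2) *\<^sub>C u = - (u :: 'h::complex_vector)"
proof -
  have "u + (- 2) *\<^sub>C u = (1 + (- 2)) *\<^sub>C u" by (simp only: scaleC_add_left scaleC_one)
  then show ?thesis by simp
qed

lemma rda_reflexion: "rda (reflexion x v) y = rda v y + refl_a v x y *\<^sub>C rda v x"
  using scaleC_minus_two[of "rda v x"] by (auto simp: reflexion_def refl_a_def)

lemma rdb_reflexion: "rdb (reflexion x v) y = (\<lambda>h. rdb v y h + refl_b v x y * rdb v x h)"
  by (auto simp: reflexion_def refl_b_def fun_eq_iff)

lemma rda_reflexion_self: "rda (reflexion x v) x = - rda v x"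
  using scaleC_minus_two[of "rda v x"] by (simp add: rda_reflexion)

lemma rdb_reflexion_self: "rdb (reflexion x v) x = (\<lambda>h. - rdb v x h)"
  by (simp add: rdb_reflexion)

lemma rdb_reflexion_comb:
  "rdb (reflexion x v) y = comb v (\<lambda>z. of_bool (z = y) + (if z = x then refl_b v x y else 0))"
  unfolding rdb_reflexion by (simp add: fun_eq_iff comb_add[symmetric] comb_delta comb_unit)

lemma rda_reflexion_acomb:
  "rda (reflexion x v) y = acomb v (\<lambda>z. of_bool (z = y) + (if z = x then refl_a v x y else 0))"
  by (simp add: rda_reflexion acomb_add[symmetric] acomb_delta acomb_unit)

lemma sum_delta_if: "(\<Sum>y\<in>UNIV. c y * (of_bool (z = y) + (if z = x then k y else 0))) =
    c z + (if z = x then (\<Sum>y\<in>UNIV. c y * k y) else (0::'a::comm_ring_1))" for z :: "'x::finite"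
proof -
  have "(\<Sum>y\<in>UNIV. c y * of_bool (z = y)) = (\<Sum>y\<in>UNIV. if y = z then c y else 0)"
    by (rule sum.cong) auto
  then show ?thesis by (simp add: distrib_left sum.distrib)
qed

lemma comb_reflexion:
  "comb (reflexion x v) c =
   comb v (\<lambda>z. c z + (if z = x then (\<Sum>y\<in>UNIV. c y * refl_b v x y) else 0))"
  by (subst comb_comb[OF rdb_reflexion_comb]) (simp only: sum_delta_if)

lemma acomb_reflexion:
  "acomb (reflexion x v) c =
   acomb v (\<lambda>z. c z + (if z = x then (\<Sum>y\<in>UNIV. c y * refl_a v x y) else 0))"
  by (subst acomb_acomb[OF rda_reflexion_acomb]) (simp only: sum_delta_if)

text \<open>The change of coordinates alters only the coordinate at \<open>x\<close>, where its
  diagonal entry is \<open>1 + k x = - 1\<close>; it is therefore invertible.\<close>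

lemma reflected_coefficients_zero:
  fixes c :: "'x::finite \<Rightarrow> complex"
  assumes "(\<lambda>z. c z + (if z = x then (\<Sum>y\<in>UNIV. c y * k y) else 0)) = (\<lambda>_. 0)" "k x = - 2"
  shows "c = (\<lambda>_. 0)"
proof -
  have c: "c z = 0" if "z \<noteq> x" for z using fun_cong[OF assms(1), of z] that by simp
  have "(\<Sum>y\<in>UNIV. c y * k y) = (\<Sum>y\<in>UNIV. if y = x then c x * k x else 0)"
    by (rule sum.cong) (auto simp: c)
  then have "c x = 0" using fun_cong[OF assms(1), of x] assms(2) by simp
  with c show ?thesis by fastforce
qed

lemma is_root_datum_reflexion:
  assumes v: "is_root_datum v"
  shows "is_root_datum (reflexion x v)"
proof -
  have "Vector_Spaces.linear scaleC (*) (rdb (reflexion x v) y)" for y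
    unfolding Vector_Spaces.linear_iff
    by (auto simp: rdb_reflexion rdb_linear[OF v] algebra_simps vector_space_scaleC vector_space_def)
  moreover have "c y = 0" if "(\<Sum>y\<in>UNIV. c y *\<^sub>C rda (reflexion x v) y) = 0" for c y
  proof -
    have "acomb (reflexion x v) c = acomb v (\<lambda>_. 0)" using that by (simp add: acomb_def)
    then have "c = (\<lambda>_. 0)"
      unfolding acomb_reflexion acomb_eq_iff[OF v]
      by (rule reflected_coefficients_zero) simp
    then show ?thesis by simp
  qed
  moreover have "c y = 0" if "\<forall>h. (\<Sum>y\<in>UNIV. c y * rdb (reflexion x v) y h) = 0" for c y
  proof -
    have "comb (reflexion x v) c = comb v (\<lambda>_. 0)" using that by (simp add: comb_def)
    then have "c = (\<lambda>_. 0)"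
      unfolding comb_reflexion comb_eq_iff[OF v]
      by (rule reflected_coefficients_zero) simp
    then show ?thesis by simp
  qed
  ultimately show ?thesis unfolding is_root_datum_def by blast
qed

section \<open>Cartan matrices after a reflexion, and involutivity\<close>

lemma cartan_reflexion:
  assumes v: "is_root_datum v"
  shows "cartan (reflexion x v) y z = cartan v y z + refl_b v x z * cartan v y x +
    refl_a v x y * (cartan v x z + refl_b v x z * cartan v x x)"
  by (simp add: cartan_def rdb_reflexion rda_reflexion rdb_linear[OF v] algebra_simps)

lemma cartan_reflexion_row:
  assumes v: "is_root_datum v"
  shows "cartan (reflexion x v) x z = - cartan v x z - refl_b v x z * cartan v x x"
  by (simp add: cartan_reflexion[OF v])

lemma cartan_reflexion_column:
  assumes v: "is_root_datum v"
  shows "cartan (reflexion x v) y x = - cartan v y x - refl_a v x y * cartan v x x"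
  by (simp add: cartan_reflexion[OF v])

text \<open>The row and the column of \<open>x\<close> stay the same in the anisotropic case and
  both change sign in the isotropic case. The coefficients depend only on quotients and zeros of
  these entries. This makes a reflexion an involution.\<close>

lemma refl_reflexion:
  assumes v: "is_root_datum v"
  shows "refl_a (reflexion x v) x y = refl_a v x y" "refl_b (reflexion x v) x y = refl_b v x y"
  by (auto simp: refl_a_def[of "reflexion x v"] refl_b_def[of "reflexion x v"]
      cartan_reflexion_row[OF v] cartan_reflexion_column[OF v])
     (auto simp: refl_a_def refl_b_def field_simps)

lemma reflectable_reflexion:
  assumes v: "is_root_datum v" and r: "reflectable v x"
  shows "reflectable (reflexion x v) x"
proof -
  have p: "rdp (reflexion x v) x = rdp v x" by (simp add: reflexion_def)
  have xx: "cartan (reflexion x v) x x = cartan v x x"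
    by (simp add: cartan_reflexion_row[OF v])
  have xy: "cartan (reflexion x v) x y = cartan v x y" if "cartan v x x \<noteq> 0" for y
    using that by (simp add: cartan_reflexion_row[OF v] refl_b_def)
  show ?thesis using r unfolding reflectable_def p xx by (auto simp: xy)
qed

lemma reflexion_reflexion:
  assumes v: "is_root_datum v"
  shows "reflexion x (reflexion x v) = v"
proof (rule root_datum.equality)
  show "rda (reflexion x (reflexion x v)) = rda v"
    by (rule ext)
       (simp add: rda_reflexion[of x "reflexion x v"] refl_reflexion[OF v] rda_reflexion_self
          rda_reflexion)
  show "rdb (reflexion x (reflexion x v)) = rdb v"
    by (simp add: fun_eq_iff rdb_reflexion[of x "reflexion x v"] refl_reflexion[OF v]
          rdb_reflexion_self rdb_reflexion)
  show "rdp (reflexion x (reflexion x v)) = rdp v"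
  proof (cases "cartan v x x = 0")
    case True
    have "cartan (reflexion x v) x y = 0 \<longleftrightarrow> cartan v x y = 0" "cartan (reflexion x v) x x = 0" for y
      using True by (simp_all add: cartan_reflexion_row[OF v])
    moreover have "1 + (1 + b) = b" for b :: bit by (cases b) simp_all
    ultimately show ?thesis using True by (simp add: reflexion_def[of x "reflexion x v"])
        (auto simp: reflexion_def fun_eq_iff)
  next
    case False
    moreover have "cartan (reflexion x v) x x \<noteq> 0"
      using False by (simp add: cartan_reflexion_row[OF v])
    ultimately show ?thesis by (simp add: reflexion_def[of x "reflexion x v"])
        (simp add: reflexion_def)
  qed
qed simp

text \<open>The evenness for odd anisotropic \<open>x\<close> is recorded because it makes the
  parity additive on the root lattice.\<close>

lemma reflectable_refl_b:
  assumes "reflectable v x" "y \<noteq> x"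
  shows "\<exists>k::nat. refl_b v x y = of_nat k \<and> (cartan v x x \<noteq> 0 \<and> rdp v x = 1 \<longrightarrow> even k)"
proof (cases "cartan v x x = 0")
  case True
  then show ?thesis using assms by (auto simp: refl_b_def intro: exI[of _ 0] exI[of _ 1])
next
  case False
  have nonpos: "\<exists>k::nat. - z = of_nat k" if "z \<in> nonpos_Ints" for z :: complex
    using nonpos_Ints_cases'[OF that] by fastforce
  show ?thesis
  proof (cases "rdp v x = 0")
    case True
    then have "2 * cartan v x y / cartan v x x \<in> nonpos_Ints"
      using assms False by (simp add: reflectable_def)
    then obtain k :: nat where "- (2 * cartan v x y / cartan v x x) = of_nat k"
      using nonpos by metis
    then show ?thesis using True False by (intro exI[of _ k]) (simp add: refl_b_def)
  next
    case p: False
    then have "cartan v x y / cartan v x x \<in> nonpos_Ints"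
      using assms False by (cases "rdp v x") (simp_all add: reflectable_def)
    then obtain k :: nat where "- (cartan v x y / cartan v x x) = of_nat k"
      using nonpos by metis
    then have "refl_b v x y = 2 * of_nat k"
      using False by (simp add: refl_b_def flip: times_divide_eq_right minus_mult_right)
    then have "refl_b v x y = of_nat (2 * k)" by simp
    then show ?thesis by (intro exI[of _ "2 * k"]) simp
  qed
qed

section \<open>Compatibility of reflexions with tautological arrows\<close>

lemma taut_simps:
  assumes "bij \<theta>"
  shows "cartan (taut \<theta> v) x y = cartan v x y" "rda (taut \<theta> v) x = \<theta> (rda v x)"
    "rdb (taut \<theta> v) x = (\<lambda>h. rdb v x (inv \<theta> h))" "rdp (taut \<theta> v) = rdp v"
  using assms by (simp_all add: cartan_def taut_def bij_is_inj)

lemma reflectable_taut: "bij \<theta> \<Longrightarrow> reflectable (taut \<theta> v) x \<longleftrightarrow> reflectable v x"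
  by (simp add: reflectable_def taut_simps)

lemma reflexion_taut:
  assumes \<theta>: "bij \<theta>" "Vector_Spaces.linear scaleC scaleC \<theta>"
  shows "reflexion x (taut \<theta> v) = taut \<theta> (reflexion x v)"
proof -
  have lin: "\<theta> (h + k) = \<theta> h + \<theta> k" "\<theta> (c *\<^sub>C h) = c *\<^sub>C \<theta> h" for h k c
    using \<theta>(2) by (simp_all add: Vector_Spaces.linear_iff)
  have "refl_a (taut \<theta> v) x y = refl_a v x y" "refl_b (taut \<theta> v) x y = refl_b v x y" for y
    by (simp_all add: refl_a_def refl_b_def taut_simps[OF \<theta>(1)])
  then show ?thesis
    by (intro root_datum.equality)
       (simp_all add: fun_eq_iff taut_simps[OF \<theta>(1)] rda_reflexion rdb_reflexion lin,
        simp add: reflexion_def taut_simps[OF \<theta>(1)])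
qed

section \<open>Skeleta\<close>

text \<open>The simple roots lie in a common lattice, on which the parity is a homomorphism.\<close>

definition int_trans :: "('h, 'x::finite) root_datum \<Rightarrow> ('h, 'x) root_datum \<Rightarrow> bool" where
  "int_trans v w \<longleftrightarrow> (\<exists>N :: 'x \<Rightarrow> 'x \<Rightarrow> int. \<forall>y.
     rdb w y = comb v (\<lambda>z. of_int (N y z)) \<and> rdp w y = (\<Sum>z\<in>UNIV. of_int (N y z) * rdp v z))"

lemma int_trans_refl: "int_trans v v"
  unfolding int_trans_def
proof (intro exI[of _ "\<lambda>y z. of_bool (z = y)"] allI conjI)
  show "rdb v y = comb v (\<lambda>z. of_int (of_bool (z = y)))" for y by (simp add: comb_delta)
  have "(\<Sum>z\<in>UNIV. of_int (of_bool (z = y)) * rdp v z) = (\<Sum>z\<in>UNIV. if z = y then rdp v z else 0)" for y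
    by (rule sum.cong) auto
  then show "rdp v y = (\<Sum>z\<in>UNIV. of_int (of_bool (z = y)) * rdp v z)" for y by simp
qed

lemma int_trans_trans:
  assumes "int_trans u v" "int_trans v w"
  shows "int_trans u w"
proof -
  obtain M :: "'b \<Rightarrow> 'b \<Rightarrow> int" where M: "\<And>y. rdb v y = comb u (\<lambda>z. of_int (M y z))"
    "\<And>y. rdp v y = (\<Sum>z\<in>UNIV. of_int (M y z) * rdp u z)"
    using assms(1) by (auto simp: int_trans_def)
  obtain N :: "'b \<Rightarrow> 'b \<Rightarrow> int" where N: "\<And>y. rdb w y = comb v (\<lambda>z. of_int (N y z))"
    "\<And>y. rdp w y = (\<Sum>z\<in>UNIV. of_int (N y z) * rdp v z)"
    using assms(2) by (auto simp: int_trans_def)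
  show ?thesis
    unfolding int_trans_def
  proof (intro exI[of _ "\<lambda>y z. \<Sum>t\<in>UNIV. N y t * M t z"] allI conjI)
    fix y
    show "rdb w y = comb u (\<lambda>z. of_int (\<Sum>t\<in>UNIV. N y t * M t z))"
      unfolding N(1) by (subst comb_comb[OF M(1)]) simp
    have "rdp w y = (\<Sum>t\<in>UNIV. \<Sum>z\<in>UNIV. of_int (N y t) * of_int (M t z) * rdp u z)"
      by (simp only: N(2) M(2) sum_distrib_left mult.assoc)
    also have "\<dots> = (\<Sum>z\<in>UNIV. \<Sum>t\<in>UNIV. of_int (N y t) * of_int (M t z) * rdp u z)"
      by (rule sum.swap)
    finally show "rdp w y = (\<Sum>z\<in>UNIV. of_int (\<Sum>t\<in>UNIV. N y t * M t z) * rdp u z)"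
      by (simp only: of_int_sum of_int_mult sum_distrib_right)
  qed
qed

text \<open>A reflectable isotropic \<open>x\<close> is odd, and the parity of another label changes
  exactly when the coefficient is 1. For anisotropic \<open>x\<close> parities stay the same, and
  the coefficient is even whenever \<open>x\<close> is odd.\<close>

lemma refl_parity:
  assumes "reflectable v x"
  shows "\<exists>k::int. refl_b v x y = of_int k \<and> rdp (reflexion x v) y = rdp v y + of_int k * rdp v x"
proof (cases "y = x")
  case True
  have "rdp (reflexion x v) x = rdp v x" by (simp add: reflexion_def)
  then show ?thesis using True by (intro exI[of _ "- 2"]) simp
next
  case False
  obtain k :: nat where k: "refl_b v x y = of_nat k" "cartan v x x \<noteq> 0 \<and> rdp v x = 1 \<longrightarrow> even k"
    using reflectable_refl_b[OF assms False] by blast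
  show ?thesis
  proof (cases "cartan v x x = 0")
    case True
    then have "rdp v x = 1" using assms by (simp add: reflectable_def)
    then show ?thesis using True False
      by (cases "cartan v x y = 0") (auto simp: refl_b_def reflexion_def intro: exI[of _ 0] exI[of _ 1])
  next
    case aniso: False
    then have p: "rdp (reflexion x v) y = rdp v y" by (simp add: reflexion_def)
    have "of_int (int k) * rdp v x = 0"
    proof (cases "rdp v x = 1")
      case True
      then have "even k" using k aniso by blast
      then show ?thesis by (auto elim!: evenE)
    qed simp
    then show ?thesis using k(1) p by (intro exI[of _ "int k"]) simp
  qed
qed

lemma int_trans_reflexion:
  assumes "reflectable v x"
  shows "int_trans v (reflexion x v)"
proof -
  obtain k :: "'b \<Rightarrow> int" where k: "\<And>y. refl_b v x y = of_int (k y)"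
    "\<And>y. rdp (reflexion x v) y = rdp v y + of_int (k y) * rdp v x"
    using refl_parity[OF assms] by metis
  show ?thesis
    unfolding int_trans_def
  proof (intro exI[of _ "\<lambda>y z. of_bool (z = y) + (if z = x then k y else 0)"] allI conjI)
    fix y
    show "rdb (reflexion x v) y = comb v (\<lambda>z. of_int (of_bool (z = y) + (if z = x then k y else 0)))"
      unfolding rdb_reflexion_comb by (rule arg_cong[of _ _ "comb v"]) (auto simp: k fun_eq_iff)
    have "(\<Sum>z\<in>UNIV. of_int (of_bool (z = y) + (if z = x then k y else 0)) * rdp v z) =
      (\<Sum>z\<in>UNIV. (if z = y then rdp v z else 0) + (if z = x then of_int (k y) * rdp v z else 0))"
      by (rule sum.cong) (auto simp: distrib_right simp del: add_bit_eq_xor mult_bit_eq_and)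
    also have "\<dots> = rdp v y + of_int (k y) * rdp v x"
      by (simp add: sum.distrib del: add_bit_eq_xor mult_bit_eq_and)
    finally show "rdp (reflexion x v) y =
      (\<Sum>z\<in>UNIV. of_int (of_bool (z = y) + (if z = x then k y else 0)) * rdp v z)"
      by (simp only: k)
  qed
qed

lemma of_nat_eq_minus_of_nat: "(of_nat m :: complex) = - of_nat n \<longleftrightarrow> m = 0 \<and> n = 0"
proof -
  have "(of_nat m :: complex) = - of_nat n \<longleftrightarrow> (of_nat (m + n) :: complex) = 0"
    by (simp add: eq_neg_iff_add_eq_0)
  then show ?thesis by (simp only: of_nat_eq_0_iff) simp
qed

text \<open>The combinatorial argument sees the superalgebras only through \<open>sign\<close>,
  \<open>coroot\<close> and \<open>cartan_sym\<close>; the other assumptions describe chains of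
  reflexions of any root datum.\<close>

locale skeleton =
  fixes S :: "('h::fd_complex_vector, 'x::finite) root_datum set"
  assumes rd: "v \<in> S \<Longrightarrow> is_root_datum v"
    and closed: "v \<in> S \<Longrightarrow> reflectable v x \<Longrightarrow> reflexion x v \<in> S"
    and conn: "v \<in> S \<Longrightarrow> w \<in> S \<Longrightarrow> (v, w) \<in> reflexion_step\<^sup>*"
    and sign: "v \<in> S \<Longrightarrow> w \<in> S \<Longrightarrow> rdb v x \<in> Qpos w \<union> Qneg w"
    and coroot: "v \<in> S \<Longrightarrow> w \<in> S \<Longrightarrow> rdb v x = rdb w y \<Longrightarrow> \<exists>c. c \<noteq> 0 \<and> rda v x = c *\<^sub>C rda w y"
    and cartan_sym: "v \<in> S \<Longrightarrow> reflectable v x \<Longrightarrow> cartan v x y = 0 \<Longrightarrow> cartan v y x = 0"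
begin

section \<open>Signs of real roots, and walls\<close>

definition "roots = {rdb u x | u x. u \<in> S}"
definition "pos u = roots \<inter> Qpos u"

lemma rootI: "u \<in> S \<Longrightarrow> rdb u x \<in> roots" by (auto simp: roots_def)

lemma int_trans_S: "v \<in> S \<Longrightarrow> w \<in> S \<Longrightarrow> int_trans v w"
proof -
  assume v: "v \<in> S" "w \<in> S"
  from conn[OF v] show ?thesis
  proof induction
    case (step y z)
    then show ?case using int_trans_trans int_trans_reflexion by (fastforce simp: reflexion_step_def)
  qed (rule int_trans_refl)
qed

lemma comb_in_Qpos: "w \<in> S \<Longrightarrow> comb w c \<in> Qpos w \<longleftrightarrow> (\<exists>n. \<forall>z. c z = of_nat (n z))"
  unfolding Qpos_def by (simp add: comb_eq_iff[OF rd]) (simp add: fun_eq_iff)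

lemma comb_in_Qneg: "w \<in> S \<Longrightarrow> comb w c \<in> Qneg w \<longleftrightarrow> (\<exists>n. \<forall>z. c z = - of_nat (n z))"
  unfolding Qneg_def by (simp add: comb_eq_iff[OF rd]) (simp add: fun_eq_iff)

lemma root_sign: "\<alpha> \<in> roots \<Longrightarrow> w \<in> S \<Longrightarrow> \<alpha> \<in> Qpos w \<or> \<alpha> \<in> Qneg w"
  using sign by (auto simp: roots_def)

lemma root_nonzero:
  assumes "comb w c \<in> roots" "w \<in> S"
  shows "\<exists>z. c z \<noteq> 0"
proof (rule ccontr)
  assume "\<nexists>z. c z \<noteq> 0"
  then have 0: "comb w c = (\<lambda>h. 0)" by (simp add: comb_def)
  obtain u x where u: "u \<in> S" "comb w c = rdb u x" using assms by (auto simp: roots_def)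
  have "comb u (\<lambda>z. of_bool (z = x)) = comb u (\<lambda>_. 0)"
    using u 0 by (simp add: comb_delta) (simp add: comb_def)
  then show False unfolding comb_eq_iff[OF rd[OF u(1)]] by (auto dest: fun_cong[of _ _ x])
qed

text \<open>Both cones contain 0, so it is the nonvanishing of roots that separates them.\<close>

lemma Q_disjoint:
  assumes "\<alpha> \<in> roots" "w \<in> S" "\<alpha> \<in> Qpos w"
  shows "\<alpha> \<notin> Qneg w"
proof
  assume "\<alpha> \<in> Qneg w"
  then obtain n :: "'x \<Rightarrow> nat" where n: "\<alpha> = comb w (\<lambda>z. - of_nat (n z))" by (auto simp: Qneg_def)
  then obtain m where m: "\<And>z. - of_nat (n z) = (of_nat (m z) :: complex)"
    using assms(2,3) comb_in_Qpos by auto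
  have "n z = 0" for z using m[of z] of_nat_eq_minus_of_nat[of "m z" "n z"] by simp
  then show False using root_nonzero assms n by fastforce
qed

lemma not_pos_iff: "\<alpha> \<in> roots \<Longrightarrow> w \<in> S \<Longrightarrow> \<alpha> \<notin> pos w \<longleftrightarrow> \<alpha> \<in> Qneg w"
  using root_sign Q_disjoint by (auto simp: pos_def)

text \<open>The value 1 suffices for all uses: adding multiples of other simple roots to a simple
  root leaves its own coefficient equal to 1.\<close>

lemma pos_of_positive_coefficient:
  assumes "comb w c \<in> roots" "w \<in> S" "c z = 1"
  shows "comb w c \<in> Qpos w"
proof (rule ccontr)
  assume "comb w c \<notin> Qpos w"
  then obtain n where n: "\<And>z. c z = - of_nat (n z)"
    using root_sign assms comb_in_Qneg by metis
  then show False using of_nat_eq_minus_of_nat[of 1 "n z"] assms(3) by simp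
qed

lemma simple_pos: "w \<in> S \<Longrightarrow> rdb w x \<in> pos w"
  using pos_of_positive_coefficient[of w "\<lambda>z. of_bool (z = x)" x] rootI[of w x]
  by (simp add: comb_delta pos_def)

text \<open>A root is simple at some object \<open>u\<close>, hence belongs to a basis of the common
  lattice and is not a proper multiple of a lattice vector.\<close>

lemma primitive:
  assumes "\<alpha> \<in> roots" "w \<in> S" "\<alpha> = comb w (\<lambda>z. if z = x then of_int n else 0)"
  shows "n = 1 \<or> n = - 1"
proof -
  obtain u y where u: "u \<in> S" "\<alpha> = rdb u y" using assms by (auto simp: roots_def)
  obtain N :: "'x \<Rightarrow> 'x \<Rightarrow> int" where N: "rdb w x = comb u (\<lambda>z. of_int (N x z))"
    using int_trans_S[OF u(1) assms(2)] unfolding int_trans_def by blast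
  have "comb u (\<lambda>z. of_bool (z = y)) = comb u (\<lambda>z. of_int n * of_int (N x z))"
    using assms(3) u(2) by (simp add: comb_delta comb_unit N comb_scale fun_eq_iff)
  then have "of_bool (y = y) = (of_int n * of_int (N x y) :: complex)"
    unfolding comb_eq_iff[OF rd[OF u(1)]] by (rule fun_cong)
  then have "(of_int (n * N x y) :: complex) = 1" by simp
  then have "n * N x y = 1" by (simp only: of_int_eq_1_iff)
  then show ?thesis by (auto simp: zmult_eq_1_iff)
qed

lemma pos_single:
  assumes "comb w c \<in> pos w" "w \<in> S" "\<And>z. z \<noteq> x \<Longrightarrow> c z = 0"
  shows "comb w c = rdb w x"
proof -
  obtain n where n: "\<And>z. c z = of_nat (n z)"
    using assms(1,2) comb_in_Qpos by (auto simp: pos_def)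
  have c: "c = (\<lambda>z. if z = x then of_int (int (n x)) else 0)" using assms(3) n by auto
  have "int (n x) = 1 \<or> int (n x) = - 1"
    using primitive[OF _ assms(2)] assms(1) c unfolding pos_def by blast
  then have "c = (\<lambda>z. of_bool (z = x))" using c by (auto simp: fun_eq_iff)
  then show ?thesis by (simp add: comb_delta)
qed

text \<open>Only the coefficient at \<open>x\<close> is altered. A positive root that becomes
  negative therefore has no other nonzero coefficient, and by primitivity it is \<open>b(x)\<close>
  itself.\<close>

lemma pos_reflexion:
  assumes v: "v \<in> S" and r: "reflectable v x"
  shows "pos (reflexion x v) = insert (\<lambda>h. - rdb v x h) (pos v - {rdb v x})"
proof -
  \<comment> \<open>Stated for every object, since the reverse inclusion applies it to the reflected
    one.\<close>
  have sub: "\<beta> \<in> pos (reflexion x v)" if v: "v \<in> S" "reflectable v x" and \<beta>: "\<beta> \<in> pos v" "\<beta> \<noteq> rdb v x"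
    for v \<beta>
  proof (rule ccontr)
    assume "\<beta> \<notin> pos (reflexion x v)"
    then have "\<beta> \<in> Qneg (reflexion x v)"
      using not_pos_iff closed[OF v] \<beta>(1) by (auto simp: pos_def)
    then obtain m :: "'x \<Rightarrow> nat" where m: "\<beta> = comb (reflexion x v) (\<lambda>z. - of_nat (m z))"
      by (auto simp: Qneg_def)
    define c where "c = (\<lambda>z. - of_nat (m z) +
      (if z = x then (\<Sum>y\<in>UNIV. - of_nat (m y) * refl_b v x y) else 0))"
    have c: "\<beta> = comb v c" unfolding m comb_reflexion c_def ..
    then obtain n where n: "\<And>z. c z = of_nat (n z)"
      using \<beta>(1) v(1) comb_in_Qpos by (auto simp: pos_def)
    have "c z = 0" if "z \<noteq> x" for z
    proof -
      have "n z = 0" using n[of z] that of_nat_eq_minus_of_nat[of "n z" "m z"] by (simp add: c_def)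
      then show ?thesis using n by simp
    qed
    then show False using pos_single[of v c x] \<beta> c v(1) by blast
  qed
  have w: "reflexion x v \<in> S" by (rule closed[OF v r])
  have neg: "(\<lambda>h. - rdb v x h) = rdb (reflexion x v) x" by (simp add: rdb_reflexion_self)
  have notin: "rdb v x \<notin> pos (reflexion x v)" if "v \<in> S" "reflectable v x" for v
  proof -
    have "rdb v x = comb (reflexion x v) (\<lambda>z. - of_nat (of_bool (z = x)))"
      by (simp add: fun_eq_iff comb_uminus[symmetric] comb_delta rdb_reflexion_self)
    then have "rdb v x \<in> Qneg (reflexion x v)" unfolding Qneg_def by (intro CollectI exI)
    then show ?thesis using not_pos_iff rootI closed that by blast
  qed
  show ?thesis
  proof (intro equalityI subsetI)
    fix \<beta> assume \<beta>: "\<beta> \<in> pos (reflexion x v)"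
    show "\<beta> \<in> insert (\<lambda>h. - rdb v x h) (pos v - {rdb v x})"
    proof (cases "\<beta> = (\<lambda>h. - rdb v x h)")
      case False
      then have "\<beta> \<in> pos v"
        using sub[OF w reflectable_reflexion[OF rd[OF v] r] \<beta>] neg reflexion_reflexion[OF rd[OF v]]
        by simp
      then show ?thesis using notin[OF v r] \<beta> by auto
    qed simp
  next
    fix \<beta> assume "\<beta> \<in> insert (\<lambda>h. - rdb v x h) (pos v - {rdb v x})"
    then show "\<beta> \<in> pos (reflexion x v)" using sub[OF v r] simple_pos[OF w, of x] neg by auto
  qed
qed

lemma neg_root: "v \<in> S \<Longrightarrow> reflectable v x \<Longrightarrow> (\<lambda>h. - rdb v x h) \<in> roots"
  using rootI[OF closed, of v x x] by (simp add: rdb_reflexion_self)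

lemma uminus_Qneg: "(\<lambda>h. - \<alpha> h) \<in> Qneg w \<longleftrightarrow> \<alpha> \<in> Qpos w"
proof -
  have "(\<lambda>h. - \<alpha> h) = comb w (\<lambda>x. - c x) \<longleftrightarrow> \<alpha> = comb w c" for c
    by (auto simp: fun_eq_iff comb_uminus[symmetric])
  then show ?thesis by (simp add: Qpos_def Qneg_def)
qed

lemma neg_pos_iff:
  assumes "v \<in> S" "reflectable v x" "w \<in> S"
  shows "(\<lambda>h. - rdb v x h) \<in> pos w \<longleftrightarrow> rdb v x \<notin> pos w"
  using not_pos_iff[OF neg_root[OF assms(1,2)] assms(3)] rootI[OF assms(1), of x]
  by (auto simp: uminus_Qneg pos_def)

text \<open>For anisotropic \<open>y\<close> the reflexion of \<open>u\<close> is its tautological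
  image under the reflection \<open>s\<close> of the vector space. Reflexions commute with
  tautological arrows, so \<open>s\<close> carries a chain from \<open>u\<close> to \<open>w\<close>
  to a chain that starts, and hence stays, in the skeleton; the simple roots of the image of
  \<open>w\<close> are then roots.\<close>

lemma reflected_root:
  assumes u: "u \<in> S" and r: "reflectable u y" and aniso: "cartan u y y \<noteq> 0" and w: "w \<in> S"
  shows "(\<lambda>h. rdb w z h - 2 * rdb w z (rda u y) / cartan u y y * rdb u y h) \<in> roots"
proof -
  define s where "s h = h - (2 * rdb u y h / cartan u y y) *\<^sub>C rda u y" for h
  have lin: "Vector_Spaces.linear scaleC scaleC s"
    unfolding Vector_Spaces.linear_iff
  proof (intro conjI allI vector_space_scaleC)
    show "s (h + k) = s h + s k" for h k
      by (simp add: s_def rdb_linear[OF rd[OF u]] add_divide_distrib distrib_left scaleC_add_left)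
    show "s (c *\<^sub>C h) = c *\<^sub>C s h" for c h
      by (simp add: s_def rdb_linear[OF rd[OF u]] scaleC.scale_right_diff_distrib mult.left_commute)
  qed
  have ya: "rdb u y (rda u y) = cartan u y y" by (simp add: cartan_def)
  have ss: "s (s h) = h" for h
    using aniso by (simp add: s_def rdb_linear[OF rd[OF u]] ya scaleC_add_left[symmetric])
  have bij: "bij s" by (rule involuntory_imp_bij) (rule ss)
  have inv: "inv s = s" by (rule inv_unique_comp) (simp_all add: fun_eq_iff ss)
  have "taut s u = reflexion y u"
    using aniso
    by (intro root_datum.equality)
       (simp_all add: taut_simps[OF bij] inv fun_eq_iff reflexion_def s_def rdb_linear[OF rd[OF u]]
         cartan_def)
  then have "taut s u \<in> S" using closed[OF u r] by simp
  with conn[OF u w] have "taut s w \<in> S"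
  proof induction
    case (step p q)
    then obtain t where "q = reflexion t p" "reflectable p t" by (auto simp: reflexion_step_def)
    moreover have "taut s p \<in> S" using step by blast
    ultimately show ?case
      using closed[of "taut s p" t] reflectable_taut[OF bij, of p t] reflexion_taut[OF bij lin, of t p]
      by simp
  qed
  from rootI[OF this, of z] show ?thesis
    by (simp add: taut_simps[OF bij] inv s_def rdb_linear[OF rd[OF w]] mult_ac)
qed

text \<open>Equal roots have equal parity and proportional coroots, which settles the isotropic
  case. In the anisotropic case the reflection of \<open>b(z)\<close> is a root
  \<open>b(z) - k b(x)\<close> with coefficient 1 at \<open>z\<close>, hence positive, so
  \<open>- k\<close> is a natural number.\<close>

lemma reflectable_transfer:
  assumes u: "u \<in> S" and v: "v \<in> S" and r: "reflectable u y" and eq: "rdb v x = rdb u y"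
  shows "reflectable v x"
proof -
  define a where "a = rda u y"
  obtain c where c: "c \<noteq> 0" "rda v x = c *\<^sub>C a" using coroot[OF v u eq] a_def by blast
  obtain N :: "'x \<Rightarrow> 'x \<Rightarrow> int" where N: "\<And>z. rdb v z = comb u (\<lambda>t. of_int (N z t))"
    "\<And>z. rdp v z = (\<Sum>t\<in>UNIV. of_int (N z t) * rdp u t)"
    using int_trans_S[OF u v] unfolding int_trans_def by blast
  have "comb u (\<lambda>t. of_int (N x t)) = comb u (\<lambda>t. of_bool (t = y))"
    using N(1)[of x] eq by (simp add: comb_delta)
  then have Nx: "(of_int (N x t) :: complex) = of_bool (t = y)" for t
    unfolding comb_eq_iff[OF rd[OF u]] by (rule fun_cong)
  have "N x t = of_bool (t = y)" for t using Nx[of t] by (cases "t = y") simp_all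
  then have "rdp v x = (\<Sum>t\<in>UNIV. if t = y then rdp u t else 0)"
    unfolding N(2) by (intro sum.cong) auto
  then have p: "rdp v x = rdp u y" by simp
  have row: "cartan v x z = c * rdb v z a" for z
    by (simp add: cartan_def c rdb_linear[OF rd[OF v]])
  have ua: "rdb u t a = cartan u y t" for t by (simp add: cartan_def a_def)
  have xx: "cartan v x x = c * cartan u y y" by (simp add: row eq ua)
  show ?thesis
  proof (cases "cartan u y y = 0")
    case True
    then show ?thesis using r xx p by (simp add: reflectable_def)
  next
    case aniso: False
    have k: "\<exists>m. 2 * (cartan v x z / cartan v x x) = - of_nat m" if z: "z \<noteq> x" for z
    proof -
      define k where "k = 2 * rdb v z a / cartan u y y"
      have "(\<lambda>h. rdb v z h - k * rdb v x h) \<in> roots"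
        using reflected_root[OF u r aniso v, of z] by (simp add: k_def eq a_def)
      also have "(\<lambda>h. rdb v z h - k * rdb v x h) =
          comb v (\<lambda>t. of_bool (t = z) + (if t = x then - k else 0))"
        by (simp add: fun_eq_iff comb_add[symmetric] comb_delta comb_unit)
      finally have root: "comb v (\<lambda>t. of_bool (t = z) + (if t = x then - k else 0)) \<in> roots" .
      have "comb v (\<lambda>t. of_bool (t = z) + (if t = x then - k else 0)) \<in> Qpos v"
        by (rule pos_of_positive_coefficient[OF root v, of z]) (use z in simp)
      then have "\<exists>n. \<forall>t. of_bool (t = z) + (if t = x then - k else 0) = (of_nat (n t) :: complex)"
        unfolding comb_in_Qpos[OF v] .
      then obtain n where
        "\<forall>t. of_bool (t = z) + (if t = x then - k else 0) = (of_nat (n t) :: complex)" ..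
      from spec[OF this, of x] have "k = - of_nat (n x)" using z by (simp add: minus_equation_iff[of k] eq_commute[of k])
      moreover have "2 * (cartan v x z / cartan v x x) = k" using c by (simp add: k_def row[of z] xx)
      ultimately show ?thesis by metis
    qed
    \<comment> \<open>For an odd root half of \<open>k\<close> must be an integer too. Evaluation at
      \<open>a\<close> divided by \<open>cartan u y y\<close> is integral on the simple roots of
      \<open>u\<close>, hence on the whole lattice.\<close>
    have int: "cartan v x z / cartan v x x \<in> \<int>" if p1: "rdp u y = 1" for z
    proof -
      have "rdb u t a / cartan u y y \<in> \<int>" for t
      proof (cases "t = y")
        case False
        then have "cartan u y t / cartan u y y \<in> nonpos_Ints"
          using r aniso p1 by (simp add: reflectable_def)
        then show ?thesis using nonpos_Ints_Int by (simp add: ua)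
      qed (use aniso ua in simp)
      then have "(\<Sum>t\<in>UNIV. of_int (N z t) * (rdb u t a / cartan u y y)) \<in> \<int>"
        by (intro Ints_sum Ints_mult Ints_of_int)
      also have "(\<Sum>t\<in>UNIV. of_int (N z t) * (rdb u t a / cartan u y y)) = rdb v z a / cartan u y y"
        by (simp add: N(1) comb_def sum_divide_distrib)
      finally show ?thesis using c by (simp add: row[of z] xx)
    qed
    have half: "cartan v x z / cartan v x x \<in> nonpos_Ints" if p1: "rdp u y = 1" and z: "z \<noteq> x" for z
    proof -
      obtain j where j: "cartan v x z / cartan v x x = of_int j" using int[OF p1] by (auto elim: Ints_cases)
      obtain m where "2 * (of_int j :: complex) = - of_nat m" using k[OF z] j by auto
      then have "(of_int (2 * j) :: complex) = of_int (- int m)" by simp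
      then have "2 * j = - int m" by (simp only: of_int_eq_iff)
      then have "j \<le> 0" by simp
      then show ?thesis unfolding j by (auto simp: nonpos_Ints_def)
    qed
    have "2 * cartan v x z / cartan v x x \<in> nonpos_Ints" if z: "z \<noteq> x" for z
    proof -
      obtain m where m: "2 * (cartan v x z / cartan v x x) = - of_nat m" using k[OF z] by blast
      have "- of_nat m \<in> (nonpos_Ints :: complex set)" by simp
      then show ?thesis using m by (metis times_divide_eq_right)
    qed
    then show ?thesis using half xx c aniso p by (simp add: reflectable_def)
  qed
qed

text \<open>
  A chain of reflexions from \<open>v\<close> to \<open>t\<close> has to cross the wall of a root that changes sign, and
  reflectability depends only on the wall.
\<close>

lemma reflectable_of_negative:
  assumes v: "v \<in> S" and t: "t \<in> S" and neg: "rdb v x \<notin> pos t"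
  shows "reflectable v x"
proof -
  from conn[OF v t] have "rdb v x \<in> pos t \<or> (\<exists>u\<in>S. \<exists>y. reflectable u y \<and> rdb v x = rdb u y)"
    and "t \<in> S"
  proof induction
    case base
    show "rdb v x \<in> pos v \<or> (\<exists>u\<in>S. \<exists>y. reflectable u y \<and> rdb v x = rdb u y)" "v \<in> S"
      using simple_pos[OF v] v by auto
  next
    case (step u w)
    then obtain y where y: "w = reflexion y u" "reflectable u y" by (auto simp: reflexion_step_def)
    show "w \<in> S" using closed step y by blast
    show "rdb v x \<in> pos w \<or> (\<exists>u\<in>S. \<exists>y. reflectable u y \<and> rdb v x = rdb u y)"
      using step.IH pos_reflexion[of u y] y by auto
  qed
  then show ?thesis using neg reflectable_transfer[OF _ v] by metis
qed

end

section \<open>Rank two residues and distance\<close>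

text \<open>
  For \<open>u\<close> reached from \<open>v\<close> by reflexions with labels in \<open>K\<close>.  The function \<open>s\<close> symmetrizes the Cartan matrix on
  \<open>K\<close>; since \<open>b(z) \<mapsto> s(z) a(z)\<close> extends to one linear map for all such \<open>u\<close>, the \<open>a(z)\<close> are determined by the \<open>b(z)\<close>.
\<close>

definition residue ::
  "'x set \<Rightarrow> ('x \<Rightarrow> complex) \<Rightarrow> ('h::fd_complex_vector, 'x::finite) root_datum \<Rightarrow>
   ('h, 'x) root_datum \<Rightarrow> bool" where
  "residue K s v u \<longleftrightarrow>
     (\<forall>z. \<exists>c. rdb u z = comb v c \<and> (\<forall>w. w \<notin> K \<longrightarrow> c w = of_bool (w = z)) \<and>
        (z \<in> K \<longrightarrow> s z *\<^sub>C rda u z = acomb v (\<lambda>w. c w * s w))) \<and>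
     (\<forall>z. \<exists>d. rda u z = acomb v d \<and> (\<forall>w. w \<notin> K \<longrightarrow> d w = of_bool (w = z))) \<and>
     (\<forall>p\<in>K. \<forall>q\<in>K. s p * cartan u p q = s q * cartan u q p)"

lemma residueE:
  assumes "residue K s v u"
  obtains C D where "\<And>z. rdb u z = comb v (C z)" "\<And>z w. w \<notin> K \<Longrightarrow> C z w = of_bool (w = z)"
    "\<And>z. z \<in> K \<Longrightarrow> s z *\<^sub>C rda u z = acomb v (\<lambda>w. C z w * s w)"
    "\<And>z. rda u z = acomb v (D z)" "\<And>z w. w \<notin> K \<Longrightarrow> D z w = of_bool (w = z)"
proof -
  have "\<forall>z. \<exists>c. rdb u z = comb v c \<and> (\<forall>w. w \<notin> K \<longrightarrow> c w = of_bool (w = z)) \<and>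
      (z \<in> K \<longrightarrow> s z *\<^sub>C rda u z = acomb v (\<lambda>w. c w * s w))"
    and "\<forall>z. \<exists>d. rda u z = acomb v d \<and> (\<forall>w. w \<notin> K \<longrightarrow> d w = of_bool (w = z))"
    using assms unfolding residue_def by simp_all
  from choice[OF this(1)] choice[OF this(2)] obtain C D where
    "\<forall>z. rdb u z = comb v (C z) \<and> (\<forall>w. w \<notin> K \<longrightarrow> C z w = of_bool (w = z)) \<and>
      (z \<in> K \<longrightarrow> s z *\<^sub>C rda u z = acomb v (\<lambda>w. C z w * s w))"
    "\<forall>z. rda u z = acomb v (D z) \<and> (\<forall>w. w \<notin> K \<longrightarrow> D z w = of_bool (w = z))"
    by blast
  then show thesis by (intro that[of C D]) auto
qed

lemma residue_combE:
  assumes "residue K s v u"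
  obtains C where "\<And>z. rdb u z = comb v (C z)" "\<And>z w. w \<notin> K \<Longrightarrow> C z w = of_bool (w = z)"
proof (rule residueE[OF assms])
  fix C D
  assume *: "\<And>z. rdb u z = comb v (C z)" "\<And>z w. w \<notin> K \<Longrightarrow> C z w = of_bool (w = z)"
  show thesis by (rule that[OF *])
qed

lemma residue_refl:
  assumes "\<forall>p\<in>K. \<forall>q\<in>K. s p * cartan v p q = s q * cartan v q p"
  shows "residue K s v v"
proof -
  have "s z *\<^sub>C rda v z = acomb v (\<lambda>w. of_bool (w = z) * s w)" for z
  proof -
    have "(\<lambda>w. of_bool (w = z) * s w) = (\<lambda>w. if w = z then s z else 0)" by auto
    then show ?thesis by (simp add: acomb_unit)
  qed
  then show ?thesis
    unfolding residue_def using assms comb_delta[of v, symmetric] acomb_delta[of v, symmetric] by blast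
qed

lemma residue_reflexion:
  assumes res: "residue K s v u" and u: "is_root_datum u" and p: "p \<in> K"
  shows "residue K s v (reflexion p u)"
proof -
  obtain C D where C: "\<And>z. rdb u z = comb v (C z)" "\<And>z w. w \<notin> K \<Longrightarrow> C z w = of_bool (w = z)"
      "\<And>z. z \<in> K \<Longrightarrow> s z *\<^sub>C rda u z = acomb v (\<lambda>w. C z w * s w)"
    and D: "\<And>z. rda u z = acomb v (D z)" "\<And>z w. w \<notin> K \<Longrightarrow> D z w = of_bool (w = z)"
    by (rule residueE[OF res]) (rule that)
  have sym: "s q * cartan u q r = s r * cartan u r q" if "q \<in> K" "r \<in> K" for q r
    using res that unfolding residue_def by blast
  \<comment> \<open>Symmetry of the Cartan matrix in terms of the coefficients: it makes
    \<open>s z\<close> times the coroot transform with the same coefficients as the root.\<close>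
  have key: "s q * refl_a u p q = refl_b u p q * s p" if q: "q \<in> K" for q
    using sym[OF p q] by (auto simp: refl_a_def refl_b_def field_simps)
  have 1: "\<exists>c. rdb (reflexion p u) z = comb v c \<and> (\<forall>w. w \<notin> K \<longrightarrow> c w = of_bool (w = z)) \<and>
      (z \<in> K \<longrightarrow> s z *\<^sub>C rda (reflexion p u) z = acomb v (\<lambda>w. c w * s w))" for z
  proof (intro exI[of _ "\<lambda>w. C z w + refl_b u p z * C p w"] conjI allI impI)
    show "rdb (reflexion p u) z = comb v (\<lambda>w. C z w + refl_b u p z * C p w)"
      by (simp add: rdb_reflexion C(1) fun_eq_iff comb_add[symmetric] comb_scale[symmetric])
    show "C z w + refl_b u p z * C p w = of_bool (w = z)" if "w \<notin> K" for w
      using C(2)[OF that] p that by auto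
    assume z: "z \<in> K"
    have "s z *\<^sub>C rda (reflexion p u) z = s z *\<^sub>C rda u z + (s z * refl_a u p z) *\<^sub>C rda u p"
      by (simp add: rda_reflexion scaleC_add_right)
    also have "(s z * refl_a u p z) *\<^sub>C rda u p = refl_b u p z *\<^sub>C (s p *\<^sub>C rda u p)"
      by (simp add: key[OF z])
    finally show "s z *\<^sub>C rda (reflexion p u) z =
        acomb v (\<lambda>w. (C z w + refl_b u p z * C p w) * s w)"
      by (simp add: C(3)[OF z] C(3)[OF p] acomb_scale acomb_add algebra_simps)
  qed
  have 2: "\<exists>d. rda (reflexion p u) z = acomb v d \<and> (\<forall>w. w \<notin> K \<longrightarrow> d w = of_bool (w = z))" for z
  proof (intro exI[of _ "\<lambda>w. D z w + refl_a u p z * D p w"] conjI allI impI)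
    show "rda (reflexion p u) z = acomb v (\<lambda>w. D z w + refl_a u p z * D p w)"
      by (simp add: rda_reflexion D(1) acomb_scale acomb_add)
    show "D z w + refl_a u p z * D p w = of_bool (w = z)" if "w \<notin> K" for w
      using D(2)[OF that] p that by auto
  qed
  have 3: "s q * cartan (reflexion p u) q r = s r * cartan (reflexion p u) r q"
    if q: "q \<in> K" and r: "r \<in> K" for q r
  proof -
    have "s q * cartan (reflexion p u) q r = s q * cartan u q r + refl_b u p r * (s q * cartan u q p) +
        (s q * refl_a u p q) * (cartan u p r + refl_b u p r * cartan u p p)"
      by (simp add: cartan_reflexion[OF u] algebra_simps)
    also have "\<dots> = s q * cartan u q r + refl_b u p r * (s p * cartan u p q) +
        refl_b u p q * (s p * cartan u p r) + refl_b u p q * refl_b u p r * (s p * cartan u p p)"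
      by (simp add: key[OF q] sym[OF q p] algebra_simps)
    also have "\<dots> = s r * cartan u r q + refl_b u p q * (s r * cartan u r p) +
        (s r * refl_a u p r) * (cartan u p q + refl_b u p q * cartan u p p)"
      by (simp add: key[OF r] sym[OF q r] sym[OF r p] algebra_simps)
    also have "\<dots> = s r * cartan (reflexion p u) r q"
      by (simp add: cartan_reflexion[OF u] algebra_simps)
    finally show ?thesis .
  qed
  show ?thesis unfolding residue_def using 1 2 3 by blast
qed

primrec alternating :: "'x \<Rightarrow> 'x \<Rightarrow> ('h::fd_complex_vector, 'x) root_datum \<Rightarrow> nat \<Rightarrow> ('h, 'x) root_datum"
where
  "alternating x y v 0 = v"
| "alternating x y v (Suc k) = reflexion (if even k then x else y) (alternating x y v k)"

context skeleton
begin

lemma Qneg_comb: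
  fixes v :: "('h, 'x) root_datum"
  assumes w: "w \<in> S" and neg: "\<And>q. n q \<noteq> 0 \<Longrightarrow> rdb v q \<in> Qneg w"
  shows "comb v (\<lambda>q. of_nat (n q)) \<in> Qneg w"
proof -
  have "\<forall>q. \<exists>m :: 'x \<Rightarrow> nat. n q \<noteq> 0 \<longrightarrow> rdb v q = comb w (\<lambda>z. - of_nat (m z))"
    using neg by (auto simp: Qneg_def)
  then obtain m :: "'x \<Rightarrow> 'x \<Rightarrow> nat" where
    m: "\<And>q. n q \<noteq> 0 \<Longrightarrow> rdb v q = comb w (\<lambda>z. - of_nat (m q z))" by metis
  have "comb v (\<lambda>q. of_nat (n q)) h = comb w (\<lambda>z. - of_nat (\<Sum>q\<in>UNIV. n q * m q z)) h" for h
  proof -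
    have "comb v (\<lambda>q. of_nat (n q)) h =
        (\<Sum>q\<in>UNIV. of_nat (n q) * comb w (\<lambda>z. - of_nat (m q z)) h)"
      unfolding comb_def[of v]
    proof (rule sum.cong)
      show "of_nat (n q) * rdb v q h = of_nat (n q) * comb w (\<lambda>z. - of_nat (m q z)) h" for q
        by (cases "n q = 0") (simp_all add: m)
    qed simp
    also have "\<dots> = (\<Sum>q\<in>UNIV. \<Sum>z\<in>UNIV. - (of_nat (n q) * of_nat (m q z)) * rdb w z h)"
      by (simp add: comb_def sum_distrib_left mult.assoc)
    also have "\<dots> = (\<Sum>z\<in>UNIV. \<Sum>q\<in>UNIV. - (of_nat (n q) * of_nat (m q z)) * rdb w z h)"
      by (rule sum.swap)
    also have "\<dots> = comb w (\<lambda>z. - of_nat (\<Sum>q\<in>UNIV. n q * m q z)) h"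
      by (simp add: comb_def sum_distrib_right sum_negf)
    finally show ?thesis .
  qed
  then have "comb v (\<lambda>q. of_nat (n q)) = comb w (\<lambda>z. - of_nat (\<Sum>q\<in>UNIV. n q * m q z))"
    by (rule ext)
  then show ?thesis unfolding Qneg_def by (intro CollectI exI)
qed

section \<open>Separating roots and walks toward a fixed object\<close>

lemma finite_pos_diff:
  assumes "u \<in> S" "t \<in> S"
  shows "finite (pos u - pos t)"
proof -
  from conn[OF assms] have "finite (pos u - pos t) \<and> t \<in> S"
  proof induction
    case (step w w')
    then obtain x where x: "w' = reflexion x w" "reflectable w x" by (auto simp: reflexion_step_def)
    have "pos u - pos w' \<subseteq> insert (rdb w x) (pos u - pos w)"
      using step.IH x pos_reflexion[of w x] by auto
    then show ?case using step.IH closed x by (meson finite_insert finite_subset)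
  qed (use assms in simp)
  then show ?thesis by simp
qed

text \<open>The lower bound for the distance: a reflexion makes only one positive root
  negative.\<close>

lemma card_pos_diff_le:
  assumes "(v, w) \<in> reflexion_step ^^ n" "v \<in> S"
  shows "card (pos v - pos w) \<le> n \<and> w \<in> S"
  using assms(1)
proof (induction n arbitrary: w)
  case (Suc n)
  then obtain u x where u: "(v, u) \<in> reflexion_step ^^ n" "w = reflexion x u" "reflectable u x"
    by (auto simp: reflexion_step_def)
  then have IH: "card (pos v - pos u) \<le> n" "u \<in> S" using Suc.IH by auto
  have "pos v - pos w \<subseteq> insert (rdb u x) (pos v - pos u)"
    using pos_reflexion[of u x] u IH by auto
  then have "card (pos v - pos w) \<le> card (insert (rdb u x) (pos v - pos u))"
    by (intro card_mono) (simp_all add: finite_pos_diff assms(2) IH)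
  also have "\<dots> \<le> Suc (card (pos v - pos u))" by (rule card_insert_le_m1) simp_all
  finally show ?case using IH u closed by auto
qed (use assms in simp)

definition "toward t = {(u, reflexion x u) | u x. u \<in> S \<and> reflectable u x \<and> rdb u x \<notin> pos t}"

lemma toward_step: "toward t \<subseteq> reflexion_step"
  by (auto simp: toward_def reflexion_step_def)

lemma toward_S: "(u, w) \<in> toward t \<Longrightarrow> u \<in> S \<and> w \<in> S"
  using closed by (auto simp: toward_def)

lemma toward_rtrancl_S: "(u, w) \<in> (toward t)\<^sup>* \<Longrightarrow> u \<in> S \<Longrightarrow> w \<in> S"
  by (induction rule: rtrancl_induct) (auto dest: toward_S)

lemma toward_card:
  assumes "(u, w) \<in> toward t" "t \<in> S"
  shows "card (pos u - pos t) = Suc (card (pos w - pos t))"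
proof -
  obtain x where x: "w = reflexion x u" "u \<in> S" "reflectable u x" "rdb u x \<notin> pos t"
    using assms by (auto simp: toward_def)
  have "pos w - pos t = (pos u - pos t) - {rdb u x}"
    using neg_pos_iff[OF x(2,3) assms(2)] x(4) unfolding x(1) pos_reflexion[OF x(2,3)] by auto
  moreover have "rdb u x \<in> pos u - pos t" using simple_pos x by simp
  ultimately show ?thesis using finite_pos_diff[OF x(2) assms(2)] by (metis card_Suc_Diff1)
qed

lemma toward_relpow_card:
  assumes "(u, w) \<in> toward t ^^ n" "t \<in> S"
  shows "card (pos u - pos t) = n + card (pos w - pos t)"
  using assms(1)
proof (induction n arbitrary: w)
  case (Suc n)
  then obtain w' where w': "(u, w') \<in> toward t ^^ n" "(w', w) \<in> toward t" by auto
  show ?case using Suc.IH[OF w'(1)] toward_card[OF w'(2) assms(2)] by simp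
qed simp

text \<open>On \<open>K\<close>, expanding the simple roots of \<open>u\<close> over those of
  \<open>v\<close>, and conversely, gives up to sign two mutually inverse matrices of natural
  numbers. Such matrices are permutation matrices.\<close>

lemma residue_opposite:
  assumes v: "v \<in> S" and u: "u \<in> S" and res: "residue K s v u"
    and neg: "\<And>p. p \<in> K \<Longrightarrow> rdb u p \<in> Qneg v" and q: "q \<in> K"
  shows "\<exists>z\<in>K. rdb u z = (\<lambda>h. - rdb v q h)"
proof -
  obtain C where C: "\<And>z. rdb u z = comb v (C z)" "\<And>z w. w \<notin> K \<Longrightarrow> C z w = of_bool (w = z)"
    using residue_combE[OF res] by blast
  have "\<exists>n :: 'x \<Rightarrow> nat. \<forall>w. C p w = - of_nat (n w)" if "p \<in> K" for p
    using neg[OF that] unfolding C(1) comb_in_Qneg[OF v] .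
  then have "\<forall>p. \<exists>n :: 'x \<Rightarrow> nat. p \<in> K \<longrightarrow> (\<forall>w. C p w = - of_nat (n w))" by blast
  from choice[OF this] obtain n :: "'x \<Rightarrow> 'x \<Rightarrow> nat" where
    n: "\<And>p w. p \<in> K \<Longrightarrow> C p w = - of_nat (n p w)" by blast
  have coeff: "of_bool (w = q) = (\<Sum>z\<in>UNIV. c z * C z w)" if "rdb v q = comb u c" for c w
  proof -
    have "comb v (\<lambda>w. of_bool (w = q)) = comb v (\<lambda>w. \<Sum>z\<in>UNIV. c z * C z w)"
      using that by (simp add: comb_delta comb_comb[of u v C, OF C(1)])
    then show ?thesis unfolding comb_eq_iff[OF rd[OF v]] by (rule fun_cong)
  qed
  \<comment> \<open>Outside \<open>K\<close> the coordinates over \<open>v\<close> and over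
    \<open>u\<close> agree, so \<open>b(q)\<close> expands over the labels in \<open>K\<close>
    alone.\<close>
  have off: "c w = 0" if c: "rdb v q = comb u c" and w: "w \<notin> K" for c w
  proof -
    have "of_bool (w = q) = (\<Sum>z\<in>UNIV. if z = w then c w else 0)"
      unfolding coeff[OF c] by (rule sum.cong) (auto simp: C(2)[OF w])
    moreover have "w \<noteq> q" using w q by blast
    ultimately show ?thesis by simp
  qed
  have coeff': "of_bool (w = q) = (\<Sum>z\<in>UNIV. - c z * of_nat (n z w))" if c: "rdb v q = comb u c" for c w
    unfolding coeff[OF c]
  proof (rule sum.cong)
    show "c z * C z w = - c z * of_nat (n z w)" for z
      using off[OF c, of z] n[of z w] by (cases "z \<in> K") auto
  qed simp
  consider m :: "'x \<Rightarrow> nat" where "rdb v q = comb u (\<lambda>z. of_nat (m z))"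
    | m :: "'x \<Rightarrow> nat" where "rdb v q = comb u (\<lambda>z. - of_nat (m z))"
    using sign[OF v u, of q] by (auto simp: Qpos_def Qneg_def)
  then show ?thesis
  proof cases
    case (1 m)
    have "(of_nat 1 :: complex) = - of_nat (\<Sum>z\<in>UNIV. m z * n z q)"
      using coeff'[OF 1, of q] by (simp add: sum_negf)
    then show ?thesis unfolding of_nat_eq_minus_of_nat by simp
  next
    case (2 m)
    have sum: "(\<Sum>z\<in>UNIV. m z * n z w) = of_bool (w = q)" for w
    proof -
      have "(of_nat (\<Sum>z\<in>UNIV. m z * n z w) :: complex) = of_nat (of_bool (w = q))"
        using coeff'[OF 2, of w] by simp
      then show ?thesis by (simp only: of_nat_eq_iff)
    qed
    then obtain z where z: "m z * n z q \<noteq> 0"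
      by (metis (mono_tags, lifting) of_bool_eq(2) sum.neutral zero_neq_one)
    have le: "m z * n z w \<le> of_bool (w = q)" for w
      unfolding sum[symmetric] by (rule member_le_sum) simp_all
    have zK: "z \<in> K" using z off[OF 2, of z] by auto
    have "n z q \<le> m z * n z q" using z by simp
    also have "\<dots> \<le> 1" using le[of q] by simp
    finally have "n z w = of_bool (w = q)" for w
      using le[of w] z by (cases "w = q") (simp_all add: le_Suc_eq)
    then have "rdb u z = (\<lambda>h. - comb v (\<lambda>w. of_bool (w = q)) h)"
      unfolding C(1) comb_uminus using n[OF zK] by (auto intro!: arg_cong[of _ _ "comb v"])
    then show ?thesis using zK by (auto simp: comb_delta)
  qed
qed

text \<open>A coordinate outside \<open>K\<close> is the same over \<open>v\<close> and
  \<open>u\<close>; for a root that changes sign it is both nonnegative and nonpositive, so it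
  vanishes. Conversely a positive combination over \<open>K\<close> is a combination of roots
  negative at \<open>u\<close>. The right-hand side does not involve \<open>u\<close>, which later
  makes the lengths of both alternations equal.\<close>

lemma residue_pos_diff:
  assumes v: "v \<in> S" and u: "u \<in> S" and res: "residue K s v u"
    and opp: "\<And>q. q \<in> K \<Longrightarrow> \<exists>z\<in>K. rdb u z = (\<lambda>h. - rdb v q h)"
  shows "pos v - pos u = pos v \<inter> {comb v c | c. \<forall>w. w \<notin> K \<longrightarrow> c w = 0}"
proof (intro equalityI subsetI)
  obtain C where C: "\<And>z. rdb u z = comb v (C z)" "\<And>z w. w \<notin> K \<Longrightarrow> C z w = of_bool (w = z)"
    using residue_combE[OF res] by blast
  fix \<beta> assume \<beta>: "\<beta> \<in> pos v - pos u"
  then obtain n :: "'x \<Rightarrow> nat" where n: "\<beta> = comb v (\<lambda>w. of_nat (n w))"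
    by (auto simp: pos_def Qpos_def)
  have "\<beta> \<in> Qneg u" using not_pos_iff[OF _ u] \<beta> by (auto simp: pos_def)
  then obtain m :: "'x \<Rightarrow> nat" where m: "\<beta> = comb u (\<lambda>z. - of_nat (m z))"
    by (auto simp: Qneg_def)
  have "comb v (\<lambda>w. of_nat (n w)) = comb v (\<lambda>w. \<Sum>z\<in>UNIV. - of_nat (m z) * C z w)"
    using n m by (simp add: comb_comb[of u v C, OF C(1)])
  then have eq: "of_nat (n w) = (\<Sum>z\<in>UNIV. - of_nat (m z) * C z w)" for w
    unfolding comb_eq_iff[OF rd[OF v]] by (rule fun_cong)
  have "n w = 0" if w: "w \<notin> K" for w
  proof -
    have "of_nat (n w) = (\<Sum>z\<in>UNIV. if z = w then - of_nat (m w) else (0::complex))"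
      unfolding eq by (rule sum.cong) (auto simp: C(2)[OF w])
    then show ?thesis using of_nat_eq_minus_of_nat[of "n w" "m w"] by simp
  qed
  then show "\<beta> \<in> pos v \<inter> {comb v c | c. \<forall>w. w \<notin> K \<longrightarrow> c w = 0}" using \<beta> n by auto
next
  fix \<beta> assume "\<beta> \<in> pos v \<inter> {comb v c | c. \<forall>w. w \<notin> K \<longrightarrow> c w = 0}"
  then obtain c where \<beta>: "\<beta> = comb v c" "\<And>w. w \<notin> K \<Longrightarrow> c w = 0" "\<beta> \<in> pos v" by auto
  then have "\<exists>n. \<forall>z. c z = of_nat (n z)" using comb_in_Qpos[OF v] by (simp add: pos_def)
  then obtain n where n: "c = (\<lambda>z. of_nat (n z))" by auto
  have "rdb v q \<in> Qneg u" if "n q \<noteq> 0" for q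
  proof -
    have "q \<in> K" using \<beta>(2)[of q] that n by auto
    then obtain z where "rdb u z = (\<lambda>h. - rdb v q h)" using opp by blast
    then have "(\<lambda>h. - rdb u z h) = rdb v q" by simp
    moreover have "(\<lambda>h. - rdb u z h) \<in> Qneg u"
      unfolding uminus_Qneg using simple_pos[OF u] by (auto simp: pos_def)
    ultimately show ?thesis by simp
  qed
  then have "\<beta> \<in> Qneg u" unfolding \<beta>(1) n by (rule Qneg_comb[OF u])
  then show "\<beta> \<in> pos v - pos u" using \<beta>(3) not_pos_iff[OF _ u] by (auto simp: pos_def)
qed

text \<open>Outside \<open>K\<close> the two versions of a simple root differ by a combination over
  \<open>K\<close>, whose coefficients are nonnegative seen from one object and nonpositive seen
  from the other. Once all simple roots agree, so do the parities, by the lattice homomorphism, and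
  the coroots on \<open>K\<close>, by the symmetrizer.\<close>

lemma residue_unique:
  assumes v: "v \<in> S" and u: "u \<in> S" and w: "w \<in> S"
    and ru: "residue K s v u" and rw: "residue K s v w" and s: "\<And>p. p \<in> K \<Longrightarrow> s p \<noteq> 0"
    and eqK: "\<And>p. p \<in> K \<Longrightarrow> rdb u p = rdb w p"
  shows "u = w"
proof -
  obtain C D where C: "\<And>z. rdb u z = comb v (C z)" "\<And>z t. t \<notin> K \<Longrightarrow> C z t = of_bool (t = z)"
      "\<And>z. z \<in> K \<Longrightarrow> s z *\<^sub>C rda u z = acomb v (\<lambda>t. C z t * s t)"
    and D: "\<And>z. rda u z = acomb v (D z)" "\<And>z t. t \<notin> K \<Longrightarrow> D z t = of_bool (t = z)"
    by (rule residueE[OF ru]) (rule that)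
  obtain C' D' where C': "\<And>z. rdb w z = comb v (C' z)" "\<And>z t. t \<notin> K \<Longrightarrow> C' z t = of_bool (t = z)"
      "\<And>z. z \<in> K \<Longrightarrow> s z *\<^sub>C rda w z = acomb v (\<lambda>t. C' z t * s t)"
    and D': "\<And>z. rda w z = acomb v (D' z)" "\<And>z t. t \<notin> K \<Longrightarrow> D' z t = of_bool (t = z)"
    by (rule residueE[OF rw]) (rule that)
  obtain N :: "'x \<Rightarrow> 'x \<Rightarrow> int" where N: "\<And>z. rdb w z = comb u (\<lambda>t. of_int (N z t))"
    "\<And>z. rdp w z = (\<Sum>t\<in>UNIV. of_int (N z t) * rdp u t)"
    using int_trans_S[OF u w] unfolding int_trans_def by blast
  have b: "rdb u z = rdb w z" for z
  proof (cases "z \<in> K")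
    case z: False
    define f where "f t = (of_int (N z t) :: complex)" for t
    have "comb v (C' z) = comb v (\<lambda>t. \<Sum>y\<in>UNIV. f y * C y t)"
      using N(1)[of z] C'(1)[of z] by (simp add: f_def comb_comb[of u v C, OF C(1)])
    then have exp: "C' z t = (\<Sum>y\<in>UNIV. f y * C y t)" for t
      unfolding comb_eq_iff[OF rd[OF v]] by (rule fun_cong)
    have off: "f t = of_bool (t = z)" if t: "t \<notin> K" for t
    proof -
      have "C' z t = (\<Sum>y\<in>UNIV. if y = t then f t else 0)"
        unfolding exp by (rule sum.cong) (auto simp: C(2)[OF t])
      then show ?thesis using C'(2)[OF t, of z] by simp
    qed
    have wz: "rdb w z = comb u f" by (simp add: N(1) f_def[abs_def])
    then have "comb u f \<in> Qpos u"
      using pos_of_positive_coefficient[OF _ u, of f z] off[OF z] rootI[OF w, of z] by simp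
    then obtain n where n: "\<And>t. f t = of_nat (n t)" using comb_in_Qpos[OF u] by blast
    \<comment> \<open>Coordinates of \<open>b(z)\<close> at \<open>u\<close> over the simple roots
      of \<open>w\<close>: these agree with those of \<open>u\<close> on \<open>K\<close>, so the
      part over \<open>K\<close> just moves to the other side with opposite sign.\<close>
    define g where "g t = of_bool (t = z) - (if t \<in> K then f t else 0)" for t
    have sumK: "(\<Sum>t\<in>UNIV. (if t \<in> K then f t else 0) * rdb w t h) =
        (\<Sum>t\<in>UNIV. (if t \<in> K then f t else 0) * rdb u t h)" for h
      by (rule sum.cong) (auto simp: eqK)
    have "comb w g h = rdb u z h" for h
    proof -
      have "comb w g h = comb w (\<lambda>t. of_bool (t = z)) h -
          (\<Sum>t\<in>UNIV. (if t \<in> K then f t else 0) * rdb w t h)"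
        unfolding comb_def g_def by (simp only: left_diff_distrib sum_subtractf)
      also have "\<dots> = comb u f h - (\<Sum>t\<in>UNIV. (if t \<in> K then f t else 0) * rdb u t h)"
        by (simp only: comb_delta wz sumK)
      also have "\<dots> = comb u (\<lambda>t. f t - (if t \<in> K then f t else 0)) h"
        unfolding comb_def by (simp only: left_diff_distrib sum_subtractf)
      also have "(\<lambda>t. f t - (if t \<in> K then f t else 0)) = (\<lambda>t. of_bool (t = z))"
        using off z by (auto simp: fun_eq_iff)
      finally show ?thesis by (simp only: comb_delta)
    qed
    then have uz: "comb w g = rdb u z" by (rule ext)
    then have "comb w g \<in> Qpos w"
      using pos_of_positive_coefficient[OF _ w, of g z] rootI[OF u, of z] z by (simp add: g_def)
    then obtain m where m: "\<And>t. g t = of_nat (m t)" using comb_in_Qpos[OF w] by blast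
    have "f t = of_bool (t = z)" for t
    proof (cases "t \<in> K")
      case True
      then have "t \<noteq> z" using z by blast
      then have "(of_nat (m t) :: complex) = - of_nat (n t)"
        using m[of t, symmetric] n[of t] True by (simp add: g_def)
      then have "n t = 0" unfolding of_nat_eq_minus_of_nat by simp
      then show ?thesis using n[of t] True z by auto
    qed (rule off)
    then have "f = (\<lambda>t. of_bool (t = z))" by (rule ext)
    then show ?thesis by (simp only: wz comb_delta)
  qed (rule eqK)
  have N_id: "N z t = of_bool (t = z)" for z t
  proof -
    have "comb u (\<lambda>t. of_int (N z t)) = comb u (\<lambda>t. of_bool (t = z))"
      using N(1)[of z] b[of z] by (simp add: comb_delta)
    then have "(of_int (N z t) :: complex) = of_bool (t = z)"
      unfolding comb_eq_iff[OF rd[OF u]] by (rule fun_cong)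
    then show ?thesis by (cases "t = z") simp_all
  qed
  have p: "rdp u z = rdp w z" for z
  proof -
    have "rdp w z = (\<Sum>t\<in>UNIV. if t = z then rdp u t else 0)"
      unfolding N(2) by (rule sum.cong) (auto simp: N_id)
    then show ?thesis by simp
  qed
  have a: "rda u z = rda w z" for z
  proof (cases "z \<in> K")
    case True
    have "C z = C' z" using b[of z] unfolding C(1) C'(1) comb_eq_iff[OF rd[OF v]] .
    then have "s z *\<^sub>C rda u z = s z *\<^sub>C rda w z" using C(3)[OF True] C'(3)[OF True] by simp
    then show ?thesis using s[OF True] by (simp only: scaleC.scale_cancel_left) simp
  next
    case False
    \<comment> \<open>Outside \<open>K\<close> coroots are known only up to a scalar; it is 1
      because both have coefficient 1 at \<open>z\<close> over \<open>v\<close>.\<close>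
    obtain c where c: "rda u z = c *\<^sub>C rda w z" using coroot[OF u w b] by blast
    then have "acomb v (D z) = acomb v (\<lambda>t. c * D' z t)" by (simp only: D(1) D'(1) acomb_scale)
    then have "D z z = c * D' z z" unfolding acomb_eq_iff[OF rd[OF v]] by (rule fun_cong)
    then have "c = 1" using D(2)[OF False, of z] D'(2)[OF False, of z] by simp
    then show ?thesis using c by simp
  qed
  show ?thesis by (rule root_datum.equality) (simp_all add: fun_eq_iff a b p)
qed

text \<open>The walk stops just before it would flip a root that is negative at \<open>v\<close>.
  Then both simple roots labelled \<open>x\<close> and \<open>y\<close> are negative at
  \<open>v\<close>, and the last root flipped must have been \<open>b(y)\<close>; the parity of the
  number of steps thus tells which label carries which root.\<close>

lemma alternating_path:
  assumes v: "v \<in> S" and t: "t \<in> S" and xy: "x \<noteq> y"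
    and neg: "rdb v x \<notin> pos t" "rdb v y \<notin> pos t"
    and s: "\<forall>p\<in>{x, y}. \<forall>q\<in>{x, y}. s p * cartan v p q = s q * cartan v q p"
  obtains M u where "card (pos v \<inter> {comb v c | c. \<forall>w. w \<notin> {x, y} \<longrightarrow> c w = 0}) = Suc M"
    "u \<in> S" "residue {x, y} s v u" "(reflexion x v, u) \<in> (toward t)\<^sup>*"
    "rdb u (if even M then x else y) = (\<lambda>h. - rdb v y h)"
    "rdb u (if even M then y else x) = (\<lambda>h. - rdb v x h)"
proof -
  define A where "A = alternating x y v"
  define lab where "lab k = (if even k then x else y)" for k :: nat
  define \<beta> where "\<beta> k = rdb (A k) (lab k)" for k
  define good where "good k \<longleftrightarrow> \<beta> k \<in> pos v" for k
  have A: "A 0 = v" "\<And>k. A (Suc k) = reflexion (lab k) (A k)"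
    by (simp_all add: A_def lab_def)
  have inv: "A k \<in> S \<and> residue {x, y} s v (A k) \<and> (v, A k) \<in> toward t ^^ k \<and>
      card (pos v - pos (A k)) = k \<and>
      (k \<noteq> 0 \<longrightarrow> rdb v x \<notin> pos (A k) \<and> (reflexion x v, A k) \<in> (toward t)\<^sup>*)"
    if "\<And>j. j < k \<Longrightarrow> good j" for k
    using that
  proof (induction k)
    case 0
    show ?case using v residue_refl[OF s] by (simp add: A)
  next
    case (Suc k)
    have IH: "A k \<in> S" "residue {x, y} s v (A k)" "(v, A k) \<in> toward t ^^ k"
      "card (pos v - pos (A k)) = k" "k \<noteq> 0 \<Longrightarrow> rdb v x \<notin> pos (A k)"
      "k \<noteq> 0 \<Longrightarrow> (reflexion x v, A k) \<in> (toward t)\<^sup>*"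
      using Suc by simp_all
    have good: "\<beta> k \<in> pos v" using Suc.prems[of k] by (simp add: good_def)
    have lab: "lab k \<in> {x, y}" by (simp add: lab_def)
    \<comment> \<open>This root is positive at \<open>v\<close> and supported on \<open>x\<close>
      and \<open>y\<close>, hence a nonnegative combination of two roots that are negative at
      \<open>t\<close>.\<close>
    have "\<beta> k \<notin> pos t"
    proof -
      obtain C where C: "\<And>z. rdb (A k) z = comb v (C z)" "\<And>z w. w \<notin> {x, y} \<Longrightarrow> C z w = of_bool (w = z)"
        using residue_combE[OF IH(2)] by blast
      have "comb v (C (lab k)) \<in> Qpos v" using good by (simp add: \<beta>_def C(1) pos_def)
      then obtain n where n: "\<And>z. C (lab k) z = of_nat (n z)" using comb_in_Qpos[OF v] by blast
      have "rdb v q \<in> Qneg t" if "n q \<noteq> 0" for q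
      proof -
        have "q \<in> {x, y}"
        proof (rule ccontr)
          assume q: "q \<notin> {x, y}"
          then have "q \<noteq> lab k" using lab by metis
          then show False using C(2)[OF q, of "lab k"] n[of q] that by simp
        qed
        then show ?thesis using neg not_pos_iff[OF rootI[OF v] t] by auto
      qed
      then have "comb v (\<lambda>q. of_nat (n q)) \<in> Qneg t" by (rule Qneg_comb[OF t])
      moreover have "\<beta> k = comb v (\<lambda>q. of_nat (n q))"
        unfolding \<beta>_def C(1) by (rule arg_cong[of _ _ "comb v"]) (simp add: fun_eq_iff n)
      ultimately have "\<beta> k \<in> Qneg t" by simp
      then show ?thesis using not_pos_iff[OF rootI[OF IH(1)] t] by (simp add: \<beta>_def)
    qed
    then have r: "reflectable (A k) (lab k)"
      using reflectable_of_negative[OF IH(1) t] by (simp add: \<beta>_def)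
    then have step: "(A k, A (Suc k)) \<in> toward t"
      using \<open>\<beta> k \<notin> pos t\<close> IH(1) by (auto simp: toward_def A \<beta>_def)
    have S: "A (Suc k) \<in> S" using toward_S[OF step] by simp
    have pos: "pos (A (Suc k)) = insert (\<lambda>h. - \<beta> k h) (pos (A k) - {\<beta> k})"
      using pos_reflexion[OF IH(1) r] by (simp add: A \<beta>_def)
    have nb: "(\<lambda>h. - \<beta> k h) \<notin> pos v" using neg_pos_iff[OF IH(1) r v] good by (simp add: \<beta>_def)
    have bA: "\<beta> k \<in> pos (A k)" using simple_pos[OF IH(1)] by (simp add: \<beta>_def)
    have "pos v - pos (A (Suc k)) = insert (\<beta> k) (pos v - pos (A k))"
      unfolding pos using nb good by auto
    then have card: "card (pos v - pos (A (Suc k))) = Suc k"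
      using bA IH(4) finite_pos_diff[OF v IH(1)] by simp
    have vx: "rdb v x \<notin> pos (A (Suc k))"
    proof (cases "k = 0")
      case True
      then have "\<beta> k = rdb v x" by (simp add: \<beta>_def A lab_def)
      then show ?thesis using nb simple_pos[OF v, of x] unfolding pos by auto
    next
      case False
      then show ?thesis using nb simple_pos[OF v, of x] IH(5) unfolding pos by auto
    qed
    have path: "(reflexion x v, A (Suc k)) \<in> (toward t)\<^sup>*"
    proof (cases "k = 0")
      case True
      then show ?thesis by (simp add: A lab_def)
    next
      case False
      show ?thesis using IH(6)[OF False] step by (rule rtrancl_into_rtrancl)
    qed
    have res: "residue {x, y} s v (A (Suc k))"
      unfolding A(2) by (rule residue_reflexion[OF IH(2) rd[OF IH(1)] lab])
    have "(v, A (Suc k)) \<in> toward t ^^ Suc k" using IH(3) step by (rule relpow_Suc_I)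
    then show ?case using S res card vx path by blast
  qed
  \<comment> \<open>Each good step removes a root separating the current object from
    \<open>t\<close>, so there cannot be more steps than such roots.\<close>
  have "\<exists>k. \<not> good k"
  proof (rule ccontr)
    assume "\<nexists>k. \<not> good k"
    then have "(v, A k) \<in> toward t ^^ k" for k using inv[of k] by blast
    from toward_relpow_card[OF this[of "Suc (card (pos v - pos t))"] t] show False by simp
  qed
  then obtain N where N: "\<not> good N" "\<And>j. j < N \<Longrightarrow> good j"
    using exists_least_iff[of "\<lambda>k. \<not> good k"] by blast
  have "good 0" using simple_pos[OF v] by (simp add: good_def \<beta>_def A)
  \<comment> \<open>The second root has coefficient 1 at \<open>y\<close>, so at least two steps are
    made. Hence \<open>b(x)\<close>, flipped by the first step, is not the last root
    flipped.\<close>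
  moreover have "good (Suc 0)" if "N = Suc 0"
  proof -
    have A1: "A (Suc 0) \<in> S" using inv[of "Suc 0"] N that by blast
    have "\<beta> (Suc 0) = comb v (\<lambda>z. of_bool (z = y) + (if z = x then refl_b v x y else 0))"
      by (simp add: \<beta>_def A lab_def rdb_reflexion_comb)
    moreover have "\<beta> (Suc 0) \<in> roots" using rootI[OF A1] by (simp add: \<beta>_def)
    ultimately show ?thesis
      using pos_of_positive_coefficient[OF _ v, of _ y] xy by (simp add: good_def pos_def)
  qed
  ultimately have "N \<noteq> 0" "N \<noteq> Suc 0" using N(1) by metis+
  then obtain M where M: "N = Suc M" "M \<noteq> 0" by (cases N) auto
  define u where "u = A N"
  have u: "u \<in> S" "residue {x, y} s v u" "card (pos v - pos u) = N"
    "(reflexion x v, u) \<in> (toward t)\<^sup>*"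
    using inv[of N] N(2) M by (auto simp: u_def)
  have AM: "A M \<in> S" "rdb v x \<notin> pos (A M)" using inv[of M] N(2) M by auto
  have uM: "rdb u (lab M) = (\<lambda>h. - \<beta> M h)"
    by (simp add: u_def M A rdb_reflexion_self \<beta>_def)
  have "rdb u (lab N) \<in> Qneg v"
    using N(1) not_pos_iff[OF rootI[OF u(1)] v] by (simp add: good_def \<beta>_def u_def)
  moreover have "rdb u (lab M) \<in> Qneg v"
    using N(2)[of M] M unfolding uM uminus_Qneg by (simp add: good_def pos_def)
  moreover have labs: "{x, y} = {lab M, lab N}" "lab M \<noteq> lab N" using xy by (auto simp: lab_def M)
  ultimately have neg_u: "rdb u p \<in> Qneg v" if "p \<in> {x, y}" for p using that by auto
  have opp: "\<exists>z\<in>{x, y}. rdb u z = (\<lambda>h. - rdb v q h)" if "q \<in> {x, y}" for q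
    using residue_opposite[OF v u(1,2) neg_u that] .
  have opp': "rdb u (lab M) = (\<lambda>h. - rdb v q h) \<or> rdb u (lab N) = (\<lambda>h. - rdb v q h)"
    if "q \<in> {x, y}" for q
    using opp[OF that] unfolding labs(1) by simp
  have card: "card (pos v \<inter> {comb v c | c. \<forall>w. w \<notin> {x, y} \<longrightarrow> c w = 0}) = Suc M"
    using residue_pos_diff[OF v u(1,2) opp] u(3) M(1) by simp
  \<comment> \<open>Otherwise the last step would flip \<open>b(x)\<close>, which has been negative
    ever since the first step.\<close>
  have "rdb u (lab M) \<noteq> (\<lambda>h. - rdb v x h)"
  proof
    assume "rdb u (lab M) = (\<lambda>h. - rdb v x h)"
    then have "\<beta> M = rdb v x" unfolding uM by (auto simp: fun_eq_iff)
    then show False using AM(2) simple_pos[OF AM(1), of "lab M"] by (simp add: \<beta>_def)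
  qed
  then have uN: "rdb u (lab N) = (\<lambda>h. - rdb v x h)" using opp'[of x] by blast
  have "rdb v x \<noteq> rdb v y"
  proof
    assume "rdb v x = rdb v y"
    then have "comb v (\<lambda>z. of_bool (z = x)) = comb v (\<lambda>z. of_bool (z = y))" by (simp add: comb_delta)
    then have "of_bool (x = x) = (of_bool (x = y) :: complex)"
      unfolding comb_eq_iff[OF rd[OF v]] by (rule fun_cong)
    then show False using xy by simp
  qed
  then have "rdb u (lab N) \<noteq> (\<lambda>h. - rdb v y h)" unfolding uN by (auto simp: fun_eq_iff)
  then have "rdb u (lab M) = (\<lambda>h. - rdb v y h)" using opp'[of y] by blast
  then show thesis
    using that[OF card u(1,2,4)] uN by (auto simp: lab_def M split: if_splits)
qed

section \<open>Confluence and normal forms\<close>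

lemma toward_local_confluence:
  assumes v: "v \<in> S" and t: "t \<in> S" and neg: "rdb v x \<notin> pos t" "rdb v y \<notin> pos t"
  shows "\<exists>w. (reflexion x v, w) \<in> (toward t)\<^sup>* \<and> (reflexion y v, w) \<in> (toward t)\<^sup>*"
proof (cases "x = y")
  case xy: False
  have ry: "reflectable v y" and rx: "reflectable v x"
    using reflectable_of_negative[OF v t] neg by blast+
  \<comment> \<open>The crosswise choice of entries symmetrizes the two by two matrix. It is nonzero
    because both labels are reflectable, so the off-diagonal entries vanish together; in that case
    constant weights serve.\<close>
  define s where "s p = (if cartan v x y = 0 then 1 else if p = x then cartan v y x else cartan v x y)" for p
  have zero: "cartan v x y = 0 \<longleftrightarrow> cartan v y x = 0"
    using cartan_sym[OF v rx, of y] cartan_sym[OF v ry, of x] by blast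
  have sym: "\<forall>p\<in>{x, y}. \<forall>q\<in>{x, y}. s p * cartan v p q = s q * cartan v q p"
    using zero xy by (auto simp: s_def)
  have nz: "s p \<noteq> 0" if "p \<in> {x, y}" for p using zero by (auto simp: s_def)
  obtain M u where M: "card (pos v \<inter> {comb v c | c. \<forall>w. w \<notin> {x, y} \<longrightarrow> c w = 0}) = Suc M"
    and u: "u \<in> S" "residue {x, y} s v u" "(reflexion x v, u) \<in> (toward t)\<^sup>*"
    and ub: "rdb u (if even M then x else y) = (\<lambda>h. - rdb v y h)"
    "rdb u (if even M then y else x) = (\<lambda>h. - rdb v x h)"
    using alternating_path[OF v t xy neg sym] by blast
  have yx: "{y, x} = {x, y}" by auto
  obtain M' u' where M': "card (pos v \<inter> {comb v c | c. \<forall>w. w \<notin> {x, y} \<longrightarrow> c w = 0}) = Suc M'"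
    and u': "u' \<in> S" "residue {x, y} s v u'" "(reflexion y v, u') \<in> (toward t)\<^sup>*"
    and ub': "rdb u' (if even M' then y else x) = (\<lambda>h. - rdb v x h)"
    "rdb u' (if even M' then x else y) = (\<lambda>h. - rdb v y h)"
    using alternating_path[OF v t xy[symmetric] neg(2,1), of s, unfolded yx, OF sym] by blast
  \<comment> \<open>Both alternations flip the same set of roots; equal parity then puts equal roots
    on equal labels.\<close>
  have "M' = M" using M M' by simp
  then have eq: "rdb u p = rdb u' p" if "p \<in> {x, y}" for p
    using that ub ub' by (cases "even M") auto
  have "u = u'" by (rule residue_unique[OF v u(1) u'(1) u(2) u'(2) nz eq])
  then show ?thesis using u(3) u'(3) by blast
qed blast

lemma toward_normal_form:
  assumes t: "t \<in> S" and u: "u \<in> S"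
  shows "\<exists>w. (u, w) \<in> (toward t)\<^sup>* \<and> w \<notin> Domain (toward t)"
  using u
proof (induction "card (pos u - pos t)" arbitrary: u rule: less_induct)
  case less
  show ?case
  proof (cases "u \<in> Domain (toward t)")
    case True
    then obtain u' where u': "(u, u') \<in> toward t" by blast
    have "card (pos u' - pos t) < card (pos u - pos t)" using toward_card[OF u' t] by simp
    from less.hyps[OF this] toward_S[OF u'] obtain w where
      "(u', w) \<in> (toward t)\<^sup>*" "w \<notin> Domain (toward t)" by blast
    then show ?thesis using u' by (meson converse_rtrancl_into_rtrancl)
  qed blast
qed

text \<open>Newman's lemma by induction on the number of roots separating \<open>u\<close> from
  \<open>t\<close>: both branches reach the normal form \<open>n\<close> of the common reduct, and
  each has a unique normal form by induction.\<close>

lemma toward_normal_form_unique: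
  assumes t: "t \<in> S" and u: "u \<in> S"
    and "(u, w) \<in> (toward t)\<^sup>*" "w \<notin> Domain (toward t)"
    and "(u, w') \<in> (toward t)\<^sup>*" "w' \<notin> Domain (toward t)"
  shows "w = w'"
  using assms(2-)
proof (induction "card (pos u - pos t)" arbitrary: u w w' rule: less_induct)
  case less
  show ?case
  proof (cases "u \<in> Domain (toward t)")
    case False
    then have "u = w" "u = w'" using less.prems(2,4) by (auto elim: converse_rtranclE)
    then show ?thesis by simp
  next
    case True
    then have "u \<noteq> w" "u \<noteq> w'" using less.prems(3,5) by auto
    then obtain u1 u2 where u1: "(u, u1) \<in> toward t" "(u1, w) \<in> (toward t)\<^sup>*"
      and u2: "(u, u2) \<in> toward t" "(u2, w') \<in> (toward t)\<^sup>*"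
      using less.prems(2,4) by (meson converse_rtranclE)
    obtain x y where "u1 = reflexion x u" "u2 = reflexion y u" "rdb u x \<notin> pos t" "rdb u y \<notin> pos t"
      using u1(1) u2(1) by (auto simp: toward_def)
    then obtain z where z: "(u1, z) \<in> (toward t)\<^sup>*" "(u2, z) \<in> (toward t)\<^sup>*"
      using toward_local_confluence[OF less.prems(1) t] by blast
    have S: "u1 \<in> S" "u2 \<in> S" using toward_S u1 u2 by blast+
    obtain n where n: "(z, n) \<in> (toward t)\<^sup>*" "n \<notin> Domain (toward t)"
      using toward_normal_form[OF t toward_rtrancl_S[OF z(1) S(1)]] by blast
    have "w = n"
      using less.hyps[OF _ S(1) u1(2) less.prems(3) rtrancl_trans[OF z(1) n(1)] n(2)]
        toward_card[OF u1(1) t] by simp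
    moreover have "w' = n"
      using less.hyps[OF _ S(2) u2(2) less.prems(5) rtrancl_trans[OF z(2) n(1)] n(2)]
        toward_card[OF u2(1) t] by simp
    ultimately show ?thesis by simp
  qed
qed

text \<open>The object \<open>t\<close> is a normal form, as its simple roots are positive at
  \<open>t\<close>. Reaching \<open>t\<close> propagates along a chain from \<open>t\<close>: if the
  reflexion from \<open>w\<close> to \<open>w'\<close> is a step toward \<open>t\<close>, uniqueness
  of normal forms applies at \<open>w\<close>; otherwise the reverse reflexion is such a step and
  prolongs the walk from \<open>w\<close>.\<close>

lemma toward_target:
  assumes t: "t \<in> S" and u: "u \<in> S"
  shows "(u, t) \<in> (toward t)\<^sup>*"
proof -
  have normal: "t \<notin> Domain (toward t)" using simple_pos[OF t] by (auto simp: toward_def)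
  from conn[OF t u] have "(u, t) \<in> (toward t)\<^sup>* \<and> u \<in> S"
  proof induction
    case (step w w')
    then have w: "w \<in> S" "(w, t) \<in> (toward t)\<^sup>*" by auto
    obtain x where x: "w' = reflexion x w" "reflectable w x"
      using step by (auto simp: reflexion_step_def)
    have w': "w' \<in> S" using closed w x by simp
    show ?case
    proof (cases "rdb w x \<in> pos t")
      case True
      have "rdb w' x \<notin> pos t"
        using neg_pos_iff[OF w(1) x(2) t] True by (simp add: x(1) rdb_reflexion_self)
      moreover have "reflectable w' x" "reflexion x w' = w"
        using reflectable_reflexion[OF rd[OF w(1)] x(2)] reflexion_reflexion[OF rd[OF w(1)]] x(1)
        by simp_all
      ultimately have "(w', w) \<in> toward t" using w' by (force simp: toward_def)
      then show ?thesis using w w' by (meson converse_rtrancl_into_rtrancl)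
    next
      case False
      then have ww': "(w, w') \<in> toward t" using w x by (auto simp: toward_def)
      obtain n where n: "(w', n) \<in> (toward t)\<^sup>*" "n \<notin> Domain (toward t)"
        using toward_normal_form[OF t w'] by blast
      have "t = n"
        by (rule toward_normal_form_unique[OF t w(1,2) normal converse_rtrancl_into_rtrancl[OF ww' n(1)] n(2)])
      then show ?thesis using n w' by simp
    qed
  qed (use t in simp)
  then show ?thesis by simp
qed

lemma sk_dist_eq_card:
  assumes v: "v \<in> S" and t: "t \<in> S"
  shows "sk_dist v t = card (pos v - pos t)"
proof -
  obtain n where n: "(v, t) \<in> toward t ^^ n"
    using toward_target[OF t v] rtrancl_imp_relpow by blast
  then have "card (pos v - pos t) = n" using toward_relpow_card[OF n t] by simp
  moreover have "(v, w) \<in> toward t ^^ k \<Longrightarrow> (v, w) \<in> reflexion_step ^^ k" for w k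
    using toward_step by (induction k arbitrary: w) fastforce+
  with n have "(v, t) \<in> reflexion_step ^^ n" by blast
  ultimately show ?thesis
    unfolding sk_dist_def by (intro Least_equality) (auto dest: card_pos_diff_le[OF _ v])
qed

end

section \<open>The skeleton of an admissible component\<close>

lemma Sk_arrow:
  assumes "is_root_datum v0" "v \<in> Sk v0"
  shows "is_root_datum v \<and> arrow v0 id v"
proof -
  have "(v0, v) \<in> reflexion_step\<^sup>*" using assms by (simp add: Sk_def)
  then show ?thesis
  proof induction
    case (step u w)
    then obtain x where x: "w = reflexion x u" "reflectable u x" by (auto simp: reflexion_step_def)
    have "arrow v0 (id \<circ> id) w"
      using step.IH arrow_reflexion[of u x] x by (blast intro: arrow_comp)
    then have "arrow v0 id w" by (simp only: comp_id)
    then show ?case using step.IH is_root_datum_reflexion x by blast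
  qed (rule conjI[OF assms(1) arrow_id[OF assms(1)]])
qed

lemma Sk_arrow_between:
  assumes "is_root_datum v0" "v \<in> Sk v0" "w \<in> Sk v0"
  shows "arrow v id w"
proof -
  have "arrow v (inv id) v0" using Sk_arrow[OF assms(1,2)] by (blast intro: arrow_inv)
  then have "arrow v (id \<circ> inv id) w" using Sk_arrow[OF assms(1,3)] by (blast intro: arrow_comp)
  then show ?thesis by simp
qed

lemma Sk_connected:
  assumes v0: "is_root_datum v0" and v: "v \<in> Sk v0" and w: "w \<in> Sk v0"
  shows "(v, w) \<in> reflexion_step\<^sup>*"
proof -
  have "(v0, v) \<in> reflexion_step\<^sup>*" using v by (simp add: Sk_def)
  then have "(v, v0) \<in> reflexion_step\<^sup>*"
  proof induction
    case (step u u')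
    then obtain x where x: "u' = reflexion x u" "reflectable u x" by (auto simp: reflexion_step_def)
    have u: "is_root_datum u" using Sk_arrow[OF v0, of u] step by (simp add: Sk_def)
    have "reflectable u' x" "u = reflexion x u'"
      using reflectable_reflexion[OF u x(2)] reflexion_reflexion[OF u] x(1) by simp_all
    then have "(u', u) \<in> reflexion_step" by (auto simp: reflexion_step_def)
    then show ?case using step.IH by (rule converse_rtrancl_into_rtrancl)
  qed simp
  moreover have "(v0, w) \<in> reflexion_step\<^sup>*" using w by (simp add: Sk_def)
  ultimately show ?thesis by (rule rtrancl_trans)
qed

lemma skeleton_Sk:
  fixes v0 :: "('h::fd_complex_vector, 'x::finite) root_datum"
  assumes v0: "is_root_datum v0" and adm: "admissible (component v0)"
  shows "skeleton (Sk v0)"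
proof -
  obtain J where J: "\<And>v. v \<in> component v0 \<Longrightarrow> lie_ideal v (J v)"
    and iso: "\<And>v v'. v \<in> component v0 \<Longrightarrow> v' \<in> component v0 \<Longrightarrow> arrow v id v' \<Longrightarrow>
        \<exists>f. ideal_hom (J v) (J v') f"
    using admissible_ideals[OF adm] by blast
  have comp: "v \<in> component v0" if "v \<in> Sk v0" for v
    using Sk_arrow[OF v0 that] by (auto simp: component_def)
  have hom: "\<exists>f. lie_hom v (J v) w (J w) f" if vw: "v \<in> Sk v0" "w \<in> Sk v0" for v w
  proof -
    obtain f where "ideal_hom (J v) (J w) f"
      using iso[OF comp[OF vw(1)] comp[OF vw(2)] Sk_arrow_between[OF v0 vw]] by blast
    moreover have "lie_quotient u (J u)" if "u \<in> Sk v0" for u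
      using J[OF comp[OF that]] Sk_arrow[OF v0 that] by (simp add: lie_quotient_def)
    ultimately have "lie_hom v (J v) w (J w) f"
      using vw by (simp add: lie_hom_def lie_hom_axioms_def)
    then show ?thesis by blast
  qed
  have closed: "reflexion x v \<in> Sk v0" if "v \<in> Sk v0" "reflectable v x" for v x
    using that unfolding Sk_def
    by (auto simp: reflexion_step_def intro!: rtrancl_into_rtrancl[of v0 v])
  have coroot: "\<exists>c. c \<noteq> 0 \<and> rda v x = c *\<^sub>C rda w y"
    if vw: "v \<in> Sk v0" "w \<in> Sk v0" and eq: "rdb v x = rdb w y" for v w x y
    using hom[OF vw] lie_hom.coroot_proportional[OF _ eq] by blast
  have sym: "cartan v y x = 0" if v: "v \<in> Sk v0" and r: "reflectable v x" and xy: "cartan v x y = 0"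
    for v x y
  proof (cases "y = x")
    case yx: False
    have v': "reflexion x v \<in> Sk v0" by (rule closed[OF v r])
    have y: "rdb (reflexion x v) y = rdb v y"
      using xy yx by (simp add: rdb_reflexion refl_b_def)
    \<comment> \<open>As \<open>cartan v x y\<close> vanishes, the reflexion fixes
      \<open>b(y)\<close>. In the isotropic case the comparison of \<open>e_x\<close> with
      \<open>f_x\<close> applies. In the anisotropic case the new coroot at \<open>y\<close> must be
      proportional to the old one, so the multiple of \<open>a(x)\<close> added to it, given by
      \<open>cartan v y x\<close>, is zero.\<close>
    show ?thesis
    proof (cases "cartan v x x = 0")
      case True
      obtain f where f: "lie_hom v (J v) (reflexion x v) (J (reflexion x v)) f"
        using hom[OF v v'] by blast
      show ?thesis
        by (rule lie_hom.cartan_zero_of_opposite[OF f yx[symmetric] rdb_reflexion_self y])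
    next
      case False
      obtain c where "rda (reflexion x v) y = c *\<^sub>C rda v y" using coroot[OF v' v y] by blast
      then have "acomb v (\<lambda>z. of_bool (z = y) + (if z = x then refl_a v x y else 0)) =
          acomb v (\<lambda>z. if z = y then c else 0)"
        by (simp only: rda_reflexion_acomb acomb_unit)
      then have "of_bool (x = y) + (if x = x then refl_a v x y else 0) = (if x = y then c else 0)"
        unfolding acomb_eq_iff[OF conjunct1[OF Sk_arrow[OF v0 v]]] by (rule fun_cong)
      then show ?thesis using yx False by (simp add: refl_a_def)
    qed
  qed (use xy in simp)
  show ?thesis
  proof
    show "is_root_datum v" if "v \<in> Sk v0" for v using Sk_arrow[OF v0 that] by simp
    show "rdb v x \<in> Qpos w \<union> Qneg w" if "v \<in> Sk v0" "w \<in> Sk v0" for v w x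
      using hom[OF that] lie_hom.simple_root_sign by blast
  qed (fact closed Sk_connected[OF v0] coroot sym)+
qed

theorem proposition5p3p9:
  fixes v0 v v' :: "('h::fd_complex_vector, 'x::finite) root_datum"
  assumes "is_root_datum v0"
    and "indecomposable (component v0)"
    and "admissible (component v0)"
    and "v \<in> Sk v0" and "v' \<in> Sk v0"
  shows "finite (pos_real_roots v0 v - pos_real_roots v0 v') \<and>
         sk_dist v v' = card (pos_real_roots v0 v - pos_real_roots v0 v')"
proof -
  interpret skeleton "Sk v0" using assms(1,3) by (rule skeleton_Sk)
  have "pos_real_roots v0 u = pos u" for u
    by (simp add: pos_real_roots_def pos_def roots_def real_roots_def Qpos_def comb_def)
  then show ?thesis using finite_pos_diff sk_dist_eq_card assms(4,5) by simp
qed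

end
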